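(* For all diverging $d$ and $n$ with $n\le 2^d$ and all nilpotent groups $G$ of size $n$ (implicitly sequences $d_N,n_N\to\infty$, $G_N$, $k_N$), if $k-\log_2 n\gg1$ and $\log k\ll\log n$, then $$t_{\mathrm{mix}}(G_k)/t_{\mathrm{mix}}(H_k)\le 1+o(1)\quad\text{with high probability},\qquad\text{where } H:=\mathbb Z_2^d.$$
   Context: Conventions. All objects are implicitly sequences indexed by $N\to\infty$; the index is suppressed. $a\ll b$ (equivalently $b\gg a$) means $a/b\to0$. Random Cayley graph and walk. For a finite group $G$ and a multiset $Z=[Z_1,\dots,Z_k]$ of elements of $G$, the directed (undirected) Cayley graph $G^+(Z)$ ($G^-(Z)$) is the multigraph with vertex set $G$ and edges $(g,gz)$ (respectively $\{g,gz\}$) for $g\in G$, $z\in Z$. The random walk (RW) is in continuous time at rate 1, started from the identity: at each step, from $g$, $z\in Z$ is chosen uniformly and the walk moves to $gz$ for $G^+(Z)$, or to one of $gz$, $gz^{-1}$ with probability $1/2$ each for $G^-(Z)$. $G_k^\pm := G^\pm(Z)$ with $Z_1,\dots,Z_k$ i.i.d. uniform on $G$; $G_k$ means either, and the statement holds in both cases (the same sign for both groups). Mixing time comparison. For a Cayley graph $H$, $d_H(t)$ is the total variation distance between the law of the RW at time $t$ and the uniform distribution, and $t_{\mathrm{mix}}(\varepsilon,H)=\inf\{t\ge0: d_H(t)\le\varepsilon\}$. For two sequences $(H_N)$, $(H'_N)$ of random Cayley graphs, "$t_{\mathrm{mix}}(H)/t_{\mathrm{mix}}(H')\le1+o(1)$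 with high probability" means: there exist non-random sequences $(\gamma_N)$ and $(\delta_N)$ with $\lim_N\delta_N=0$ such that, for all $\varepsilon,\varepsilon'\in(0,1)$, $$\lim_{N\to\infty}\mathbb P\big(t_{\mathrm{mix}}(\varepsilon,H_N)\le(1+\delta_N)\gamma_N\big)=1=\lim_{N\to\infty}\mathbb P\big((1-\delta_N)\gamma_N\le t_{\mathrm{mix}}(\varepsilon',H'_N)\big).$$ *)

theory Defs
  imports "HOL-Algebra.Elementary_Groups" "HOL-Algebra.Product_Groups"
    "HOL-Algebra.Generated_Groups" "HOL-Probability.Probability"
begin

primrec lower_central :: "('a, 'b) monoid_scheme \<Rightarrow> nat \<Rightarrow> 'a set" where
  "lower_central G 0 = carrier G"
| "lower_central G (Suc i) = generate G
     (\<Union>x \<in> lower_central G i. \<Union>y \<in> carrier G.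
        {x \<otimes>\<^bsub>G\<^esub> y \<otimes>\<^bsub>G\<^esub> inv\<^bsub>G\<^esub> x \<otimes>\<^bsub>G\<^esub> inv\<^bsub>G\<^esub> y})"

definition nilpotent_group :: "('a, 'b) monoid_scheme \<Rightarrow> bool" where
  "nilpotent_group G \<longleftrightarrow> group G \<and> (\<exists>c. lower_central G c = {\<one>\<^bsub>G\<^esub>})"

definition Z2_power :: "nat \<Rightarrow> (nat \<Rightarrow> int) monoid" where
  "Z2_power d = product_group {..<d} (\<lambda>_. integer_mod_group 2)"

datatype direction = Directed | Undirected

(* The multiset Z must be nonempty, since pmf_of_multiset is unspecified on {#}. *)
definition cayley_step ::
    "direction \<Rightarrow> ('a, 'b) monoid_scheme \<Rightarrow> 'a multiset \<Rightarrow> 'a \<Rightarrow> 'a pmf" where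
  "cayley_step s G Z g =
     (case s of
        Directed \<Rightarrow> map_pmf (\<lambda>z. g \<otimes>\<^bsub>G\<^esub> z) (pmf_of_multiset Z)
      | Undirected \<Rightarrow>
          do {
            z \<leftarrow> pmf_of_multiset Z;
            forward \<leftarrow> bernoulli_pmf (1 / 2);
            return_pmf (g \<otimes>\<^bsub>G\<^esub> (if forward then z else inv\<^bsub>G\<^esub> z))
          })"

primrec cayley_walk ::
    "direction \<Rightarrow> ('a, 'b) monoid_scheme \<Rightarrow> 'a multiset \<Rightarrow> nat \<Rightarrow> 'a pmf" where
  "cayley_walk s G Z 0 = return_pmf \<one>\<^bsub>G\<^esub>"
| "cayley_walk s G Z (Suc m) = bind_pmf (cayley_walk s G Z m) (cayley_step s G Z)"

(* The walk jumps at the points of a rate-1 Poisson process, so the number of jumps by time t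
   has the Poisson distribution of parameter t. The library's poisson_pmf is specified only for
   positive parameters, whence the separate case t = 0. *)
definition jumps_pmf :: "real \<Rightarrow> nat pmf" where
  "jumps_pmf t = (if t = 0 then return_pmf 0 else poisson_pmf t)"

definition cayley_rw ::
    "direction \<Rightarrow> ('a, 'b) monoid_scheme \<Rightarrow> 'a multiset \<Rightarrow> real \<Rightarrow> 'a pmf" where
  "cayley_rw s G Z t = bind_pmf (jumps_pmf t) (cayley_walk s G Z)"

definition tv_dist :: "'a pmf \<Rightarrow> 'a pmf \<Rightarrow> real" where
  "tv_dist p q = (SUP A. \<bar>measure_pmf.prob p A - measure_pmf.prob q A\<bar>)"

(* Infinite if the walk never gets within the given distance of uniformity, as when Z does not
   generate G. *)
definition t_mix ::
    "direction \<Rightarrow> ('a, 'b) monoid_scheme \<Rightarrow> 'a multiset \<Rightarrow> real \<Rightarrow> ereal" where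
  "t_mix s G Z \<epsilon> =
     Inf (ereal ` {t. 0 \<le> t \<and> tv_dist (cayley_rw s G Z t) (pmf_of_set (carrier G)) \<le> \<epsilon>})"

definition random_generators :: "('a, 'b) monoid_scheme \<Rightarrow> nat \<Rightarrow> 'a multiset pmf" where
  "random_generators G k = map_pmf mset (replicate_pmf k (pmf_of_set (carrier G)))"

(* PG N and PH N are the laws of the generating multisets of the N-th random Cayley graphs. *)
definition t_mix_ratio_le_1_whp ::
    "direction \<Rightarrow> (nat \<Rightarrow> ('a, 'b) monoid_scheme) \<Rightarrow> (nat \<Rightarrow> 'a multiset pmf)
      \<Rightarrow> (nat \<Rightarrow> ('c, 'd) monoid_scheme) \<Rightarrow> (nat \<Rightarrow> 'c multiset pmf) \<Rightarrow> bool" where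
  "t_mix_ratio_le_1_whp s G PG H PH \<longleftrightarrow>
     (\<exists>(\<gamma> :: nat \<Rightarrow> real) (\<delta> :: nat \<Rightarrow> real).
        \<delta> \<longlonglongrightarrow> 0 \<and>
        (\<forall>\<epsilon>\<in>{0<..<1}. \<forall>\<epsilon>'\<in>{0<..<1}.
           (\<lambda>N. measure_pmf.prob (PG N)
                 {Z. t_mix s (G N) Z \<epsilon> \<le> ereal ((1 + \<delta> N) * \<gamma> N)}) \<longlonglongrightarrow> 1 \<and>
           (\<lambda>N. measure_pmf.prob (PH N)
                 {Z. ereal ((1 - \<delta> N) * \<gamma> N) \<le> t_mix s (H N) Z \<epsilon>'}) \<longlonglongrightarrow> 1))"

end

(* A word with Poisson(t) letters drives the walk on every group, so both mixing times are compared with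
   the entropy of its exponent vector W modulo 2, whose k coordinates are independent and odd with
   probability (1 - L) / 2, L = exp (- 2 t / k). Let L0 be the value of L at the time when this entropy
   equals ln n.

   Before that time W modulo 2 lies with high probability in a set of size o(n), and n <= 2 ^ d, so the walk
   on H is far from uniform whatever the generators are.

   After it, restrict the law of the walk on G to the words with about the expected number of odd exponents
   and bound its expected squared L2 norm by the collisions of two independent words. A central series
   of G with factors of prime order shows that a word with exponent vector v is trivial with probability
   at most 1 / n times the product of those primes q (with multiplicity) that divide v; this is at most
   1 / n plus the average, over the prime factors q of n, of the indicator that q divides v. For every prime
   q, a typical W agrees modulo q with an independent copy with probability at most the bound for q = 2,
   which is o(1 / n). *)
theory Submission
  imports Defs "HOL-Analysis.FPS_Convergence" "HOL-Algebra.Multiplicative_Group"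
    "HOL-Real_Asymp.Real_Asymp"
begin

text \<open>The restriction to typical words looks only at parities, even when \<open>q\<close> is
  odd and the law of the exponents modulo \<open>q\<close> has no comparable closed form. What makes
  one typical set serve all primes is the weight \<open>1 - L * parity x\<close>: it is an
  exponential tilt towards odd exponents, hence a product over coordinates, and its one-coordinate
  collision value \<open>(1 - L ^ 2) / 2\<close> is exact for q = 2 and an upper bound for every odd
  prime. The product of primes lost along a central series can be as large as \<open>n\<close>.
  Trading it for an average makes the loss linear in the events that \<open>q\<close> divides the
  exponents, so neither the number nor the size of the prime factors enters. All errors are governed
  by Y = k L0^2 (1 - L0). Changing the time by a factor 1 + \<eta> or 1 - \<eta> gains a factor
  exp(- c \<eta> Y) in the counting and costs C / (\<eta>^2 Y) in Chebyshev's inequality, so a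
  window with \<eta> tending to 0 exists as soon as Y diverges. That is where the hypotheses on k
  are used: k - log2 n controls Y when L0 is at most 1/2, and ln n / ln k controls it when L0 is
  larger.\<close>

section \<open>Expectations of bounded functions and Poisson mixtures\<close>

lemma expectation_bind_bounded:
  fixes f :: "'a \<Rightarrow> real"
  assumes "\<And>x. \<bar>f x\<bar> \<le> B"
  shows "measure_pmf.expectation (bind_pmf p q) f
    = measure_pmf.expectation p (\<lambda>x. measure_pmf.expectation (q x) f)"
  unfolding measure_pmf_bind
  by (rule integral_bind[where K = "count_space UNIV" and B = B and B' = 1])
     (auto simp: assms measure_pmf.emeasure_space_1 measure_pmf_in_subprob_algebra
       intro!: measure_pmf.finite_measure measurable_pmf_measure1)

lemma expectation_pair_bounded:
  fixes f :: "'a \<times> 'b \<Rightarrow> real"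
  assumes "\<And>x. \<bar>f x\<bar> \<le> B"
  shows "measure_pmf.expectation (pair_pmf p q) f
    = measure_pmf.expectation p (\<lambda>x. measure_pmf.expectation q (\<lambda>y. f (x, y)))"
  unfolding pair_pmf_def
  by (subst expectation_bind_bounded[OF assms], subst expectation_bind_bounded[OF assms]) simp

lemma expectation_commute_bounded:
  fixes f :: "'a \<Rightarrow> 'b \<Rightarrow> real"
  assumes "\<And>x y. \<bar>f x y\<bar> \<le> B"
  shows "measure_pmf.expectation p (\<lambda>x. measure_pmf.expectation q (f x))
    = measure_pmf.expectation q (\<lambda>y. measure_pmf.expectation p (\<lambda>x. f x y))"
proof -
  have "measure_pmf.expectation p (\<lambda>x. measure_pmf.expectation q (f x))
     = measure_pmf.expectation (pair_pmf p q) (\<lambda>z. f (fst z) (snd z))"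
    by (subst expectation_pair_bounded[where B = B]) (auto simp: assms)
  also have "\<dots> = measure_pmf.expectation (map_pmf prod.swap (pair_pmf q p)) (\<lambda>z. f (fst z) (snd z))"
    by (subst (1) pair_commute_pmf) (simp add: case_prod_unfold prod.swap_def)
  also have "\<dots> = measure_pmf.expectation q (\<lambda>y. measure_pmf.expectation p (\<lambda>x. f x y))"
    by (simp, subst expectation_pair_bounded[where B = B]) (auto simp: assms)
  finally show ?thesis .
qed

lemma integrable_pmf_bounded:
  fixes f :: "'a \<Rightarrow> real"
  assumes "\<And>x. \<bar>f x\<bar> \<le> B"
  shows "integrable (measure_pmf p) f"
  by (rule measure_pmf.integrable_const_bound[where B = B]) (auto simp: assms)

lemma expectation_abs_le:
  fixes f :: "'a \<Rightarrow> real"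
  assumes "\<And>x. \<bar>f x\<bar> \<le> B"
  shows "\<bar>measure_pmf.expectation p f\<bar> \<le> B"
proof -
  have int: "integrable (measure_pmf p) f"
    by (rule integrable_pmf_bounded) (rule assms)
  have "measure_pmf.expectation p f \<le> B"
    by (rule measure_pmf.integral_le_const[OF int]) (use assms abs_le_D1 in auto)
  moreover have "- B \<le> measure_pmf.expectation p f"
  proof (rule measure_pmf.integral_ge_const[OF int])
    have "- B \<le> f x" for x using assms[of x] by linarith
    then show "AE x in measure_pmf p. - B \<le> f x" by simp
  qed
  ultimately show ?thesis by simp
qed

text \<open>Writing the Poisson mixture as a power series in t is what later allows independence of
  the coordinates to be read off from coefficients.\<close>

lemma expectation_jumps_sums:
  fixes h :: "nat \<Rightarrow> real"
  assumes "\<And>m. \<bar>h m\<bar> \<le> B" "0 \<le> t"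
  shows "(\<lambda>m. t ^ m / fact m * exp (- t) * h m) sums measure_pmf.expectation (jumps_pmf t) h"
proof (cases "t = 0")
  case True
  \<comment> \<open>Since \<open>0 ^ 0 = 1\<close>, exactly the term m = 0 survives, in agreement
    with the point mass chosen for \<open>jumps_pmf 0\<close>.\<close>
  have "(\<lambda>m. 0 ^ m / fact m * exp (- 0) * h m) = (\<lambda>m. if m = 0 then h m else 0)"
    by (auto simp: fun_eq_iff)
  then show ?thesis
    using True sums_single[of 0 h] by (simp add: jumps_pmf_def)
next
  case False
  then have t: "t > 0" using assms by simp
  have int: "integrable (measure_pmf (poisson_pmf t)) h"
    by (rule integrable_pmf_bounded) (rule assms)
  have "integrable (count_space UNIV) (\<lambda>m. pmf (poisson_pmf t) m *\<^sub>R h m)"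
    using int unfolding measure_pmf_eq_density by (subst (asm) integrable_density) auto
  then have "(\<lambda>m. pmf (poisson_pmf t) m *\<^sub>R h m) sums
      integral\<^sup>L (count_space UNIV) (\<lambda>m. pmf (poisson_pmf t) m *\<^sub>R h m)"
    by (rule sums_integral_count_space_nat)
  also have "integral\<^sup>L (count_space UNIV) (\<lambda>m. pmf (poisson_pmf t) m *\<^sub>R h m)
      = measure_pmf.expectation (poisson_pmf t) h"
    unfolding measure_pmf_eq_density by (subst integral_density) auto
  finally show ?thesis using t by (simp add: jumps_pmf_def)
qed

section \<open>Random words and their exponents\<close>

text \<open>The directed and the undirected walk differ only in this law; everything that depends on
  the direction passes through it.\<close>

definition sign_pmf :: "direction \<Rightarrow> int pmf" where
  "sign_pmf s = (case s of Directed \<Rightarrow> return_pmf 1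
     | Undirected \<Rightarrow> map_pmf (\<lambda>b. if b then 1 else - 1) (bernoulli_pmf (1 / 2)))"

definition letter_pmf :: "direction \<Rightarrow> nat \<Rightarrow> (nat \<times> int) pmf" where
  "letter_pmf s k = bind_pmf (pmf_of_set {..<k}) (\<lambda>i. map_pmf (Pair i) (sign_pmf s))"

definition word_pmf :: "direction \<Rightarrow> nat \<Rightarrow> real \<Rightarrow> (nat \<times> int) list pmf" where
  "word_pmf s k t = bind_pmf (jumps_pmf t) (\<lambda>m. replicate_pmf m (letter_pmf s k))"

text \<open>The head of a word is its last letter, so that prepending a letter is a step of the walk.\<close>

primrec expo :: "(nat \<times> int) list \<Rightarrow> nat \<Rightarrow> int" where
  "expo [] = (\<lambda>_. 0)"
| "expo (x # w) = (expo w)(fst x := expo w (fst x) + snd x)"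

text \<open>The transition operator of the exponent of a single generator, acting on test
  functions.\<close>

definition shift_avg :: "direction \<Rightarrow> (int \<Rightarrow> real) \<Rightarrow> int \<Rightarrow> real" where
  "shift_avg s h x = measure_pmf.expectation (sign_pmf s) (\<lambda>e. h (x + e))"

lemma shift_avg_simps:
  "shift_avg Directed h x = h (x + 1)"
  "shift_avg Undirected h x = (h (x + 1) + h (x - 1)) / 2"
  by (auto simp: shift_avg_def sign_pmf_def integral_bernoulli_pmf)

lemma shift_avg_abs_le:
  assumes "\<And>x. \<bar>h x\<bar> \<le> B"
  shows "\<bar>shift_avg s h x\<bar> \<le> B"
  unfolding shift_avg_def by (rule expectation_abs_le) (rule assms)

lemma expectation_letter:
  fixes f :: "nat \<times> int \<Rightarrow> real"
  assumes "k > 0" "\<And>x. \<bar>f x\<bar> \<le> B"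
  shows "measure_pmf.expectation (letter_pmf s k) f
    = (\<Sum>i<k. shift_avg s (\<lambda>e. f (i, e)) 0) / real k"
  unfolding letter_pmf_def
  by (subst expectation_bind_bounded[OF assms(2)])
     (use assms(1) in \<open>auto simp: integral_pmf_of_set shift_avg_def lessThan_empty_iff\<close>)

lemma expectation_replicate_Suc:
  fixes f :: "'a list \<Rightarrow> real"
  assumes "\<And>w. \<bar>f w\<bar> \<le> B"
  shows "measure_pmf.expectation (replicate_pmf (Suc m) p) f
    = measure_pmf.expectation (replicate_pmf m p) (\<lambda>w. measure_pmf.expectation p (\<lambda>x. f (x # w)))"
proof -
  have "measure_pmf.expectation (replicate_pmf (Suc m) p) f
    = measure_pmf.expectation p (\<lambda>x. measure_pmf.expectation (replicate_pmf m p) (\<lambda>w. f (x # w)))"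
    by (simp, subst expectation_bind_bounded[OF assms], subst expectation_bind_bounded[OF assms]) simp
  also have "\<dots> = measure_pmf.expectation (replicate_pmf m p) (\<lambda>w. measure_pmf.expectation p (\<lambda>x. f (x # w)))"
    by (rule expectation_commute_bounded[where B = B]) (rule assms)
  finally show ?thesis .
qed

lemma expectation_word_sums:
  fixes f :: "(nat \<times> int) list \<Rightarrow> real"
  assumes "\<And>w. \<bar>f w\<bar> \<le> B" "0 \<le> t"
  shows "(\<lambda>m. t ^ m / fact m * exp (- t) *
      measure_pmf.expectation (replicate_pmf m (letter_pmf s k)) f)
    sums measure_pmf.expectation (word_pmf s k t) f"
proof -
  have "\<bar>measure_pmf.expectation (replicate_pmf m (letter_pmf s k)) f\<bar> \<le> B" for m
    by (rule expectation_abs_le) (rule assms)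
  from expectation_jumps_sums[OF this assms(2)] show ?thesis
    unfolding word_pmf_def by (subst expectation_bind_bounded[OF assms(1)])
qed

section \<open>Independence of the coordinates\<close>

text \<open>The exponential of u times the operator \<open>shift_avg s\<close>, applied to
  \<open>h\<close> and evaluated at 0, as a formal series in u. Multiplied by exp(- u) it is the
  expectation of \<open>h\<close> after one coordinate has run at rate 1 for time u.\<close>

definition coord_fps :: "direction \<Rightarrow> (int \<Rightarrow> real) \<Rightarrow> real fps" where
  "coord_fps s h = Abs_fps (\<lambda>j. (shift_avg s ^^ j) h 0 / fact j)"

lemma fps_deriv_coord_fps: "fps_deriv (coord_fps s h) = coord_fps s (shift_avg s h)"
proof (rule fps_ext)
  fix j
  have "real (Suc j) * (a / fact (Suc j)) = a / fact j" for a :: real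
    unfolding fact_Suc by (simp del: of_nat_Suc)
  then show "fps_nth (fps_deriv (coord_fps s h)) j = fps_nth (coord_fps s (shift_avg s h)) j"
    by (simp add: coord_fps_def funpow_swap1 del: fact_Suc of_nat_Suc)
qed

lemma fps_deriv_prod:
  fixes F :: "'a \<Rightarrow> 'b::comm_ring_1 fps"
  assumes "finite A"
  shows "fps_deriv (\<Prod>i\<in>A. F i) = (\<Sum>i\<in>A. fps_deriv (F i) * (\<Prod>j\<in>A - {i}. F j))"
  using assms
proof (induction A)
  case (insert a A)
  have "(\<Prod>j\<in>insert a A - {i}. F j) = F a * (\<Prod>j\<in>A - {i}. F j)" if "i \<in> A" for i
  proof -
    have "insert a A - {i} = insert a (A - {i})" using that insert by auto
    then show ?thesis using insert by simp
  qed
  then have "(\<Sum>i\<in>A. fps_deriv (F i) * (\<Prod>j\<in>insert a A - {i}. F j))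
     = F a * (\<Sum>i\<in>A. fps_deriv (F i) * (\<Prod>j\<in>A - {i}. F j))"
    by (simp add: sum_distrib_left mult_ac)
  then show ?case using insert by (simp add: mult_ac)
qed simp

text \<open>Averaging preserves the bound B, so the j-th coefficient is at most B / j! in absolute
  value.\<close>

lemma coord_fps_conv_radius:
  assumes "\<And>x. \<bar>h x\<bar> \<le> B"
  shows "fps_conv_radius (coord_fps s h) = \<infinity>"
  unfolding fps_conv_radius_def
proof (rule conv_radius_inftyI'')
  fix z :: real
  have bd: "\<bar>(shift_avg s ^^ j) h x\<bar> \<le> B" for j x
    by (induction j arbitrary: x) (auto simp: assms intro: shift_avg_abs_le)
  show "summable (\<lambda>j. fps_nth (coord_fps s h) j * z ^ j)"
  proof (rule summable_comparison_test')
    show "summable (\<lambda>j. B * (\<bar>z\<bar> ^ j / fact j))"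
      using summable_exp[of "\<bar>z\<bar>"] by (intro summable_mult) (simp add: field_simps)
    show "norm (fps_nth (coord_fps s h) j * z ^ j) \<le> B * (\<bar>z\<bar> ^ j / fact j)" if "j \<ge> 0" for j
      using mult_right_mono[OF bd[of j 0], of "\<bar>z\<bar> ^ j / fact j"]
      by (simp add: coord_fps_def abs_mult power_abs)
  qed
qed

lemma fps_conv_radius_prod_infty:
  fixes F :: "'a \<Rightarrow> real fps"
  assumes "\<And>i. i \<in> A \<Longrightarrow> fps_conv_radius (F i) = \<infinity>"
  shows "fps_conv_radius (\<Prod>i\<in>A. F i) = \<infinity>"
  using assms
proof (induction A rule: infinite_finite_induct)
  case (insert a A)
  have "fps_conv_radius (F a * (\<Prod>i\<in>A. F i)) \<ge> min (fps_conv_radius (F a)) (fps_conv_radius (\<Prod>i\<in>A. F i))"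
    by (rule fps_conv_radius_mult)
  then show ?case using insert by simp
qed auto

lemma eval_fps_prod_infty:
  fixes F :: "'a \<Rightarrow> real fps"
  assumes "\<And>i. i \<in> A \<Longrightarrow> fps_conv_radius (F i) = \<infinity>"
  shows "eval_fps (\<Prod>i\<in>A. F i) z = (\<Prod>i\<in>A. eval_fps (F i) z)"
  using assms
  by (induction A rule: infinite_finite_induct) (auto simp: eval_fps_mult fps_conv_radius_prod_infty)

lemma fps_prod_nth_0: "fps_nth (\<Prod>i\<in>A. F i) 0 = (\<Prod>i\<in>A. fps_nth (F i) 0)"
  for F :: "'a \<Rightarrow> 'b::comm_ring_1 fps"
  by (induction A rule: infinite_finite_induct) auto

text \<open>Both sides obey the same recursion in m. One more letter picks a coordinate uniformly
  and applies \<open>shift_avg\<close> to the factor of that coordinate; differentiating the product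
  of series does the same by Leibniz' rule. The power of k cancels the uniform choice. The functions
  \<open>f\<close> must stay arbitrary because the induction step replaces one of them by its
  average.\<close>

lemma replicate_product_coeff:
  fixes f :: "nat \<Rightarrow> int \<Rightarrow> real"
  assumes "k > 0" "\<And>i x. \<bar>f i x\<bar> \<le> B"
  shows "real k ^ m / fact m *
      measure_pmf.expectation (replicate_pmf m (letter_pmf s k)) (\<lambda>w. \<Prod>i<k. f i (expo w i))
    = fps_nth (\<Prod>i<k. coord_fps s (f i)) m"
  using assms(2)
proof (induction m arbitrary: f)
  case 0
  show ?case by (simp add: fps_prod_nth_0 coord_fps_def)
next
  case (Suc m)
  let ?E = "measure_pmf.expectation (replicate_pmf m (letter_pmf s k))"
  have B: "B \<ge> 0" using Suc.prems[of 0 0] by linarith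
  have bd: "\<bar>\<Prod>i\<in>A. f i (x i)\<bar> \<le> B ^ card A" if "finite A" for x and A :: "nat set"
    unfolding abs_prod using that prod_mono[of A "\<lambda>i. \<bar>f i (x i)\<bar>" "\<lambda>_. B"] Suc.prems by simp
  have bd1: "\<bar>\<Prod>i<k. f i (x i)\<bar> \<le> B ^ k" for x
    using bd[of "{..<k}" x] by simp
  define g where "g i = f(i := shift_avg s (f i))" for i
  have gb: "\<bar>g i j x\<bar> \<le> B" for i j x
    by (auto simp: g_def Suc.prems intro: shift_avg_abs_le)
  have split: "(\<Prod>j<k. F j) = F i * (\<Prod>j\<in>{..<k} - {i}. F j)" if "i < k" for i and F :: "nat \<Rightarrow> 'c::comm_monoid_mult"
    using that by (subst prod.remove[of _ i]) auto
  have step: "measure_pmf.expectation (letter_pmf s k) (\<lambda>x. \<Prod>j<k. f j (expo (x # w) j))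
     = (\<Sum>i<k. \<Prod>j<k. g i j (expo w j)) / real k" for w
  proof (subst expectation_letter[OF assms(1), where B = "B ^ k"])
    show "\<bar>\<Prod>j<k. f j (expo (x # w) j)\<bar> \<le> B ^ k" for x by (rule bd1)
    have "shift_avg s (\<lambda>e. \<Prod>j<k. f j (expo ((i, e) # w) j)) 0 = (\<Prod>j<k. g i j (expo w j))"
      if "i < k" for i
    proof -
      have 1: "(\<Prod>j\<in>{..<k} - {i}. f j (expo ((i, e) # w) j)) = (\<Prod>j\<in>{..<k} - {i}. f j (expo w j))" for e
        by (rule prod.cong) auto
      have 2: "(\<Prod>j\<in>{..<k} - {i}. g i j (expo w j)) = (\<Prod>j\<in>{..<k} - {i}. f j (expo w j))"
        by (rule prod.cong) (auto simp: g_def)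
      show ?thesis
        unfolding split[OF that] 1 2 by (simp add: shift_avg_def g_def)
    qed
    then show "(\<Sum>i<k. shift_avg s (\<lambda>e. \<Prod>j<k. f j (expo ((i, e) # w) j)) 0) / real k
       = (\<Sum>i<k. \<Prod>j<k. g i j (expo w j)) / real k" by simp
  qed
  have fin: "finite (set_pmf (replicate_pmf m (letter_pmf s k)))"
  proof -
    have "finite (set_pmf (letter_pmf s k))"
      using assms(1) by (auto simp: letter_pmf_def sign_pmf_def lessThan_empty_iff split: direction.split)
    then show ?thesis
      by (simp add: set_replicate_pmf finite_lists_length_eq lists_eq_set)
  qed
  have "measure_pmf.expectation (replicate_pmf (Suc m) (letter_pmf s k)) (\<lambda>w. \<Prod>i<k. f i (expo w i))
      = ?E (\<lambda>w. (\<Sum>i<k. \<Prod>j<k. g i j (expo w j)) / real k)"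
    by (subst expectation_replicate_Suc[OF bd1]) (simp only: step)
  also have "\<dots> = (\<Sum>i<k. ?E (\<lambda>w. \<Prod>j<k. g i j (expo w j))) / real k"
    by (simp add: Bochner_Integration.integral_sum integrable_measure_pmf_finite fin)
  finally have E: "measure_pmf.expectation (replicate_pmf (Suc m) (letter_pmf s k)) (\<lambda>w. \<Prod>i<k. f i (expo w i))
     = (\<Sum>i<k. ?E (\<lambda>w. \<Prod>j<k. g i j (expo w j))) / real k" .
  have D: "fps_deriv (\<Prod>i<k. coord_fps s (f i)) = (\<Sum>i<k. \<Prod>j<k. coord_fps s (g i j))"
  proof (subst fps_deriv_prod)
    have "fps_deriv (coord_fps s (f i)) * (\<Prod>j\<in>{..<k} - {i}. coord_fps s (f j)) = (\<Prod>j<k. coord_fps s (g i j))"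
      if "i < k" for i
    proof -
      have 2: "(\<Prod>j\<in>{..<k} - {i}. coord_fps s (g i j)) = (\<Prod>j\<in>{..<k} - {i}. coord_fps s (f j))"
        by (rule prod.cong) (auto simp: g_def)
      show ?thesis unfolding split[OF that] 2 by (simp add: g_def fps_deriv_coord_fps)
    qed
    then show "(\<Sum>i<k. fps_deriv (coord_fps s (f i)) * (\<Prod>j\<in>{..<k} - {i}. coord_fps s (f j)))
      = (\<Sum>i<k. \<Prod>j<k. coord_fps s (g i j))" by simp
  qed simp
  have "real (Suc m) * fps_nth (\<Prod>i<k. coord_fps s (f i)) (Suc m)
      = fps_nth (fps_deriv (\<Prod>i<k. coord_fps s (f i))) m" by simp
  also have "\<dots> = (\<Sum>i<k. real k ^ m / fact m * ?E (\<lambda>w. \<Prod>j<k. g i j (expo w j)))"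
    unfolding D fps_sum_nth by (intro sum.cong refl, rule Suc.IH[symmetric], rule gb)
  finally have "real (Suc m) * fps_nth (\<Prod>i<k. coord_fps s (f i)) (Suc m)
      = real k ^ m / fact m * (\<Sum>i<k. ?E (\<lambda>w. \<Prod>j<k. g i j (expo w j)))"
    by (simp only: sum_distrib_left)
  then show ?case
    unfolding E fact_Suc using assms(1) by (simp add: field_simps del: of_nat_Suc)
qed

text \<open>Summing the fixed-length identity against the Poisson weights evaluates the product
  series at t / k.\<close>

lemma word_product_eval_fps:
  fixes f :: "nat \<Rightarrow> int \<Rightarrow> real"
  assumes "k > 0" "\<And>i x. \<bar>f i x\<bar> \<le> B" "0 \<le> t"
  shows "measure_pmf.expectation (word_pmf s k t) (\<lambda>w. \<Prod>i<k. f i (expo w i))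
    = exp (- t) * eval_fps (\<Prod>i<k. coord_fps s (f i)) (t / real k)"
proof -
  have bd1: "\<bar>\<Prod>i<k. f i (x i)\<bar> \<le> B ^ k" for x
    unfolding abs_prod using prod_mono[of "{..<k}" "\<lambda>i. \<bar>f i (x i)\<bar>" "\<lambda>_. B"] assms(2) by simp
  have eq: "t ^ m / fact m * exp (- t) *
      measure_pmf.expectation (replicate_pmf m (letter_pmf s k)) (\<lambda>w. \<Prod>i<k. f i (expo w i))
    = exp (- t) * (fps_nth (\<Prod>i<k. coord_fps s (f i)) m * (t / real k) ^ m)" for m
    unfolding replicate_product_coeff[OF assms(1,2), symmetric]
    using assms(1) by (simp add: field_simps power_divide)
  from expectation_word_sums[of "\<lambda>w. \<Prod>i<k. f i (expo w i)", OF bd1 assms(3), of s k]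
  have "(\<lambda>m. exp (- t) * (fps_nth (\<Prod>i<k. coord_fps s (f i)) m * (t / real k) ^ m)) sums
     measure_pmf.expectation (word_pmf s k t) (\<lambda>w. \<Prod>i<k. f i (expo w i))"
    unfolding eq .
  moreover have "(\<lambda>m. exp (- t) * (fps_nth (\<Prod>i<k. coord_fps s (f i)) m * (t / real k) ^ m)) sums
      (exp (- t) * eval_fps (\<Prod>i<k. coord_fps s (f i)) (t / real k))"
    by (intro sums_mult sums_eval_fps)
       (simp add: fps_conv_radius_prod_infty coord_fps_conv_radius[OF assms(2)])
  ultimately show ?thesis by (rule sums_unique2)
qed

lemma word_single_eval_fps:
  fixes h :: "int \<Rightarrow> real"
  assumes "\<And>x. \<bar>h x\<bar> \<le> B" "0 \<le> u"
  shows "measure_pmf.expectation (word_pmf s 1 u) (\<lambda>w. h (expo w 0)) = exp (- u) * eval_fps (coord_fps s h) u"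
  using word_product_eval_fps[of 1 "\<lambda>_. h" B u s] assms by simp

text \<open>Poisson thinning: with a Poisson number of letters the exponents of different generators
  are independent, each one being a single-generator walk run for time t / k. Since exp(- t) is the
  product of k factors exp(- t / k), the evaluated product of series splits into these
  marginals.\<close>

lemma word_product:
  fixes f :: "nat \<Rightarrow> int \<Rightarrow> real"
  assumes "k > 0" "\<And>i x. \<bar>f i x\<bar> \<le> B" "0 \<le> t"
  shows "measure_pmf.expectation (word_pmf s k t) (\<lambda>w. \<Prod>i<k. f i (expo w i))
    = (\<Prod>i<k. measure_pmf.expectation (word_pmf s 1 (t / real k)) (\<lambda>w. f i (expo w 0)))"
proof -
  have "exp (- t) = (\<Prod>i<k. exp (- (t / real k)))"
    using assms(1) by (simp add: exp_of_nat_mult[symmetric])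
  then have "exp (- t) * eval_fps (\<Prod>i<k. coord_fps s (f i)) (t / real k)
      = (\<Prod>i<k. exp (- (t / real k)) * eval_fps (coord_fps s (f i)) (t / real k))"
    by (simp only: prod.distrib eval_fps_prod_infty[OF coord_fps_conv_radius[OF assms(2)]])
  also have "\<dots> = (\<Prod>i<k. measure_pmf.expectation (word_pmf s 1 (t / real k)) (\<lambda>w. f i (expo w 0)))"
  proof (rule prod.cong)
    have "0 \<le> t / real k" using assms by simp
    then show "exp (- (t / real k)) * eval_fps (coord_fps s (f i)) (t / real k)
        = measure_pmf.expectation (word_pmf s 1 (t / real k)) (\<lambda>w. f i (expo w 0))" for i
      by (rule word_single_eval_fps[OF assms(2), symmetric])
  qed simp
  finally show ?thesis by (rule trans[OF word_product_eval_fps[OF assms]])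
qed

section \<open>Parities and the number of odd exponents\<close>

definition parity :: "int \<Rightarrow> real" where
  "parity x = (if even x then 1 else - 1)"

lemma parity_add_odd [simp]: "odd e \<Longrightarrow> parity (x + e) = - parity x"
  and parity_diff_one [simp]: "parity (x - 1) = - parity x"
  and abs_parity [simp]: "\<bar>parity x\<bar> = 1"
  and parity_square [simp]: "parity x * parity x = 1"
  by (auto simp: parity_def)

text \<open>Every letter flips the parity, whatever its sign, so \<open>parity\<close> is an
  eigenfunction of \<open>shift_avg\<close> with eigenvalue - 1 and its series is exp(- u). The
  Poisson normalisation contributes a second factor exp(- u).\<close>

lemma expectation_parity:
  assumes "0 \<le> u"
  shows "measure_pmf.expectation (word_pmf s 1 u) (\<lambda>w. parity (expo w 0)) = exp (- 2 * u)"
proof -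
  have *: "(shift_avg s ^^ j) parity = (\<lambda>x. (- 1) ^ j * parity x)" for j
  proof (induction j)
    case (Suc j)
    have "shift_avg s (\<lambda>x. c * parity x) = (\<lambda>x. - c * parity x)" for c
      by (cases s) (auto simp: shift_avg_simps fun_eq_iff field_simps)
    then show ?case using Suc by simp
  qed simp
  have "coord_fps s parity = fps_exp (- 1)"
    by (rule fps_ext) (simp add: coord_fps_def * parity_def)
  then show ?thesis
    by (subst word_single_eval_fps[where B = 1]) (auto simp: assms exp_add[symmetric])
qed

definition odd_count :: "nat \<Rightarrow> (nat \<times> int) list \<Rightarrow> nat" where
  "odd_count k w = card {i. i < k \<and> odd (expo w i)}"

lemma odd_count_eq: "real (odd_count k w) = (real k - (\<Sum>i<k. parity (expo w i))) / 2"
proof -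
  have "(\<Sum>i<k. parity (expo w i)) = (\<Sum>i<k. 1 - 2 * (if odd (expo w i) then 1 else 0))"
    by (rule sum.cong) (auto simp: parity_def)
  also have "\<dots> = real k - 2 * (\<Sum>i<k. if odd (expo w i) then 1 else 0)"
    by (simp add: sum_subtractf sum_distrib_left)
  also have "(\<Sum>i<k. if odd (expo w i) then 1 else (0::real)) = real (odd_count k w)"
    by (subst sum.inter_filter[symmetric]) (simp_all add: odd_count_def)
  finally show ?thesis by simp
qed

lemma expectation_parity_prod:
  assumes "k > 0" "0 \<le> t" "A \<subseteq> {..<k}"
  shows "measure_pmf.expectation (word_pmf s k t) (\<lambda>w. \<Prod>i\<in>A. parity (expo w i))
    = exp (- 2 * (t / real k)) ^ card A"
proof -
  have restrict: "(\<Prod>i<k. if i \<in> A then F i else 1) = (\<Prod>i\<in>A. F i)" for F :: "nat \<Rightarrow> real"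
    using assms(3) by (simp add: prod.inter_restrict[symmetric] Int_absorb1)
  have "measure_pmf.expectation (word_pmf s k t) (\<lambda>w. \<Prod>i\<in>A. parity (expo w i))
     = measure_pmf.expectation (word_pmf s k t)
         (\<lambda>w. \<Prod>i<k. (\<lambda>i x. if i \<in> A then parity x else 1) i (expo w i))"
    by (simp add: restrict)
  also have "\<dots> = (\<Prod>i<k. measure_pmf.expectation (word_pmf s 1 (t / real k))
      (\<lambda>w. (\<lambda>i x. if i \<in> A then parity x else 1) i (expo w 0)))"
    by (rule word_product[where B = 1]) (use assms in auto)
  also have "\<dots> = (\<Prod>i<k. if i \<in> A then exp (- 2 * (t / real k)) else 1)"
    by (rule prod.cong) (use assms expectation_parity[of "t / real k" s] in auto)
  finally show ?thesis by (simp add: restrict)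
qed

text \<open>The parities are independent with mean L and variance 1 - L^2, and
  \<open>odd_count\<close> is affine in their sum with slope - 1/2. Only the first two moments of
  the parities enter.\<close>

lemma odd_count_variance:
  assumes "k > 0" "0 \<le> t"
  defines "L \<equiv> exp (- 2 * (t / real k))"
  shows "measure_pmf.expectation (word_pmf s k t) (\<lambda>w. (real (odd_count k w) - real k * ((1 - L) / 2))\<^sup>2)
    = real k * (1 - L\<^sup>2) / 4"
proof -
  let ?E = "measure_pmf.expectation (word_pmf s k t)"
  have bs: "\<bar>\<Sum>i<k. parity (expo w i)\<bar> \<le> real k" for w
    using sum_abs[of "\<lambda>i. parity (expo w i)" "{..<k}"] by simp
  have E1: "?E (\<lambda>w. parity (expo w i)) = L" if "i < k" for i
    using expectation_parity_prod[of k t "{i}" s] that assms by simp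
  have E2: "?E (\<lambda>w. parity (expo w i) * parity (expo w j)) = (if i = j then 1 else L\<^sup>2)"
    if "i < k" "j < k" for i j
    using expectation_parity_prod[of k t "{i, j}" s] that assms by (auto simp: power2_eq_square)
  have S1: "?E (\<lambda>w. \<Sum>i<k. parity (expo w i)) = real k * L"
    by (subst Bochner_Integration.integral_sum) (auto simp: E1 intro: integrable_pmf_bounded[where B = 1])
  have "?E (\<lambda>w. (\<Sum>i<k. parity (expo w i))\<^sup>2)
     = (\<Sum>i<k. \<Sum>j<k. ?E (\<lambda>w. parity (expo w i) * parity (expo w j)))"
    unfolding power2_eq_square sum_product
    by (subst Bochner_Integration.integral_sum;
        (subst Bochner_Integration.integral_sum)?)
       (auto simp: abs_mult intro!: integrable_pmf_bounded[where B = 1] Bochner_Integration.integrable_sum)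
  also have "\<dots> = (\<Sum>i<k. \<Sum>j<k. if i = j then 1 else L\<^sup>2)"
    by (simp add: E2)
  also have "\<dots> = (\<Sum>i<k. 1 + (real k - 1) * L\<^sup>2)"
  proof (rule sum.cong)
    fix i assume "i \<in> {..<k}"
    then have "(\<Sum>j<k. if i = j then 1 else L\<^sup>2) = 1 + (\<Sum>j\<in>{..<k} - {i}. L\<^sup>2)"
      by (subst sum.remove[of _ i]) (auto intro!: sum.cong)
    then show "(\<Sum>j<k. if i = j then 1 else L\<^sup>2) = 1 + (real k - 1) * L\<^sup>2"
      using \<open>i \<in> {..<k}\<close> by (simp add: of_nat_diff)
  qed simp
  finally have S2: "?E (\<lambda>w. (\<Sum>i<k. parity (expo w i))\<^sup>2) = real k * (1 + (real k - 1) * L\<^sup>2)"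
    by simp
  have i2: "integrable (measure_pmf (word_pmf s k t)) (\<lambda>w. (\<Sum>i<k. parity (expo w i))\<^sup>2)"
  proof (rule integrable_pmf_bounded)
    show "\<bar>(\<Sum>i<k. parity (expo w i))\<^sup>2\<bar> \<le> (real k)\<^sup>2" for w
      using power_mono[OF bs[of w] abs_ge_zero, of 2] by simp
  qed
  have i1: "integrable (measure_pmf (word_pmf s k t)) (\<lambda>w. \<Sum>i<k. parity (expo w i))"
    by (rule integrable_pmf_bounded[OF bs])
  have "?E (\<lambda>w. (real (odd_count k w) - real k * ((1 - L) / 2))\<^sup>2)
     = ?E (\<lambda>w. (\<Sum>i<k. parity (expo w i))\<^sup>2 / 4
        - (real k * L / 2) * (\<Sum>i<k. parity (expo w i)) + (real k * L)\<^sup>2 / 4)"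
    unfolding odd_count_eq by (rule Bochner_Integration.integral_cong) (auto simp: power2_eq_square field_simps)
  also have "\<dots> = real k * (1 + (real k - 1) * L\<^sup>2) / 4 - (real k * L / 2) * (real k * L) + (real k * L)\<^sup>2 / 4"
    using i1 i2 by (simp add: S1 S2)
  also have "\<dots> = real k * (1 - L\<^sup>2) / 4"
    by (simp add: power2_eq_square field_simps)
  finally show ?thesis .
qed

lemma odd_count_chebyshev:
  assumes "k > 0" "0 \<le> t" "D > 0"
  defines "L \<equiv> exp (- 2 * (t / real k))"
  shows "measure_pmf.prob (word_pmf s k t) {w. \<bar>real (odd_count k w) - real k * ((1 - L) / 2)\<bar> \<ge> D}
    \<le> real k * (1 - L\<^sup>2) / (4 * D\<^sup>2)"
proof -
  let ?X = "\<lambda>w. (real (odd_count k w) - real k * ((1 - L) / 2))\<^sup>2"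
  have "odd_count k w \<le> k" for w
    unfolding odd_count_def using card_mono[of "{..<k}" "{i. i < k \<and> odd (expo w i)}"] by auto
  then have oc: "0 \<le> real (odd_count k w)" "real (odd_count k w) \<le> real k" for w by auto
  have "0 \<le> real k * ((1 - L) / 2)" "real k * ((1 - L) / 2) \<le> real k"
    using assms(1,2) by (auto simp: L_def field_simps intro: order_trans[of _ 1])
  with oc have "\<bar>real (odd_count k w) - real k * ((1 - L) / 2)\<bar> \<le> real k" for w
    by (smt (verit))
  then have "?X w \<le> (real k)\<^sup>2" for w
    using power_mono[of _ _ 2] by fastforce
  then have int: "integrable (measure_pmf (word_pmf s k t)) ?X"
    by (intro measure_pmf.integrable_const_bound[where B = "(real k)\<^sup>2"]) auto
  have "measure_pmf.prob (word_pmf s k t) {w. \<bar>real (odd_count k w) - real k * ((1 - L) / 2)\<bar> \<ge> D}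
     = measure_pmf.prob (word_pmf s k t) {w \<in> space (measure_pmf (word_pmf s k t)). D\<^sup>2 \<le> ?X w}"
    using assms(3) by (simp add: abs_le_square_iff[symmetric])
  also have "\<dots> \<le> measure_pmf.expectation (word_pmf s k t) ?X / D\<^sup>2"
    by (rule integral_Markov_inequality_measure[OF int, where A = "{}"]) (use assms(3) in auto)
  also have "\<dots> = real k * (1 - L\<^sup>2) / (4 * D\<^sup>2)"
    unfolding L_def odd_count_variance[OF assms(1,2)] by simp
  finally show ?thesis .
qed

section \<open>Collisions in one coordinate\<close>

text \<open>This is tanh u \<le> u with the denominator cleared; the derivative of the difference is
  1 - (1 + 2 u) exp(- 2 u).\<close>

lemma tanh_bound: "0 \<le> u \<Longrightarrow> 1 - exp (- 2 * u) \<le> u * (1 + exp (- 2 * u))" for u :: real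
proof -
  assume u: "0 \<le> u"
  let ?g = "\<lambda>u::real. u * (1 + exp (- 2 * u)) - (1 - exp (- 2 * u))"
  have "?g 0 \<le> ?g u"
  proof (rule DERIV_nonneg_imp_nondecreasing[OF u])
    fix x :: real assume "0 \<le> x" "x \<le> u"
    have "1 + 2 * x \<le> exp (2 * x)" by (rule exp_ge_add_one_self)
    then have "(1 + 2 * x) * exp (- 2 * x) \<le> exp (2 * x) * exp (- 2 * x)"
      by (intro mult_right_mono) auto
    also have "\<dots> = 1" by (simp add: exp_add[symmetric])
    finally have "1 - (1 + 2 * x) * exp (- 2 * x) \<ge> 0" by simp
    moreover have "(?g has_real_derivative 1 - (1 + 2 * x) * exp (- 2 * x)) (at x)"
      by (auto intro!: derivative_eq_intros simp: algebra_simps)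
    ultimately show "\<exists>y. (?g has_real_derivative y) (at x) \<and> 0 \<le> y" by blast
  qed
  then show ?thesis by simp
qed

text \<open>With p = (1 - L) / 2 the weight is 2 p for even x and 2 (1 - p) for odd x. It is thus 2
  p times the tilt by (1 - p) / p per odd exponent, written as an affine function of the parity. The
  tilt acts on the first argument only.\<close>

definition collision :: "int \<Rightarrow> real \<Rightarrow> int \<Rightarrow> int \<Rightarrow> real" where
  "collision q L x y = (1 - L * parity x) * of_bool (q dvd x - y)"

lemma collision_abs_le:
  assumes "0 \<le> L" "L \<le> 1"
  shows "\<bar>collision q L x y\<bar> \<le> 2"
  using assms by (auto simp: collision_def parity_def of_bool_def)

text \<open>The transition operator of a word in two generators: each letter moves one of the two
  exponents.\<close>

definition shift_avg2 :: "direction \<Rightarrow> (int \<Rightarrow> int \<Rightarrow> real) \<Rightarrow> int \<Rightarrow> int \<Rightarrow> real" where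
  "shift_avg2 s h x y = (shift_avg s (\<lambda>u. h u y) x + shift_avg s (h x) y) / 2"

lemma shift_avg2_abs_le:
  assumes "\<And>x y. \<bar>h x y\<bar> \<le> B"
  shows "\<bar>shift_avg2 s h x y\<bar> \<le> B"
  using shift_avg_abs_le[of "\<lambda>u. h u y" B s x] shift_avg_abs_le[of "h x" B s y] assms
  by (simp add: shift_avg2_def)

lemma expectation_letter_2:
  assumes "\<And>x y. \<bar>h x y\<bar> \<le> B"
  shows "measure_pmf.expectation (letter_pmf s 2) (\<lambda>x. h (expo (x # w) 0) (expo (x # w) 1))
    = shift_avg2 s h (expo w 0) (expo w 1)"
  by (subst expectation_letter[where B = B]) (auto simp: assms numeral_2_eq_2 shift_avg2_def shift_avg_def)

lemma expectation_replicate_2_Suc: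
  assumes "\<And>x y. \<bar>h x y\<bar> \<le> B"
  shows "measure_pmf.expectation (replicate_pmf (Suc m) (letter_pmf s 2)) (\<lambda>w. h (expo w 0) (expo w 1))
    = measure_pmf.expectation (replicate_pmf m (letter_pmf s 2))
        (\<lambda>w. shift_avg2 s h (expo w 0) (expo w 1))"
proof -
  have b: "\<bar>h (expo w 0) (expo w 1)\<bar> \<le> B" for w by (rule assms)
  show ?thesis
    by (subst expectation_replicate_Suc[OF b]) (simp only: expectation_letter_2[of h B, OF assms])
qed

text \<open>Two letters change x - y by 0, 2 or - 2. As q is odd, at most one of the three resulting
  differences is divisible by q, and the most likely change, 0, has probability 1/2. In the directed
  case the remaining weight is at most 1 + L; in the undirected case the parity terms
  cancel.\<close>

lemma shift_avg2_shift_avg2_collision_le: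
  assumes "prime q" "q \<ge> 3" "0 \<le> L" "L \<le> 1"
  shows "shift_avg2 s (shift_avg2 s (collision q L)) x y \<le> (1 + L) / 2"
proof -
  have nd: "\<not> q dvd 2" "\<not> q dvd 4"
  proof -
    show "\<not> q dvd 2" using assms(2) zdvd_imp_le by fastforce
    then show "\<not> q dvd 4"
      using assms(1) prime_dvd_mult_iff[of q 2 2] by auto
  qed
  define a b c :: real where "a = of_bool (q dvd x - y)" and "b = of_bool (q dvd x - y + 2)"
    and "c = of_bool (q dvd x - y - 2)"
  have "\<not> (q dvd x - y \<and> q dvd x - y + 2)"
    using nd(1) dvd_add_right_iff by blast
  moreover have "\<not> (q dvd x - y - 2 \<and> q dvd x - y)"
    using nd(1) dvd_diff[of q "x - y" "x - y - 2"] by auto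
  moreover have "\<not> (q dvd x - y + 2 \<and> q dvd x - y - 2)"
    using nd(2) dvd_diff[of q "x - y + 2" "x - y - 2"] by auto
  ultimately have abc: "(a = 0 \<and> b = 0 \<and> c = 0) \<or> (a = 1 \<and> b = 0 \<and> c = 0) \<or> (a = 0 \<and> b = 1 \<and> c = 0)
      \<or> (a = 0 \<and> b = 0 \<and> c = 1)"
    by (simp only: a_def b_def c_def of_bool_eq_0_iff of_bool_eq_1_iff) blast
  have p: "parity x = 1 \<or> parity x = - 1" by (auto simp: parity_def)
  have par: "parity (x + 1) = - parity x" "parity (x + 1 + 1) = parity x" "parity (x - 1 - 1) = parity x"
    "parity (x + 1 - 1) = parity x" "parity (x - 1 + 1) = parity x"
    by (auto simp: parity_def)
  have d: "x + 1 + 1 - y = x - y + 2" "x + 1 - 1 - y = x - y" "x - 1 + 1 - y = x - y"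
    "x - 1 - 1 - y = x - y - 2" "x - (y + 1 + 1) = x - y - 2" "x - (y + 1 - 1) = x - y"
    "x - (y - 1 + 1) = x - y" "x - (y - 1 - 1) = x - y + 2" "x + 1 - (y + 1) = x - y"
    "x + 1 - (y - 1) = x - y + 2" "x - 1 - (y + 1) = x - y - 2" "x - 1 - (y - 1) = x - y" by auto
  show ?thesis
  proof (cases s)
    case Directed
    have "shift_avg2 s (shift_avg2 s (collision q L)) x y =
       ((1 - L * parity x) * b + 2 * (1 + L * parity x) * a + (1 - L * parity x) * c) / 4"
      unfolding Directed shift_avg2_def shift_avg_simps collision_def par d
        a_def[symmetric] b_def[symmetric] c_def[symmetric]
      by (simp add: par algebra_simps add_divide_distrib diff_divide_distrib)
    then show ?thesis using abc p assms(3,4) by auto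
  next
    case Undirected
    have "shift_avg2 s (shift_avg2 s (collision q L)) x y = (2 * a + b + c) / 4"
      unfolding Undirected shift_avg2_def shift_avg_simps collision_def par parity_diff_one d
        a_def[symmetric] b_def[symmetric] c_def[symmetric]
      by (simp add: par algebra_simps add_divide_distrib diff_divide_distrib)
    then show ?thesis using abc assms(3,4) by auto
  qed
qed

text \<open>Averaging over the last two letters already gives the bound, uniformly in the exponents
  of the letters before them.\<close>

lemma collision_replicate_le:
  assumes "prime q" "q \<ge> 3" "0 \<le> L" "L \<le> 1"
  shows "measure_pmf.expectation (replicate_pmf (Suc (Suc m)) (letter_pmf s 2))
      (\<lambda>w. collision q L (expo w 0) (expo w 1)) \<le> (1 + L) / 2"
proof -
  have b: "\<bar>collision q L x y\<bar> \<le> 2" for x y by (rule collision_abs_le) (use assms in auto)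
  note b2 = shift_avg2_abs_le[of "collision q L", OF b] 
  note b3 = shift_avg2_abs_le[of "shift_avg2 s (collision q L)" 2 s, OF b2]
  show ?thesis
    unfolding expectation_replicate_2_Suc[of "collision q L", OF b]
      expectation_replicate_2_Suc[of "shift_avg2 s (collision q L)", OF b2]
    by (rule measure_pmf.integral_le_const[OF integrable_pmf_bounded[where B = 2]])
       (use b3 shift_avg2_shift_avg2_collision_le[OF assms] in auto)
qed

text \<open>The number of letters is split into three cases. No letter contributes the weight 1 - L;
  a single letter contributes 0, because q does not divide 1; from two letters on the previous bound
  K = (1 + L) / 2 applies. As exp(- 2 u) = L, the total is (1 - L^2) / 2 plus L ((1 - L) - u (1 +
  L)), and the correction is nonpositive by tanh u \<le> u.\<close>

lemma collision_word_2_le: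
  assumes "prime q" "q \<ge> 3" "0 \<le> u"
  defines "L \<equiv> exp (- 2 * u)"
  shows "measure_pmf.expectation (word_pmf s 2 (2 * u)) (\<lambda>w. collision q L (expo w 0) (expo w 1))
    \<le> (1 - L\<^sup>2) / 2"
proof -
  let ?F = "\<lambda>w. collision q L (expo w 0) (expo w 1)"
  let ?E = "\<lambda>m. measure_pmf.expectation (replicate_pmf m (letter_pmf s 2)) ?F"
  let ?K = "(1 + L) / 2"
  let ?c = "\<lambda>m. (2 * u) ^ m / fact m * exp (- (2 * u))"
  have L: "0 \<le> L" "L \<le> 1" using assms by auto
  have b: "\<bar>?F w\<bar> \<le> 2" for w by (rule collision_abs_le) (use L in auto)
  have "(\<lambda>m. ?c m * ?E m) sums measure_pmf.expectation (word_pmf s 2 (2 * u)) ?F"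
    by (rule expectation_word_sums[OF b]) (use assms in simp)
  moreover have "(\<lambda>m. ?c m * ?K) sums ?K"
    using expectation_jumps_sums[of "\<lambda>_. ?K" ?K "2 * u"] assms by (simp add: L_def)
  \<comment> \<open>Subtracting the constant \<open>?K\<close> makes all terms with at least two
    letters nonpositive, so the series is bounded by its first two terms.\<close>
  ultimately have 1: "(\<lambda>m. ?c m * (?E m - ?K)) sums
      (measure_pmf.expectation (word_pmf s 2 (2 * u)) ?F - ?K)"
    by (simp add: right_diff_distrib sums_diff)
  have 2: "(\<lambda>m. if m \<in> {0, 1} then ?c m * (?E m - ?K) else 0) sums
      (\<Sum>m\<in>{0, 1}. ?c m * (?E m - ?K))"
    by (rule sums_If_finite_set) simp
  have E0: "?E 0 = 1 - L" by (simp add: collision_def parity_def)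
  have "\<not> q dvd 1" "\<not> q dvd - 1" using assms(1,2) by (auto simp: zdvd1_eq)
  then have "collision q L 1 0 = 0" "collision q L (- 1) 0 = 0" "collision q L 0 1 = 0" "collision q L 0 (- 1) = 0"
    by (auto simp: collision_def)
  then have "shift_avg2 s (collision q L) 0 0 = 0"
    by (cases s) (simp_all add: shift_avg2_def shift_avg_simps)
  then have E1: "?E (Suc 0) = 0"
    by (subst expectation_replicate_2_Suc[where B = 2]) (use L in \<open>auto simp: collision_abs_le\<close>)
  have "measure_pmf.expectation (word_pmf s 2 (2 * u)) ?F - ?K \<le> (\<Sum>m\<in>{0, 1}. ?c m * (?E m - ?K))"
  proof (rule sums_le[OF _ 1 2])
    fix m
    show "?c m * (?E m - ?K) \<le> (if m \<in> {0, 1} then ?c m * (?E m - ?K) else 0)"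
    proof (cases "m \<in> {0, 1}")
      case False
      then obtain j where "m = Suc (Suc j)" by (metis insertCI not0_implies_Suc One_nat_def)
      then have "?E m \<le> ?K" using collision_replicate_le[OF assms(1,2) L] by simp
      then have "?c m * (?E m - ?K) \<le> 0"
        using assms(3) by (intro mult_nonneg_nonpos) auto
      then show ?thesis using False by simp
    qed simp
  qed
  also have "\<dots> = L * (1 - L - ?K) - 2 * u * L * ?K"
    using E0 E1 by (simp add: L_def)
  finally have "measure_pmf.expectation (word_pmf s 2 (2 * u)) ?F
      \<le> ?K + L * (1 - L - ?K) - 2 * u * L * ?K" by simp
  also have "\<dots> = (1 - L\<^sup>2) / 2 + L * ((1 - L) - u * (1 + L))"
    by (simp add: power2_eq_square field_simps)
  also have "\<dots> \<le> (1 - L\<^sup>2) / 2"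
    using mult_nonneg_nonpos[OF L(1), of "(1 - L) - u * (1 + L)"] tanh_bound[OF assms(3)]
    unfolding L_def[symmetric] by linarith
  finally show ?thesis .
qed

text \<open>For q = 2 the collision is affine in the parity of either exponent and the bound is an
  equality. For odd q two independent words in one generator are merged into a single word in two
  generators of total duration 2 u, for which the letters can be counted.\<close>

lemma collision_le:
  assumes "prime q" "0 \<le> u"
  defines "L \<equiv> exp (- 2 * u)"
  shows "measure_pmf.expectation (word_pmf s 1 u) (\<lambda>w'. measure_pmf.expectation (word_pmf s 1 u)
      (\<lambda>w. collision q L (expo w 0) (expo w' 0))) \<le> (1 - L\<^sup>2) / 2"
proof (cases "q = 2")
  case True
  let ?E = "measure_pmf.expectation (word_pmf s 1 u)"
  have int: "integrable (measure_pmf (word_pmf s 1 u)) (\<lambda>w. parity (expo w 0))"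
    by (rule measure_pmf.integrable_const_bound[where B = 1]) auto
  have c: "collision q L x y = (1 - L * parity y) / 2 + (parity y - L) / 2 * parity x" for x y
    by (auto simp: True collision_def parity_def field_simps of_bool_def)
  have "?E (\<lambda>w'. ?E (\<lambda>w. collision q L (expo w 0) (expo w' 0)))
     = ?E (\<lambda>w'. (1 - L * parity (expo w' 0)) / 2 + (parity (expo w' 0) - L) / 2 * L)"
    unfolding c using int expectation_parity[OF assms(2), of s] by (simp add: L_def)
  also have "\<dots> = ?E (\<lambda>w'. (1 - L\<^sup>2) / 2)"
    by (rule Bochner_Integration.integral_cong) (auto simp: power2_eq_square field_simps)
  finally show ?thesis by simp
next
  case False
  then have q: "q \<ge> 3" using prime_ge_2_int[OF assms(1)] by linarith
  let ?E = "measure_pmf.expectation (word_pmf s 1 u)"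
  define f where "f r x = (1 - L * parity x) * of_bool (x mod q = r)" for r x
  define g where "g r y = (of_bool (y mod q = r) :: real)" for r y
  have L: "0 \<le> L" "L \<le> 1" using assms by auto
  have fb: "\<bar>f r x\<bar> \<le> 2" and gb: "\<bar>g r x\<bar> \<le> 2" for r x
    using L by (auto simp: f_def g_def parity_def of_bool_def)
  \<comment> \<open>Independence is available only for products of functions of one coordinate, so
    the event q | x - y is split according to the common residue.\<close>
  have c: "collision q L x y = (\<Sum>r\<in>{0..<q}. f r x * g r y)" for x y
  proof -
    have "(\<Sum>r\<in>{0..<q}. f r x * g r y)
       = (\<Sum>r\<in>{0..<q}. if r = x mod q then (1 - L * parity x) * of_bool (y mod q = r) else 0)"
      by (rule sum.cong) (auto simp: f_def g_def)
    also have "\<dots> = collision q L x y"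
      using q by (auto simp: collision_def mod_eq_dvd_iff[symmetric])
    finally show ?thesis by simp
  qed
  have fgb: "\<bar>f r x * g r' y\<bar> \<le> 2 * 2" for r r' x y
    unfolding abs_mult by (intro mult_mono fb gb) auto
  have "?E (\<lambda>w'. ?E (\<lambda>w. collision q L (expo w 0) (expo w' 0)))
     = ?E (\<lambda>w'. \<Sum>r\<in>{0..<q}. ?E (\<lambda>w. f r (expo w 0)) * g r (expo w' 0))"
    unfolding c
    by (subst Bochner_Integration.integral_sum)
       (auto simp: integrable_pmf_bounded[OF fb] intro: integrable_pmf_bounded[OF fgb])
  also have "\<dots> = (\<Sum>r\<in>{0..<q}. ?E (\<lambda>w. f r (expo w 0)) * ?E (\<lambda>w. g r (expo w 0)))"
    by (subst Bochner_Integration.integral_sum) (auto intro!: integrable_mult_right integrable_pmf_bounded[OF gb])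
  also have "\<dots> = (\<Sum>r\<in>{0..<q}. measure_pmf.expectation (word_pmf s 2 (2 * u))
      (\<lambda>w. f r (expo w 0) * g r (expo w 1)))"
  proof (rule sum.cong)
    fix r
    have "measure_pmf.expectation (word_pmf s 2 (2 * u))
        (\<lambda>w. \<Prod>i<(2::nat). (\<lambda>i. if i = 0 then f r else g r) i (expo w i))
      = (\<Prod>i<(2::nat). measure_pmf.expectation (word_pmf s 1 (2 * u / real 2))
          (\<lambda>w. (\<lambda>i. if i = 0 then f r else g r) i (expo w 0)))"
      by (rule word_product[where B = 2]) (use fb gb assms in auto)
    then show "?E (\<lambda>w. f r (expo w 0)) * ?E (\<lambda>w. g r (expo w 0))
       = measure_pmf.expectation (word_pmf s 2 (2 * u)) (\<lambda>w. f r (expo w 0) * g r (expo w 1))"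
      by (simp add: numeral_2_eq_2)
  qed simp
  also have "\<dots> = measure_pmf.expectation (word_pmf s 2 (2 * u)) (\<lambda>w. collision q L (expo w 0) (expo w 1))"
    unfolding c by (subst Bochner_Integration.integral_sum) (auto intro: integrable_pmf_bounded[OF fgb])
  also have "\<dots> \<le> (1 - L\<^sup>2) / 2"
    unfolding L_def by (rule collision_word_2_le[OF assms(1) q assms(2)])
  finally show ?thesis .
qed

text \<open>Exponential Markov inequality: on words with at least a odd exponents, \<theta> to the
  power \<open>odd_count - a\<close> is at least 1, since \<theta> = (1 - p) / p \<ge> 1. The tilted
  collision expectation factorises over the coordinates, and each factor is at most (1 - L^2) / 2 /
  (2 p) = 1 - p. The resulting bound is the probability that independent bits with bias p produce a
  given vector with a ones, which is the natural bound for q = 2.\<close>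

lemma typical_collision_le:
  fixes a :: real
  assumes "prime q" "0 < t" "k > 0"
  defines "p \<equiv> (1 - exp (- 2 * (t / real k))) / 2"
  shows "measure_pmf.expectation (word_pmf s k t) (\<lambda>w'. measure_pmf.prob (word_pmf s k t)
      {w. a \<le> real (odd_count k w) \<and> (\<forall>i<k. q dvd expo w i - expo w' i)})
    \<le> p powr a * (1 - p) powr (real k - a)"
proof -
  define u where "u = t / real k"
  define L where "L = exp (- 2 * u)"
  have u: "0 < u" using assms by (simp add: u_def)
  have L: "0 < L" "L < 1" using u by (auto simp: L_def)
  have p: "p = (1 - L) / 2" by (simp add: p_def L_def u_def)
  have p01: "0 < p" "p < 1 / 2" using L by (auto simp: p)
  define \<theta> where "\<theta> = (1 - p) / p"
  have \<theta>: "\<theta> \<ge> 1" using p01 by (simp add: \<theta>_def field_simps)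
  let ?E = "measure_pmf.expectation (word_pmf s k t)"
  let ?E1 = "measure_pmf.expectation (word_pmf s 1 u)"
  define F where "F x y = collision q L x y / (2 * p)" for x y
  define B where "B = 1 / p"
  have Fb: "\<bar>F x y\<bar> \<le> B" for x y
    using collision_abs_le[of L q x y] L p01 by (simp add: F_def B_def field_simps)
  have B0: "B \<ge> 0" using p01 by (simp add: B_def)
  have F: "F x y = (if odd x then \<theta> else 1) * of_bool (q dvd x - y)" for x y
    using p01 by (auto simp: F_def collision_def \<theta>_def parity_def p field_simps)
  have pw: "\<bar>\<Prod>i<k. F (x i) (y i)\<bar> \<le> B ^ k" for x y
    unfolding abs_prod using prod_mono[of "{..<k}" "\<lambda>i. \<bar>F (x i) (y i)\<bar>" "\<lambda>_. B"] Fb by simp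
  have prodF: "(\<Prod>i<k. F (expo w i) (expo w' i))
      = \<theta> ^ odd_count k w * of_bool (\<forall>i<k. q dvd expo w i - expo w' i)" for w w'
  proof (cases "\<forall>i<k. q dvd expo w i - expo w' i")
    case True
    then have "(\<Prod>i<k. F (expo w i) (expo w' i)) = (\<Prod>i<k. if odd (expo w i) then \<theta> else 1)"
      by (intro prod.cong) (auto simp: F)
    also have "\<dots> = \<theta> ^ odd_count k w"
      by (subst prod.inter_filter[symmetric]) (auto simp: odd_count_def)
    finally show ?thesis using True by simp
  next
    case False
    then obtain i where "i < k" "\<not> q dvd expo w i - expo w' i" by blast
    then have "(\<Prod>i<k. F (expo w i) (expo w' i)) = 0"
      by (intro prod_zero) (auto simp: F)
    then show ?thesis using False by auto
  qed
  have markov: "measure_pmf.prob (word_pmf s k t)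
      {w. a \<le> real (odd_count k w) \<and> (\<forall>i<k. q dvd expo w i - expo w' i)}
    \<le> \<theta> powr (- a) * ?E (\<lambda>w. \<Prod>i<k. F (expo w i) (expo w' i))" for w'
  proof -
    let ?A = "{w. a \<le> real (odd_count k w) \<and> (\<forall>i<k. q dvd expo w i - expo w' i)}"
    have "indicator ?A w \<le> \<theta> powr (- a) * (\<Prod>i<k. F (expo w i) (expo w' i))" for w
    proof (cases "w \<in> ?A")
      case True
      have "1 \<le> \<theta> powr (real (odd_count k w) - a)"
        using True \<theta> by (intro ge_one_powr_ge_zero) auto
      also have "\<dots> = \<theta> powr (- a) * \<theta> ^ odd_count k w"
        using \<theta> by (simp add: powr_realpow[symmetric] powr_add[symmetric])
      finally show ?thesis using True by (simp add: prodF)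
    next
      case False
      then show ?thesis using \<theta> by (simp add: prodF)
    qed
    then have "?E (indicator ?A) \<le> ?E (\<lambda>w. \<theta> powr (- a) * (\<Prod>i<k. F (expo w i) (expo w' i)))"
      by (intro integral_mono integrable_mult_right integrable_pmf_bounded[OF pw] integrable_pmf_bounded[where B = 1])
         (auto simp: indicator_def)
    then show ?thesis by simp
  qed
  \<comment> \<open>Independence is used twice: here for \<open>w\<close> with \<open>w'\<close>
    fixed, and below for \<open>w'\<close>, once the inner expectation has become a product of
    functions of single exponents of \<open>w'\<close>.\<close>
  have E1: "?E (\<lambda>w. \<Prod>i<k. F (expo w i) (expo w' i)) = (\<Prod>i<k. ?E1 (\<lambda>w. F (expo w 0) (expo w' i)))" for w'
    unfolding u_def using word_product[of k "\<lambda>i x. F x (expo w' i)" B t s] assms(2,3) Fb by simp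
  have "?E (\<lambda>w'. measure_pmf.prob (word_pmf s k t)
      {w. a \<le> real (odd_count k w) \<and> (\<forall>i<k. q dvd expo w i - expo w' i)})
    \<le> ?E (\<lambda>w'. \<theta> powr (- a) * ?E (\<lambda>w. \<Prod>i<k. F (expo w i) (expo w' i)))"
    by (intro integral_mono markov integrable_mult_right integrable_pmf_bounded[where B = 1] integrable_pmf_bounded[where B = "B ^ k"]
          expectation_abs_le pw) auto
  also have "\<dots> = \<theta> powr (- a) * ?E (\<lambda>w'. \<Prod>i<k. (\<lambda>y. ?E1 (\<lambda>w. F (expo w 0) y)) (expo w' i))"
    by (simp add: E1)
  also have "?E (\<lambda>w'. \<Prod>i<k. (\<lambda>y. ?E1 (\<lambda>w. F (expo w 0) y)) (expo w' i))
     = (\<Prod>i<k. ?E1 (\<lambda>w'. ?E1 (\<lambda>w. F (expo w 0) (expo w' 0))))"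
    unfolding u_def
    by (rule word_product[where B = B]) (use assms in \<open>auto intro!: expectation_abs_le Fb\<close>)
  also have "\<dots> = (?E1 (\<lambda>w'. ?E1 (\<lambda>w. F (expo w 0) (expo w' 0)))) ^ k" by simp
  also have "?E1 (\<lambda>w'. ?E1 (\<lambda>w. F (expo w 0) (expo w' 0)))
      = ?E1 (\<lambda>w'. ?E1 (\<lambda>w. collision q L (expo w 0) (expo w' 0))) / (2 * p)"
    by (simp add: F_def)
  also have "\<theta> powr (- a) * \<dots> ^ k \<le> \<theta> powr (- a) * (1 - p) ^ k"
  proof (intro mult_left_mono power_mono)
    have "?E1 (\<lambda>w'. ?E1 (\<lambda>w. collision q L (expo w 0) (expo w' 0))) / (2 * p) \<le> (1 - L\<^sup>2) / 2 / (2 * p)"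
      using collision_le[OF assms(1), of u s] u p01 by (intro divide_right_mono) (auto simp: L_def)
    also have "\<dots> = 1 - p"
      using p01 L by (simp add: p field_simps power2_eq_square)
    finally show "?E1 (\<lambda>w'. ?E1 (\<lambda>w. collision q L (expo w 0) (expo w' 0))) / (2 * p) \<le> 1 - p" .
    show "0 \<le> ?E1 (\<lambda>w'. ?E1 (\<lambda>w. collision q L (expo w 0) (expo w' 0))) / (2 * p)"
      using p01 L by (intro divide_nonneg_pos Bochner_Integration.integral_nonneg)
        (auto simp: collision_def parity_def)
  qed auto
  also have "\<theta> powr (- a) * (1 - p) ^ k = p powr a * (1 - p) powr (real k - a)"
    using p01 by (simp add: \<theta>_def powr_divide powr_minus powr_diff powr_realpow field_simps)
  finally show ?thesis .
qed

section \<open>Evaluating words in a group\<close>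

primrec word_eval :: "('a, 'b) monoid_scheme \<Rightarrow> 'a list \<Rightarrow> (nat \<times> int) list \<Rightarrow> 'a" where
  "word_eval G zs [] = \<one>\<^bsub>G\<^esub>"
| "word_eval G zs (x # w) = word_eval G zs w \<otimes>\<^bsub>G\<^esub> (zs ! fst x) [^]\<^bsub>G\<^esub> snd x"

definition words :: "nat \<Rightarrow> (nat \<times> int) list set" where
  "words k = {w. \<forall>x\<in>set w. fst x < k}"

lemma words_simps [simp]:
  "[] \<in> words k" "x # w \<in> words k \<longleftrightarrow> fst x < k \<and> w \<in> words k"
  "w @ w' \<in> words k \<longleftrightarrow> w \<in> words k \<and> w' \<in> words k"
  by (auto simp: words_def)

abbreviation tuples :: "('a, 'b) monoid_scheme \<Rightarrow> nat \<Rightarrow> 'a list set" where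
  "tuples G k \<equiv> {zs. set zs \<subseteq> carrier G \<and> length zs = k}"

lemma tuples_nth: "zs \<in> tuples G k \<Longrightarrow> i < k \<Longrightarrow> zs ! i \<in> carrier G"
  by (auto simp: subset_iff)

definition inv_word :: "(nat \<times> int) list \<Rightarrow> (nat \<times> int) list" where
  "inv_word w = rev (map (\<lambda>(i, e). (i, - e)) w)"

lemma inv_word_words [simp]: "inv_word w \<in> words k \<longleftrightarrow> w \<in> words k"
  by (auto simp: inv_word_def words_def)

lemma expo_append: "expo (w @ w') i = expo w i + expo w' i"
  by (induction w arbitrary: i) auto

lemma expo_inv_word: "expo (inv_word w) i = - expo w i"
  by (induction w arbitrary: i) (auto simp: inv_word_def expo_append case_prod_unfold)

context group begin

lemma int_pow_commutes:
  assumes "x \<otimes> y = y \<otimes> x" "x \<in> carrier G" "y \<in> carrier G"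
  shows "x [^] (e::int) \<otimes> y = y \<otimes> x [^] e"
proof (cases e rule: int_cases2)
  case (nonneg n)
  then show ?thesis using group_commutes_pow[OF assms] by (simp add: int_pow_int)
next
  case (nonpos n)
  have c: "x [^] n \<otimes> y = y \<otimes> x [^] n" and z: "x [^] n \<in> carrier G"
    using group_commutes_pow[OF assms] assms by auto
  have "inv (x [^] n) \<otimes> y = inv (x [^] n) \<otimes> (y \<otimes> x [^] n) \<otimes> inv (x [^] n)"
    using z assms(3) by (simp add: m_assoc)
  also have "\<dots> = y \<otimes> inv (x [^] n)"
    unfolding c[symmetric] using z assms(3) by (simp add: m_assoc[symmetric])
  finally show ?thesis using nonpos assms by (simp add: int_pow_neg int_pow_int)
qed

lemma word_eval_closed:
  assumes "zs \<in> tuples G k" "w \<in> words k"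
  shows "word_eval G zs w \<in> carrier G"
  using assms(2) by (induction w) (use tuples_nth[OF assms(1)] in auto)

text \<open>The order is reversed because the head of a list is its last letter: \<open>w'\<close>
  is walked before \<open>w\<close>.\<close>

lemma word_eval_append:
  assumes "zs \<in> tuples G k" "w \<in> words k" "w' \<in> words k"
  shows "word_eval G zs (w @ w') = word_eval G zs w' \<otimes> word_eval G zs w"
  using assms(2)
proof (induction w)
  case (Cons x w)
  then show ?case
    using word_eval_closed[OF assms(1), of w] word_eval_closed[OF assms(1,3)] tuples_nth[OF assms(1)]
    by (simp add: m_assoc)
qed (use word_eval_closed[OF assms(1,3)] in simp)

lemma word_eval_inv_word:
  assumes "zs \<in> tuples G k" "w \<in> words k"
  shows "word_eval G zs (inv_word w) = inv (word_eval G zs w)"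
  using assms(2)
proof (induction w)
  case (Cons x w)
  have "word_eval G zs (inv_word (x # w)) = word_eval G zs (inv_word w @ [(fst x, - snd x)])"
    by (simp add: inv_word_def case_prod_unfold)
  also have "\<dots> = (zs ! fst x) [^] (- snd x) \<otimes> word_eval G zs (inv_word w)"
    using Cons.prems tuples_nth[OF assms(1)] by (subst word_eval_append[OF assms(1)]) auto
  also have "\<dots> = inv (word_eval G zs (x # w))"
    using Cons tuples_nth[OF assms(1)] word_eval_closed[OF assms(1), of w]
    by (simp add: int_pow_neg inv_mult_group)
  finally show ?case .
qed (simp add: inv_word_def)

end

lemma word_eval_hom:
  assumes "group G" "group Q" "h \<in> hom G Q" "zs \<in> tuples G k" "w \<in> words k"
  shows "h (word_eval G zs w) = word_eval Q (map h zs) w"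
proof -
  interpret group_hom G Q h
    using assms by (simp add: group_hom_def group_hom_axioms_def)
  show ?thesis
    using assms(5)
  proof (induction w)
    case (Cons x w)
    then show ?case
      using assms(4) tuples_nth[OF assms(4)] G.word_eval_closed[OF assms(4)]
      by (simp add: hom_int_pow)
  qed simp
qed

text \<open>Copies of a central element can be collected at the end of the word, and their number is
  the net exponent of the modified generator. This is how exponent vectors control words in a
  nonabelian group.\<close>

lemma (in group) word_eval_central_update:
  assumes "x \<in> carrier G" "\<And>y. y \<in> carrier G \<Longrightarrow> x \<otimes> y = y \<otimes> x"
    and "zs \<in> tuples G k" "w \<in> words k" "i < k"
  shows "word_eval G (zs[i := zs ! i \<otimes> x]) w = word_eval G zs w \<otimes> x [^] expo w i"
  using assms(4)
proof (induction w)
  case (Cons a w)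
  have c: "word_eval G zs w \<in> carrier G" "zs ! j \<in> carrier G" if "j < k" for j
    using Cons.prems word_eval_closed[OF assms(3)] tuples_nth[OF assms(3) that] by auto
  have l: "length zs = k" using assms(3) by simp
  have comm: "x [^] (e::int) \<otimes> y = y \<otimes> x [^] e" if "y \<in> carrier G" for e y
    using int_pow_commutes[OF assms(2)[OF that] assms(1) that] .
  show ?case
  proof (cases "fst a = i")
    case True
    have "word_eval G (zs[i := zs ! i \<otimes> x]) (a # w)
        = (word_eval G zs w \<otimes> x [^] expo w i) \<otimes> (zs ! i \<otimes> x) [^] snd a"
      using Cons True assms(5) l by simp
    also have "(zs ! i \<otimes> x) [^] snd a = x [^] snd a \<otimes> (zs ! i) [^] snd a"
      using assms(1,2,5) c by (subst int_pow_mult_distrib) (auto simp: comm)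
    also have "(word_eval G zs w \<otimes> x [^] expo w i) \<otimes> (x [^] snd a \<otimes> (zs ! i) [^] snd a)
        = word_eval G zs w \<otimes> (x [^] (expo w i + snd a) \<otimes> (zs ! i) [^] snd a)"
      using c assms(1,5) by (simp add: m_assoc int_pow_mult)
    also have "\<dots> = word_eval G zs w \<otimes> (zs ! i) [^] snd a \<otimes> x [^] (expo w i + snd a)"
      using c assms(1,5) by (simp add: comm m_assoc)
    finally show ?thesis using True by simp
  next
    case False
    then have "word_eval G (zs[i := zs ! i \<otimes> x]) (a # w)
        = (word_eval G zs w \<otimes> x [^] expo w i) \<otimes> (zs ! fst a) [^] snd a"
      using Cons by simp
    also have "\<dots> = word_eval G zs w \<otimes> (zs ! fst a) [^] snd a \<otimes> x [^] expo w i"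
      using c[of "fst a"] Cons.prems assms(1) by (simp add: comm m_assoc)
    finally show ?thesis using False by simp
  qed
qed (use assms in simp)

section \<open>Collisions in nilpotent groups\<close>

lemma (in group) lower_central_subset: "lower_central G i \<subseteq> carrier G"
proof (induction i)
  case (Suc i)
  then show ?case
    unfolding lower_central.simps by (intro subgroup.subset[OF generate_is_subgroup]) blast
qed simp

text \<open>Take the first term of the lower central series contained in N. The term before it has
  an element outside N, and all commutators of this element with G fall into N, so it is central
  modulo N.\<close>

lemma nilpotent_central_coset:
  fixes G (structure)
  assumes "nilpotent_group G" "N \<lhd> G" "N \<noteq> carrier G"
  obtains x where "x \<in> carrier G" "x \<notin> N"
    "\<And>y. y \<in> carrier G \<Longrightarrow> x \<otimes>\<^bsub>G\<^esub> y \<otimes>\<^bsub>G\<^esub> inv\<^bsub>G\<^esub> x \<otimes>\<^bsub>G\<^esub> inv\<^bsub>G\<^esub> y \<in> N"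
proof -
  interpret normal N G by fact
  obtain c where c: "lower_central G c = {\<one>\<^bsub>G\<^esub>}"
    using assms(1) by (auto simp: nilpotent_group_def)
  define i where "i = (LEAST i. lower_central G i \<subseteq> N)"
  have i: "lower_central G i \<subseteq> N"
    unfolding i_def by (rule LeastI[of _ c]) (simp add: c)
  have "i \<noteq> 0"
    using i assms(3) subset by (intro notI) auto
  then obtain j where j: "i = Suc j" by (cases i) auto
  have "\<not> lower_central G j \<subseteq> N"
    using not_less_Least[of j "\<lambda>i. lower_central G i \<subseteq> N"] j unfolding i_def by simp
  then obtain x where x: "x \<in> lower_central G j" "x \<notin> N" by blast
  show ?thesis
  proof (rule that[of x])
    show "x \<in> carrier G" using x lower_central_subset by blast
    show "x \<otimes>\<^bsub>G\<^esub> y \<otimes>\<^bsub>G\<^esub> inv\<^bsub>G\<^esub> x \<otimes>\<^bsub>G\<^esub> inv\<^bsub>G\<^esub> y \<in> N" if "y \<in> carrier G" for y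
    proof (rule subsetD[OF i])
      show "x \<otimes>\<^bsub>G\<^esub> y \<otimes>\<^bsub>G\<^esub> inv\<^bsub>G\<^esub> x \<otimes>\<^bsub>G\<^esub> inv\<^bsub>G\<^esub> y \<in> lower_central G i"
        unfolding j lower_central.simps by (rule generate.incl) (use x that in auto)
    qed
  qed (fact x)
qed

text \<open>A nontrivial central element of the quotient has a power of prime order, and powers of
  central elements are central.\<close>

lemma nilpotent_central_prime_order:
  fixes G (structure)
  assumes "nilpotent_group G" "finite (carrier G)" "N \<lhd> G" "N \<noteq> carrier G"
  obtains X where "X \<in> carrier (G Mod N)"
    "\<And>Y. Y \<in> carrier (G Mod N) \<Longrightarrow> X \<otimes>\<^bsub>G Mod N\<^esub> Y = Y \<otimes>\<^bsub>G Mod N\<^esub> X"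
    "prime (group.ord (G Mod N) X)"
proof -
  interpret normal N G by fact
  interpret Q: group "G Mod N" by (rule factorgroup_is_group)
  obtain x where x: "x \<in> carrier G" "x \<notin> N"
    and comm: "\<And>y. y \<in> carrier G \<Longrightarrow> x \<otimes>\<^bsub>G\<^esub> y \<otimes>\<^bsub>G\<^esub> inv\<^bsub>G\<^esub> x \<otimes>\<^bsub>G\<^esub> inv\<^bsub>G\<^esub> y \<in> N"
    using nilpotent_central_coset[OF assms(1,3,4)] by blast
  define X where "X = N #>\<^bsub>G\<^esub> x"
  have X: "X \<in> carrier (G Mod N)" using x by (auto simp: X_def FactGroup_def RCOSETS_def)
  have central: "X \<otimes>\<^bsub>G Mod N\<^esub> Y = Y \<otimes>\<^bsub>G Mod N\<^esub> X" if Y: "Y \<in> carrier (G Mod N)" for Y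
  proof -
    obtain y where y: "y \<in> carrier G" "Y = N #>\<^bsub>G\<^esub> y"
      using Y by (auto simp: FactGroup_def RCOSETS_def)
    have "x \<otimes> y = (x \<otimes> y \<otimes> inv x \<otimes> inv y) \<otimes> (y \<otimes> x)"
      using x y by (simp add: m_assoc) (simp add: m_assoc[symmetric])
    then have "x \<otimes> y \<in> N #> (y \<otimes> x)"
      using comm[OF y(1)] x y by (auto simp: r_coset_def)
    then have "N #> (y \<otimes> x) = N #> (x \<otimes> y)"
      using x y by (intro repr_independence) (auto intro: subgroup_axioms)
    then show ?thesis
      using x y by (simp add: X_def rcos_sum)
  qed
  have finQ: "finite (carrier (G Mod N))"
    using assms(2) by (simp add: FactGroup_def RCOSETS_def)
  have "X \<noteq> \<one>\<^bsub>G Mod N\<^esub>"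
    using x coset_join1[OF _ x(1) subgroup_axioms] by (auto simp: X_def)
  then have "Q.ord X \<noteq> 1" using Q.ord_eq_1[OF X] by simp
  then obtain q where q: "prime q" "q dvd Q.ord X"
    using prime_factor_nat by blast
  have pos: "Q.ord X > 0" using Q.ord_ge_1[OF finQ X] by simp
  define e where "e = Q.ord X div q"
  have e: "Q.ord X = e * q" "e \<noteq> 0" using q pos by (auto simp: e_def)
  show ?thesis
  proof (rule that)
    show "X [^]\<^bsub>G Mod N\<^esub> e \<in> carrier (G Mod N)" using X by simp
    show "X [^]\<^bsub>G Mod N\<^esub> e \<otimes>\<^bsub>G Mod N\<^esub> Y = Y \<otimes>\<^bsub>G Mod N\<^esub> X [^]\<^bsub>G Mod N\<^esub> e"
      if "Y \<in> carrier (G Mod N)" for Y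
      using Q.group_commutes_pow[OF central[OF that] X that] .
    have "Q.ord (X [^]\<^bsub>G Mod N\<^esub> e) = q"
      using Q.ord_pow[OF X, of e] e by simp
    then show "prime (Q.ord (X [^]\<^bsub>G Mod N\<^esub> e))" using q by simp
  qed
qed

lemma finite_tuples: "finite (carrier G) \<Longrightarrow> finite (tuples G k)"
  by (rule finite_lists_length_eq)

text \<open>Multiplying one generator by a representative of the central element X multiplies the value
  of the word modulo N by a power of X that generates the group of X, so that all cosets of N in M
  are equally likely.\<close>

lemma central_extension_count:
  fixes G (structure)
  assumes "group G" "finite (carrier G)" "N \<lhd> G" "X \<in> carrier (G Mod N)"
    and central: "\<And>Y. Y \<in> carrier (G Mod N) \<Longrightarrow> X \<otimes>\<^bsub>G Mod N\<^esub> Y = Y \<otimes>\<^bsub>G Mod N\<^esub> X"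
    and "prime (group.ord (G Mod N) X)" "w \<in> words k"
    and "\<not> (\<forall>i<k. int (group.ord (G Mod N) X) dvd expo w i)"
  shows "group.ord (G Mod N) X * card {zs \<in> tuples G k. word_eval G zs w \<in> N}
    \<le> card {zs \<in> tuples G k. word_eval G zs w \<in> \<Union>(generate (G Mod N) {X})}"
proof -
  interpret normal N G by fact
  interpret Q: group "G Mod N" by (rule factorgroup_is_group)
  let ?Q = "G Mod N"
  define q where "q = Q.ord X"
  have q: "prime q" using assms by (simp add: q_def)
  obtain i where i: "i < k" "\<not> int q dvd expo w i" using assms(8) by (auto simp: q_def)
  define v where "v = expo w i"
  obtain x where x: "x \<in> carrier G" "X = N #> x"
    using assms(4) by (auto simp: FactGroup_def RCOSETS_def)
  define h where "h = (\<lambda>a. N #> a)"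
  have hom: "h \<in> hom G ?Q" unfolding h_def by (rule r_coset_hom_Mod)
  have hX: "h x = X" using x by (simp add: h_def)
  define C where "C Y = {zs \<in> tuples G k. h (word_eval G zs w) = Y}" for Y
  have finC: "finite (C Y)" for Y
    unfolding C_def by (rule finite_subset[OF _ finite_tuples[OF assms(2), of k]]) auto
  have C_mono: "card (C Y) \<le> card (C (Y \<otimes>\<^bsub>?Q\<^esub> X [^]\<^bsub>?Q\<^esub> v))" for Y
  proof (rule card_inj_on_le[OF _ _ finC])
    let ?f = "\<lambda>zs. zs[i := zs ! i \<otimes> x]"
    have mem: "?f zs \<in> tuples G k" if "zs \<in> tuples G k" for zs
      using that x(1) i(1) set_update_subset_insert[of zs i "zs ! i \<otimes> x"] tuples_nth[OF that i(1)] by auto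
    show "inj_on ?f (C Y)"
    proof (rule inj_onI)
      fix as bs assume ab: "as \<in> C Y" "bs \<in> C Y" "?f as = ?f bs"
      then have t: "as \<in> tuples G k" "bs \<in> tuples G k" by (auto simp: C_def)
      then have l: "length as = k" "length bs = k" by auto
      show "as = bs"
      proof (rule nth_equalityI)
        fix j assume j: "j < length as"
        have "?f as ! j = ?f bs ! j" using ab(3) by simp
        then show "as ! j = bs ! j"
          using j l i(1) x(1) tuples_nth[OF t(1) i(1)] tuples_nth[OF t(2) i(1)]
          by (cases "j = i") auto
      qed (simp add: l)
    qed
    show "?f ` C Y \<subseteq> C (Y \<otimes>\<^bsub>?Q\<^esub> X [^]\<^bsub>?Q\<^esub> v)"
    proof safe
      fix zs assume zs: "zs \<in> C Y"
      then have t: "zs \<in> tuples G k" by (simp add: C_def)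
      then have l: "length zs = k" by simp
      have th: "map h zs \<in> tuples ?Q k"
        using t hom by (auto simp: hom_def)
      have "map h (?f zs) = (map h zs)[i := map h zs ! i \<otimes>\<^bsub>?Q\<^esub> X]"
        using hom_mult[OF hom, of "zs ! i" x] tuples_nth[OF t i(1)] x(1) i(1) l
        by (simp add: map_update hX)
      then have "h (word_eval G (?f zs) w) = word_eval ?Q ((map h zs)[i := map h zs ! i \<otimes>\<^bsub>?Q\<^esub> X]) w"
        using word_eval_hom[OF assms(1) Q.is_group hom mem[OF t] assms(7)] by simp
      also have "\<dots> = word_eval ?Q (map h zs) w \<otimes>\<^bsub>?Q\<^esub> X [^]\<^bsub>?Q\<^esub> v"
        unfolding v_def by (rule Q.word_eval_central_update[OF assms(4) central th assms(7) i(1)])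
      also have "word_eval ?Q (map h zs) w = Y"
        using word_eval_hom[OF assms(1) Q.is_group hom t assms(7)] zs by (simp add: C_def)
      finally show "?f zs \<in> C (Y \<otimes>\<^bsub>?Q\<^esub> X [^]\<^bsub>?Q\<^esub> v)"
        using mem[OF t] by (simp add: C_def)
    qed
  qed
  \<comment> \<open>Lower bounds relative to the trivial coset suffice: each of the q cosets reached
    by iterating the shift has at least as many tuples as N.\<close>
  have C_pow: "card (C \<one>\<^bsub>?Q\<^esub>) \<le> card (C (X [^]\<^bsub>?Q\<^esub> (v * int j)))" for j
  proof (induction j)
    case (Suc j)
    have "X [^]\<^bsub>?Q\<^esub> (v * int j) \<otimes>\<^bsub>?Q\<^esub> X [^]\<^bsub>?Q\<^esub> v = X [^]\<^bsub>?Q\<^esub> (v * int (Suc j))"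
      using Q.int_pow_mult[OF assms(4), of "v * int j" v] by (simp add: algebra_simps)
    then show ?case using Suc C_mono[of "X [^]\<^bsub>?Q\<^esub> (v * int j)"] by simp
  qed simp
  have inj: "j = j'" if "X [^]\<^bsub>?Q\<^esub> (v * int j) = X [^]\<^bsub>?Q\<^esub> (v * int j')" "j < q" "j' < q" for j j'
  proof -
    have "int q dvd v * (int j' - int j)"
      using that(1) Q.int_pow_eq[OF assms(4)] by (simp add: q_def right_diff_distrib)
    moreover have "prime (int q)" using q by simp
    ultimately have "int q dvd int j' - int j"
      using i(2) by (simp add: prime_dvd_mult_iff v_def)
    then have "int j' mod int q = int j mod int q" by (simp add: mod_eq_dvd_iff)
    then show ?thesis using that(2,3) by simp
  qed
  have "C \<one>\<^bsub>?Q\<^esub> = {zs \<in> tuples G k. word_eval G zs w \<in> N}"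
    unfolding C_def h_def
    using coset_join1[OF _ word_eval_closed subgroup_axioms] coset_join2[OF word_eval_closed subgroup_axioms] assms(7)
    by auto
  then have "q * card {zs \<in> tuples G k. word_eval G zs w \<in> N} = (\<Sum>j<q. card (C \<one>\<^bsub>?Q\<^esub>))"
    by simp
  also have "\<dots> \<le> (\<Sum>j<q. card (C (X [^]\<^bsub>?Q\<^esub> (v * int j))))"
    by (intro sum_mono C_pow)
  also have "\<dots> = card (\<Union>j<q. C (X [^]\<^bsub>?Q\<^esub> (v * int j)))"
  proof (rule card_UN_disjoint[symmetric])
    show "\<forall>i\<in>{..<q}. \<forall>j\<in>{..<q}. i \<noteq> j \<longrightarrow> C (X [^]\<^bsub>?Q\<^esub> (v * int i)) \<inter> C (X [^]\<^bsub>?Q\<^esub> (v * int j)) = {}"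
      using inj by (auto simp: C_def)
  qed (auto simp: finC)
  also have "\<dots> \<le> card {zs \<in> tuples G k. word_eval G zs w \<in> \<Union>(generate ?Q {X})}"
  proof (rule card_mono)
    show "finite {zs \<in> tuples G k. word_eval G zs w \<in> \<Union>(generate ?Q {X})}"
      by (rule finite_subset[OF _ finite_tuples[OF assms(2), of k]]) auto
    have "g \<in> h g" if "g \<in> carrier G" for g
      unfolding h_def by (rule rcos_self[OF that subgroup_axioms])
    moreover have "X [^]\<^bsub>?Q\<^esub> (v * int j) \<in> generate ?Q {X}" for j
      unfolding Q.generate_pow[OF assms(4)] by blast
    ultimately show "(\<Union>j<q. C (X [^]\<^bsub>?Q\<^esub> (v * int j))) \<subseteq>
        {zs \<in> tuples G k. word_eval G zs w \<in> \<Union>(generate ?Q {X})}"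
      unfolding C_def using word_eval_closed[OF _ assms(7)] by blast
  qed
  finally show ?thesis by (simp add: q_def)
qed

text \<open>One step up a central series: M is the preimage of the cyclic group generated by X, a
  disjoint union of \<open>ord X\<close> cosets of N. Its generator being central, the cyclic group
  is normal, and so is its preimage.\<close>

lemma central_extension_subgroup:
  fixes G (structure)
  assumes "group G" "finite (carrier G)" "N \<lhd> G" "X \<in> carrier (G Mod N)"
    and central: "\<And>Y. Y \<in> carrier (G Mod N) \<Longrightarrow> X \<otimes>\<^bsub>G Mod N\<^esub> Y = Y \<otimes>\<^bsub>G Mod N\<^esub> X"
  defines "M \<equiv> \<Union>(generate (G Mod N) {X})"
  shows "M \<lhd> G" "N \<subseteq> M" "card M = group.ord (G Mod N) X * card N"
proof -
  interpret normal N G by fact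
  interpret Q: group "G Mod N" by (rule factorgroup_is_group)
  let ?Q = "G Mod N"
  have sub: "subgroup (generate ?Q {X}) ?Q"
    by (rule Q.generate_is_subgroup) (use assms(4) in simp)
  have "generate ?Q {X} \<lhd> ?Q"
  proof (rule Q.normal_invI[OF sub])
    fix Y h assume Y: "Y \<in> carrier ?Q" and h: "h \<in> generate ?Q {X}"
    then obtain e :: int where e: "h = X [^]\<^bsub>?Q\<^esub> e" using Q.generate_pow[OF assms(4)] by auto
    have "Y \<otimes>\<^bsub>?Q\<^esub> h = h \<otimes>\<^bsub>?Q\<^esub> Y"
      unfolding e using Q.int_pow_commutes[OF central[OF Y] assms(4) Y] by simp
    then have "Y \<otimes>\<^bsub>?Q\<^esub> h \<otimes>\<^bsub>?Q\<^esub> inv\<^bsub>?Q\<^esub> Y = h"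
      using Q.inv_solve_right[of h "Y \<otimes>\<^bsub>?Q\<^esub> h" Y] Y subgroup.mem_carrier[OF sub h]
        Q.m_closed[OF Y subgroup.mem_carrier[OF sub h]] by metis
    then show "Y \<otimes>\<^bsub>?Q\<^esub> h \<otimes>\<^bsub>?Q\<^esub> inv\<^bsub>?Q\<^esub> Y \<in> generate ?Q {X}" using h by simp
  qed
  then show "M \<lhd> G" unfolding M_def by (rule factgroup_subgroup_union_normal)
  have "N \<in> generate ?Q {X}" using generate.one[of ?Q "{X}"] by simp
  then show "N \<subseteq> M" by (auto simp: M_def)
  have rc: "generate ?Q {X} \<subseteq> rcosets N"
    using subgroup.subset[OF sub] by (simp add: FactGroup_def)
  have fin: "finite c" if "c \<in> rcosets N" for c
    using that rcosets_finite subset finite_subset[OF subset assms(2)] by blast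
  have "card N * card (generate ?Q {X}) = card M"
    unfolding M_def
  proof (rule card_partition)
    show finQ: "finite (generate ?Q {X})"
      by (rule finite_subset[OF rc]) (use assms(2) in \<open>simp add: RCOSETS_def\<close>)
    show "finite (\<Union> (generate ?Q {X}))"
      using finQ fin rc by blast
    show "card c = card N" if "c \<in> generate ?Q {X}" for c
      using card_rcosets_equal[of c N] rc that subset by auto
    show "c1 \<inter> c2 = {}" if "c1 \<in> generate ?Q {X}" "c2 \<in> generate ?Q {X}" "c1 \<noteq> c2" for c1 c2
      using that rc rcos_disjoint[OF subgroup_axioms] by (auto simp: pairwise_def disjnt_def)
  qed
  then show "card M = group.ord ?Q X * card N"
    using Q.generate_pow_card[OF assms(4)] by (simp add: mult.commute)
qed

text \<open>Induction on the index m of N, enlarging N by a central factor of prime order q until it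
  is all of G. If q fails to divide some exponent, passing from M down to N gains the full factor q.
  Otherwise the trivial bound for N by M is used, and the missing q appears in the product. The
  later application has N trivial.\<close>

lemma nilpotent_word_count:
  fixes G (structure)
  assumes "nilpotent_group G" "finite (carrier G)" "w \<in> words k" "N \<lhd> G" "card (carrier G) = m * card N"
  shows "m * card {zs \<in> tuples G k. word_eval G zs w \<in> N}
    \<le> (\<Prod>q\<in>#prime_factorization m. if \<forall>i<k. int q dvd expo w i then q else 1) * card (tuples G k)"
  using assms(4,5)
proof (induction m arbitrary: N rule: less_induct)
  case (less m)
  interpret normal N G by fact
  let ?c = "\<lambda>N. card {zs \<in> tuples G k. word_eval G zs w \<in> N}"
  have fin: "finite (tuples G k)" by (rule finite_tuples[OF assms(2)])
  have cN: "card N > 0"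
    using subgroup.one_closed[OF subgroup_axioms] finite_subset[OF subset assms(2)] by (metis card_gt_0_iff empty_iff)
  show ?case
  proof (cases "N = carrier G")
    case True
    then have "m = 1" using less.prems(2) cN by simp
    then show ?thesis by (auto intro!: card_mono fin)
  next
    case False
    obtain X where X: "X \<in> carrier (G Mod N)"
      "\<And>Y. Y \<in> carrier (G Mod N) \<Longrightarrow> X \<otimes>\<^bsub>G Mod N\<^esub> Y = Y \<otimes>\<^bsub>G Mod N\<^esub> X"
      "prime (group.ord (G Mod N) X)"
      using nilpotent_central_prime_order[OF assms(1,2) less.prems(1) False] by blast
    define q where "q = group.ord (G Mod N) X"
    define M where "M = \<Union>(generate (G Mod N) {X})"
    note M = central_extension_subgroup[OF is_group assms(2) less.prems(1) X(1,2), folded M_def q_def]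
    interpret M: normal M G by (rule M(1))
    have "card (carrier G) = card (rcosets M) * card M"
      using lagrange[OF M.subgroup_axioms] by (simp add: Coset.order_def)
    then obtain m' where m': "card (carrier G) = m' * card M" by blast
    then have m: "m = q * m'" using less.prems(2) M(3) cN by simp
    have q: "prime q" using X by (simp add: q_def)
    have "card (carrier G) > 0" using assms(2) subset subgroup.one_closed[OF subgroup_axioms] by (metis card_gt_0_iff empty_iff subsetD)
    then have m'0: "m' > 0" using m' by (cases m') auto
    have "m' < m" using m m'0 prime_gt_1_nat[OF q] by simp
    let ?P = "\<lambda>m. \<Prod>q\<in>#prime_factorization m. if \<forall>i<k. int q dvd expo w i then q else 1"
    have IH: "m' * ?c M \<le> ?P m' * card (tuples G k)"
      by (rule less.IH[OF \<open>m' < m\<close> M(1) m'])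
    have P: "?P m = (if \<forall>i<k. int q dvd expo w i then q else 1) * ?P m'"
      using q m m'0 by (simp add: prime_factorization_mult prime_factorization_prime)
    show ?thesis
    proof (cases "\<forall>i<k. int q dvd expo w i")
      case True
      have "?c N \<le> ?c M"
        using M(2) by (intro card_mono finite_subset[OF _ fin]) auto
      then have "m * ?c N \<le> q * (m' * ?c M)" by (simp add: m)
      also have "\<dots> \<le> q * (?P m' * card (tuples G k))" using IH by (rule mult_left_mono) simp
      finally show ?thesis unfolding P using True by (simp add: mult_ac)
    next
      case False
      have "q * ?c N \<le> ?c M"
        using central_extension_count[OF is_group assms(2) less.prems(1) X assms(3)] False
        by (simp add: q_def M_def)
      then have "m * ?c N \<le> m' * ?c M" by (simp add: m mult_ac)
      also note IH
      finally show ?thesis unfolding P using False by (simp only: if_False mult_1_left)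
    qed
  qed
qed

text \<open>With j selected primes of product P and m others of product R, the claim is P \<le> 1 +
  P R j / (j + m), with denominators cleared. If j = 0 then P = 1; if j is positive, then j + m
  \<le> j (1 + m) \<le> j R, because a product of m integers that are at least 2 is at least 1 +
  m.\<close>

lemma prod_mset_selected_le:
  fixes A :: "nat multiset"
  assumes "\<And>q. q \<in># A \<Longrightarrow> q \<ge> 2"
  shows "(\<Prod>q\<in>#A. if D q then q else 1) * size A \<le> size A + prod_mset A * size (filter_mset D A)"
proof -
  have 1: "(\<Prod>q\<in>#A. if D q then q else 1) = prod_mset (filter_mset D A)"
    by (induction A) auto
  have 2: "prod_mset A = prod_mset (filter_mset D A) * prod_mset (filter_mset (\<lambda>q. \<not> D q) A)"
    by (metis multiset_partition prod_mset.union)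
  have 3: "size A = size (filter_mset D A) + size (filter_mset (\<lambda>q. \<not> D q) A)"
    by (metis multiset_partition size_union)
  have 4: "1 + size B \<le> prod_mset B" if "\<And>q. q \<in># B \<Longrightarrow> q \<ge> 2" for B :: "nat multiset"
    using that
  proof (induction B)
    case (add q B)
    then have "1 + size B \<le> prod_mset B" "2 \<le> q" by auto
    then have "2 * (1 + size B) \<le> q * prod_mset B" by (intro mult_mono) auto
    then show ?case by simp
  qed simp
  define j m P R where "j = size (filter_mset D A)" and "m = size (filter_mset (\<lambda>q. \<not> D q) A)"
    and "P = prod_mset (filter_mset D A)" and "R = prod_mset (filter_mset (\<lambda>q. \<not> D q) A)"
  have R: "1 + m \<le> R" unfolding m_def R_def by (rule 4) (use assms in auto)
  show ?thesis
  proof (cases "j = 0")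
    case True
    then have "filter_mset D A = {#}" unfolding j_def by (simp only: size_eq_0_iff_empty)
    then have "P = 1" by (simp only: P_def prod_mset_empty)
    then show ?thesis by (simp add: 1 P_def)
  next
    case False
    then have "j + m \<le> j * (1 + m)" by (cases j) auto
    also have "\<dots> \<le> j * R" by (rule mult_le_mono2[OF R])
    finally have "P * (j + m) \<le> P * (j * R)" by (rule mult_le_mono2)
    also have "\<dots> = P * R * j" by (simp only: mult_ac)
    finally show ?thesis
      unfolding 1 2 3 j_def[symmetric] m_def[symmetric] P_def[symmetric] R_def[symmetric]
      by (rule trans_le_add2)
  qed
qed

section \<open>The walk as the value of a random word\<close>

lemma step_pmf_letter:
  assumes "group G" "zs \<in> tuples G k" "k > 0" "g \<in> carrier G"
  shows "cayley_step s G (mset zs) g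
    = map_pmf (\<lambda>x. g \<otimes>\<^bsub>G\<^esub> (zs ! fst x) [^]\<^bsub>G\<^esub> snd x) (letter_pmf s k)"
proof -
  interpret group G by fact
  have l: "length zs = k" using assms by simp
  have "image_mset (nth zs) (mset_set {..<k}) = mset zs"
    using l by (simp add: lessThan_atLeast0 flip: mset_upt mset_map) (metis map_nth)
  then have Z: "pmf_of_multiset (mset zs) = map_pmf (nth zs) (pmf_of_set {..<k})"
    using assms(3) by (subst map_pmf_of_set) (auto simp: lessThan_empty_iff)
  have cl: "zs ! i \<in> carrier G" if "i \<in> set_pmf (pmf_of_set {..<k})" for i
    using that assms(3) tuples_nth[OF assms(2), of i] by (simp add: lessThan_empty_iff)
  show ?thesis
  proof (cases s)
    case Directed
    then show ?thesis
      unfolding cayley_step_def Z letter_pmf_def sign_pmf_def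
      by (simp add: map_bind_pmf pmf.map_comp o_def map_pmf_def[symmetric] bind_return_pmf)
         (auto simp: map_pmf_def bind_assoc_pmf bind_return_pmf intro!: bind_pmf_cong dest!: cl)
  next
    case Undirected
    then show ?thesis
      unfolding cayley_step_def Z letter_pmf_def sign_pmf_def
      by (auto simp: map_pmf_def bind_assoc_pmf bind_return_pmf int_pow_neg dest!: cl intro!: bind_pmf_cong)
  qed
qed

lemma set_letter_pmf: "k > 0 \<Longrightarrow> x \<in> set_pmf (letter_pmf s k) \<Longrightarrow> fst x < k"
  by (auto simp: letter_pmf_def lessThan_empty_iff)

lemma set_replicate_letter_pmf:
  "k > 0 \<Longrightarrow> w \<in> set_pmf (replicate_pmf m (letter_pmf s k)) \<Longrightarrow> w \<in> words k"
  by (auto simp: set_replicate_pmf words_def dest: set_letter_pmf)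

lemma set_word_pmf: "k > 0 \<Longrightarrow> w \<in> set_pmf (word_pmf s k t) \<Longrightarrow> w \<in> words k"
  by (auto simp: word_pmf_def dest: set_replicate_letter_pmf)

lemma cayley_rw_eq_word_eval:
  assumes "group G" "zs \<in> tuples G k" "k > 0"
  shows "cayley_rw s G (mset zs) t = map_pmf (word_eval G zs) (word_pmf s k t)"
proof -
  interpret group G by fact
  have walk: "cayley_walk s G (mset zs) m = map_pmf (word_eval G zs) (replicate_pmf m (letter_pmf s k))" for m
  proof (induction m)
    case (Suc m)
    have "cayley_walk s G (mset zs) (Suc m)
       = bind_pmf (replicate_pmf m (letter_pmf s k)) (\<lambda>w. cayley_step s G (mset zs) (word_eval G zs w))"
      by (simp add: Suc bind_map_pmf)
    also have "\<dots> = bind_pmf (replicate_pmf m (letter_pmf s k))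
        (\<lambda>w. map_pmf (\<lambda>x. word_eval G zs (x # w)) (letter_pmf s k))"
      by (intro bind_pmf_cong refl)
         (simp add: step_pmf_letter[OF assms] word_eval_closed[OF assms(2)] set_replicate_letter_pmf[OF assms(3)])
    \<comment> \<open>\<open>replicate_pmf\<close> draws the head first, whereas the head is the
      last letter of the walk; the independent draws are interchanged.\<close>
    also have "\<dots> = bind_pmf (letter_pmf s k) (\<lambda>x. bind_pmf (replicate_pmf m (letter_pmf s k))
        (\<lambda>w. return_pmf (word_eval G zs (x # w))))"
      unfolding map_pmf_def by (rule bind_commute_pmf)
    also have "\<dots> = map_pmf (word_eval G zs) (replicate_pmf (Suc m) (letter_pmf s k))"
      by (simp only: replicate_pmf.simps map_bind_pmf map_return_pmf)
    finally show ?case .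
  qed simp
  show ?thesis
    unfolding cayley_rw_def word_pmf_def map_bind_pmf by (intro bind_pmf_cong refl walk)
qed

lemma replicate_pmf_of_set:
  assumes "finite A" "A \<noteq> {}"
  shows "replicate_pmf k (pmf_of_set A) = pmf_of_set {xs. set xs \<subseteq> A \<and> length xs = k}"
proof (rule pmf_eqI)
  have ne: "{xs. set xs \<subseteq> A \<and> length xs = k} \<noteq> {}" for k
  proof -
    obtain a where "a \<in> A" using assms(2) by blast
    then have "replicate k a \<in> {xs. set xs \<subseteq> A \<and> length xs = k}" by auto
    then show ?thesis by blast
  qed
  have fin: "finite {xs. set xs \<subseteq> A \<and> length xs = k}" for k
    by (rule finite_lists_length_eq[OF assms(1)])
  fix xs
  have "pmf (replicate_pmf k (pmf_of_set A)) xs = of_bool (set xs \<subseteq> A \<and> length xs = k) / real (card A) ^ k"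
  proof (induction k arbitrary: xs)
    case 0
    show ?case by (auto simp: indicator_def)
  next
    case (Suc k)
    have r: "replicate_pmf (Suc k) (pmf_of_set A)
        = map_pmf (\<lambda>(x, xs). x # xs) (pair_pmf (pmf_of_set A) (replicate_pmf k (pmf_of_set A)))"
      by (simp add: pair_pmf_def map_bind_pmf)
    show ?case
    proof (cases xs)
      case Nil
      then show ?thesis unfolding r by (subst pmf_map_outside) auto
    next
      case (Cons y ys)
      have "pmf (replicate_pmf (Suc k) (pmf_of_set A)) xs
          = pmf (pmf_of_set A) y * pmf (replicate_pmf k (pmf_of_set A)) ys"
        unfolding r Cons
        using pmf_map_inj'[of "\<lambda>(x, xs). x # xs" "pair_pmf (pmf_of_set A) (replicate_pmf k (pmf_of_set A))" "(y, ys)"]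
        by (auto simp: inj_on_def pmf_pair)
      then show ?thesis
        using assms Cons by (auto simp: Suc indicator_def)
    qed
  qed
  then show "pmf (replicate_pmf k (pmf_of_set A)) xs = pmf (pmf_of_set {xs. set xs \<subseteq> A \<and> length xs = k}) xs"
    using assms fin[of k] ne[of k] by (simp add: card_lists_length_eq indicator_def)
qed

section \<open>Total variation\<close>

lemma tv_dist_ge: "\<bar>measure_pmf.prob p A - measure_pmf.prob q A\<bar> \<le> tv_dist p q"
  unfolding tv_dist_def
proof (rule cSUP_upper)
  have "\<bar>measure_pmf.prob p B - measure_pmf.prob q B\<bar> \<le> 1" for B
    using measure_pmf.prob_le_1[of p B] measure_pmf.prob_le_1[of q B]
      measure_nonneg[of "measure_pmf p" B] measure_nonneg[of "measure_pmf q" B] by linarith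
  then show "bdd_above (range (\<lambda>A. \<bar>measure_pmf.prob p A - measure_pmf.prob q A\<bar>))"
    by (auto intro!: bdd_aboveI[where M = 1])
qed simp

lemma tv_dist_le:
  assumes "\<And>A. \<bar>measure_pmf.prob p A - measure_pmf.prob q A\<bar> \<le> B"
  shows "tv_dist p q \<le> B"
  unfolding tv_dist_def by (rule cSUP_least) (auto simp: assms)

text \<open>The truncated image law \<nu> has mass 1 - \<beta>, so n times its squared L2 distance
  from uniform is n (sum of \<nu>^2) - 1 + 2 \<beta>. Cauchy-Schwarz turns this into an L1 bound,
  and the discarded words cost another \<beta>. Truncating only one of the two words suffices, since
  \<nu> is dominated by the full law; this matches a tilt that acts on one word only.\<close>

lemma tv_dist_truncated:
  fixes P :: "'w pmf" and f :: "'w \<Rightarrow> 'a" and T :: "'w set"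
  assumes "finite C" "C \<noteq> {}" "\<And>w. w \<in> set_pmf P \<Longrightarrow> f w \<in> C"
  defines "\<beta> \<equiv> measure_pmf.prob P (- T)"
    and "X \<equiv> real (card C) * measure_pmf.expectation P (\<lambda>w'. measure_pmf.prob P {w \<in> T. f w = f w'})
      - 1 + 2 * measure_pmf.prob P (- T)"
  shows "0 \<le> X" "tv_dist (map_pmf f P) (pmf_of_set C) \<le> \<beta> + sqrt X"
proof -
  define n where "n = real (card C)"
  have n: "n > 0" using assms(1,2) by (auto simp: n_def card_gt_0_iff)
  define \<nu> where "\<nu> g = measure_pmf.prob P {w \<in> T. f w = g}" for g
  have \<nu>0: "\<nu> g \<ge> 0" for g by (simp add: \<nu>_def)
  have \<nu>_sum: "(\<Sum>g\<in>A \<inter> C. \<nu> g) = measure_pmf.prob P {w \<in> T. f w \<in> A}" for A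
  proof -
    have "(\<Sum>g\<in>A \<inter> C. \<nu> g) = measure_pmf.prob P (\<Union>g\<in>A \<inter> C. {w \<in> T. f w = g})"
      unfolding \<nu>_def using assms(1)
      by (intro measure_pmf.finite_measure_finite_Union[symmetric]) (auto simp: disjoint_family_on_def)
    also have "\<dots> = measure_pmf.prob P {w \<in> T. f w \<in> A}"
      by (rule measure_prob_cong_0) (use assms(3) in \<open>auto simp: set_pmf_iff\<close>)
    finally show ?thesis .
  qed
  have T: "measure_pmf.prob P T = 1 - \<beta>"
    using measure_pmf.prob_compl[of T P] by (simp add: \<beta>_def Compl_eq_Diff_UNIV)
  have \<nu>1: "(\<Sum>g\<in>C. \<nu> g) = 1 - \<beta>"
    using \<nu>_sum[of UNIV] T by simp
  have "measure_pmf.expectation P (\<lambda>w'. \<nu> (f w')) = measure_pmf.expectation (map_pmf f P) \<nu>"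
    by simp
  also have "\<dots> = (\<Sum>g\<in>C. pmf (map_pmf f P) g * \<nu> g)"
    using assms(1,3) by (subst integral_measure_pmf[of C]) auto
  also have "\<dots> \<ge> (\<Sum>g\<in>C. \<nu> g * \<nu> g)"
  proof (intro sum_mono mult_right_mono \<nu>0)
    show "\<nu> g \<le> pmf (map_pmf f P) g" for g
      unfolding \<nu>_def pmf_map by (rule measure_pmf.finite_measure_mono) auto
  qed
  finally have "(\<Sum>g\<in>C. (\<nu> g)\<^sup>2) \<le> measure_pmf.expectation P (\<lambda>w'. \<nu> (f w'))"
    by (simp add: power2_eq_square)
  then have X: "n * (\<Sum>g\<in>C. (\<nu> g)\<^sup>2) - 1 + 2 * \<beta> \<le> X"
    using n by (simp add: X_def \<nu>_def \<beta>_def n_def[symmetric])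
  have "n * (\<Sum>g\<in>C. (\<nu> g - 1 / n)\<^sup>2) = n * (\<Sum>g\<in>C. (\<nu> g)\<^sup>2 - 2 / n * \<nu> g + 1 / n\<^sup>2)"
    by (simp add: power2_diff power_divide algebra_simps)
  also have "\<dots> = n * (\<Sum>g\<in>C. (\<nu> g)\<^sup>2) - 2 * (\<Sum>g\<in>C. \<nu> g) + 1"
    using n by (simp add: sum.distrib sum_subtractf sum_distrib_left[symmetric] n_def[symmetric]
        distrib_left right_diff_distrib power2_eq_square sum_divide_distrib[symmetric])
  finally have sq: "n * (\<Sum>g\<in>C. (\<nu> g - 1 / n)\<^sup>2) = n * (\<Sum>g\<in>C. (\<nu> g)\<^sup>2) - 1 + 2 * \<beta>"
    by (simp add: \<nu>1)
  have "0 \<le> n * (\<Sum>g\<in>C. (\<nu> g - 1 / n)\<^sup>2)" using n by (simp add: sum_nonneg)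
  then show "0 \<le> X" using sq X by linarith
  have "(\<Sum>g\<in>C. \<bar>\<nu> g - 1 / n\<bar>)\<^sup>2 \<le> (\<Sum>g\<in>C. \<bar>\<nu> g - 1 / n\<bar>\<^sup>2) * card C"
    by (rule sum_squared_le_sum_of_squares)
  also have "\<dots> = n * (\<Sum>g\<in>C. (\<nu> g - 1 / n)\<^sup>2)" by (simp add: n_def)
  also have "\<dots> \<le> X" using sq X by linarith
  finally have l1: "(\<Sum>g\<in>C. \<bar>\<nu> g - 1 / n\<bar>) \<le> sqrt X" by (rule real_le_rsqrt)
  show "tv_dist (map_pmf f P) (pmf_of_set C) \<le> \<beta> + sqrt X"
  proof (rule tv_dist_le)
    fix A
    have U: "measure_pmf.prob (pmf_of_set C) A = (\<Sum>g\<in>A \<inter> C. 1 / n)"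
      using assms(1,2) by (simp add: measure_pmf_of_set n_def Int_commute)
    have "\<bar>(\<Sum>g\<in>A \<inter> C. \<nu> g) - measure_pmf.prob (pmf_of_set C) A\<bar> = \<bar>\<Sum>g\<in>A \<inter> C. \<nu> g - 1 / n\<bar>"
      unfolding U by (simp add: sum_subtractf)
    also have "\<dots> \<le> (\<Sum>g\<in>A \<inter> C. \<bar>\<nu> g - 1 / n\<bar>)" by (rule sum_abs)
    also have "\<dots> \<le> (\<Sum>g\<in>C. \<bar>\<nu> g - 1 / n\<bar>)" using assms(1) by (intro sum_mono2) auto
    also note l1
    finally have 1: "\<bar>(\<Sum>g\<in>A \<inter> C. \<nu> g) - measure_pmf.prob (pmf_of_set C) A\<bar> \<le> sqrt X" .
    have m: "measure_pmf.prob (map_pmf f P) A = measure_pmf.prob P {w. f w \<in> A}"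
      by (simp add: vimage_def)
    have 2: "measure_pmf.prob P {w \<in> T. f w \<in> A} \<le> measure_pmf.prob P {w. f w \<in> A}"
      by (rule measure_pmf.finite_measure_mono) auto
    have "measure_pmf.prob P {w. f w \<in> A} \<le> measure_pmf.prob P ({w \<in> T. f w \<in> A} \<union> - T)"
      by (rule measure_pmf.finite_measure_mono) auto
    also have "\<dots> \<le> measure_pmf.prob P {w \<in> T. f w \<in> A} + \<beta>"
      unfolding \<beta>_def by (rule measure_Un_le) auto
    finally show "\<bar>measure_pmf.prob (map_pmf f P) A - measure_pmf.prob (pmf_of_set C) A\<bar> \<le> \<beta> + sqrt X"
      using 1 2 unfolding m \<nu>_sum by (auto simp: \<beta>_def)
  qed
qed

section \<open>Averaging over the random generators\<close>

text \<open>Two words agree exactly when one followed by the inverse of the other is trivial, and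
  the exponents of that word are the differences. The counting bound is combined with the passage
  from product to average; both sides stay multiplied by the number of prime factors and by n to
  keep the arithmetic in integers for most of the proof.\<close>

lemma nilpotent_collision_prob:
  fixes G (structure)
  assumes "nilpotent_group G" "finite (carrier G)" "card (carrier G) = n" "w \<in> words k" "w' \<in> words k"
  shows "real (size (prime_factorization n)) * (real n * measure_pmf.prob (pmf_of_set (tuples G k))
      {zs. word_eval G zs w = word_eval G zs w'})
    \<le> real (size (prime_factorization n))
      + real n * (\<Sum>q\<in>prime_factors n. real (count (prime_factorization n) q)
          * of_bool (\<forall>i<k. int q dvd expo w i - expo w' i))"
proof -
  interpret group G using assms(1) by (simp add: nilpotent_group_def)
  define v where "v = w @ inv_word w'"
  have v: "v \<in> words k" using assms(4,5) by (simp add: v_def)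
  have ev: "expo v i = expo w i - expo w' i" for i by (simp add: v_def expo_append expo_inv_word)
  have fin: "finite (tuples G k)" by (rule finite_tuples[OF assms(2)])
  have "replicate k \<one> \<in> tuples G k" by auto
  then have ne: "tuples G k \<noteq> {}" by blast
  have n0: "n > 0" using assms(2,3) one_closed by (metis card_gt_0_iff empty_iff)
  define A where "A = prime_factorization n"
  define D where "D q \<longleftrightarrow> (\<forall>i<k. int q dvd expo v i)" for q
  let ?c = "card {zs \<in> tuples G k. word_eval G zs v \<in> {\<one>}}"
  have eq: "word_eval G zs w = word_eval G zs w' \<longleftrightarrow> word_eval G zs v \<in> {\<one>}" if "zs \<in> tuples G k" for zs
  proof -
    have c: "word_eval G zs w \<in> carrier G" "word_eval G zs w' \<in> carrier G"
      using word_eval_closed[OF that] assms(4,5) by blast+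
    have "word_eval G zs v = inv (word_eval G zs w') \<otimes> word_eval G zs w"
      using word_eval_append[OF that assms(4), of "inv_word w'"] assms(5)
      by (simp only: v_def inv_word_words word_eval_inv_word[OF that assms(5)])
    then show ?thesis
      using inv_solve_left[OF one_closed c(2,1)] r_one[OF c(2)] by (metis singleton_iff)
  qed
  have "n * ?c \<le> (\<Prod>q\<in>#A. if D q then q else 1) * card (tuples G k)"
    using nilpotent_word_count[OF assms(1,2) v one_is_normal, of n] assms(3) by (simp add: D_def A_def)
  then have "size A * (n * ?c) \<le> size A * ((\<Prod>q\<in>#A. if D q then q else 1) * card (tuples G k))"
    by (rule mult_le_mono2)
  also have "\<dots> = (\<Prod>q\<in>#A. if D q then q else 1) * size A * card (tuples G k)" by (simp only: mult_ac)
  also have "\<dots> \<le> (size A + prod_mset A * size (filter_mset D A)) * card (tuples G k)"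
    by (intro mult_le_mono1 prod_mset_selected_le) (auto simp: A_def in_prime_factors_iff prime_ge_2_nat)
  also have "prod_mset A = n" using n0 by (simp add: A_def prod_mset_prime_factorization_nat)
  also have "size (filter_mset D A) = (\<Sum>q\<in>prime_factors n. count A q * of_bool (D q))"
  proof -
    have "size (filter_mset D A) = (\<Sum>q\<in>set_mset (filter_mset D A). count A q)"
      by (simp add: size_multiset_overloaded_eq)
    also have "\<dots> = (\<Sum>q\<in>prime_factors n. count A q * of_bool (D q))"
      by (rule sum.mono_neutral_cong_left) (auto simp: A_def)
    finally show ?thesis .
  qed
  finally have f1: "real (size A * (n * ?c)) \<le> real ((size A + n * (\<Sum>q\<in>prime_factors n. count A q * of_bool (D q))) * card (tuples G k))"
    by (simp only: of_nat_le_iff)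
  have "{zs. word_eval G zs w = word_eval G zs w'} \<inter> tuples G k = {zs \<in> tuples G k. word_eval G zs v \<in> {\<one>}}"
    using eq by blast
  then have f2: "measure_pmf.prob (pmf_of_set (tuples G k)) {zs. word_eval G zs w = word_eval G zs w'}
     = real ?c / real (card (tuples G k))"
    by (simp only: measure_pmf_of_set[OF ne fin] Int_commute)
  have f3: "real (card (tuples G k)) > 0" using ne fin by (simp add: card_gt_0_iff)
  have "r * (m * y) \<le> r + m * S" if "r * (m * c) \<le> (r + m * S) * u" "y = c / u" "u > 0" for r m y c S u :: real
  proof -
    have "r * (m * y) = r * (m * c) / u" using that(2) by simp
    then show ?thesis using that(1) by (simp only: pos_divide_le_eq[OF that(3)])
  qed
  from this[OF f1[unfolded of_nat_mult of_nat_add] f2 f3] show ?thesis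
    by (simp only: of_nat_sum of_nat_mult of_nat_of_bool A_def D_def ev)
qed

lemma expectation_affine:
  fixes h :: "'i \<Rightarrow> 'a \<Rightarrow> real"
  assumes "\<And>i. integrable (measure_pmf p) (h i)"
  shows "measure_pmf.expectation p (\<lambda>x. c + (\<Sum>i\<in>A. a i * h i x))
    = c + (\<Sum>i\<in>A. a i * measure_pmf.expectation p (h i))"
  by (simp add: assms)

text \<open>The order of averaging is exchanged: with the two words fixed, the generators are
  averaged first, where the group structure enters; then the words are averaged prime by prime,
  where it no longer does.\<close>

lemma truncated_collision_expectation_le:
  fixes G (structure) and a :: real
  assumes "nilpotent_group G" "finite (carrier G)" "card (carrier G) = n" "n \<ge> 2" "k > 0" "0 < t"
  defines "p \<equiv> (1 - exp (- 2 * (t / real k))) / 2"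
  shows "real n * measure_pmf.expectation (pmf_of_set (tuples G k))
      (\<lambda>zs. measure_pmf.expectation (word_pmf s k t) (\<lambda>w'. measure_pmf.prob (word_pmf s k t)
        {w \<in> {w. a \<le> real (odd_count k w)}. word_eval G zs w = word_eval G zs w'}))
    \<le> 1 + real n * (p powr a * (1 - p) powr (real k - a))"
proof -
  let ?P = "word_pmf s k t"
  let ?Z = "pmf_of_set (tuples G k)"
  let ?T = "{w. a \<le> real (odd_count k w)}"
  define A where "A = prime_factorization n"
  define r where "r = size A"
  define D where "D q w w' \<longleftrightarrow> (\<forall>i<k. int q dvd expo w i - expo w' i)" for q w w'
  have "A \<noteq> {#}" using assms(4) by (simp add: A_def prime_factorization_empty_iff)
  then have r: "r > 0" by (simp only: r_def nonempty_has_size)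
  have ind: "measure_pmf.prob Q {w \<in> T. R w} = measure_pmf.expectation Q (\<lambda>w. of_bool (w \<in> T \<and> R w))"
    for Q :: "'x pmf" and T R
  proof -
    have "(\<lambda>w. of_bool (w \<in> T \<and> R w) :: real) = indicator {w \<in> T. R w}"
      by (auto simp: indicator_def)
    then show ?thesis by simp
  qed
  let ?K = "measure_pmf.expectation ?Z (\<lambda>zs. measure_pmf.expectation ?P (\<lambda>w'. measure_pmf.prob ?P
        {w \<in> ?T. word_eval G zs w = word_eval G zs w'}))"
  have "?K = measure_pmf.expectation ?P (\<lambda>w'. measure_pmf.expectation ?Z (\<lambda>zs. measure_pmf.prob ?P
        {w \<in> ?T. word_eval G zs w = word_eval G zs w'}))"
    by (rule expectation_commute_bounded[where B = 1]) simp
  also have "\<dots> = measure_pmf.expectation ?P (\<lambda>w'. measure_pmf.expectation ?P (\<lambda>w.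
      measure_pmf.expectation ?Z (\<lambda>zs. of_bool (w \<in> ?T \<and> word_eval G zs w = word_eval G zs w'))))"
    unfolding ind by (intro Bochner_Integration.integral_cong refl expectation_commute_bounded[where B = 1]) simp
  finally have K: "?K = measure_pmf.expectation ?P (\<lambda>w'. measure_pmf.expectation ?P (\<lambda>w.
      measure_pmf.expectation ?Z (\<lambda>zs. of_bool (w \<in> ?T \<and> word_eval G zs w = word_eval G zs w'))))" .
  \<comment> \<open>The weights \<open>count A q / r\<close> sum to 1, so a bound that is uniform in
    q passes through the average unchanged.\<close>
  define F where "F w w' = 1 / real n + (\<Sum>q\<in>prime_factors n. real (count A q) / real r * of_bool (w \<in> ?T \<and> D q w w'))" for w w'
  have pointwise: "measure_pmf.expectation ?Z (\<lambda>zs. of_bool (w \<in> ?T \<and> word_eval G zs w = word_eval G zs w')) \<le> F w w'"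
    if "w \<in> words k" "w' \<in> words k" for w w'
  proof (cases "w \<in> ?T")
    case True
    have "measure_pmf.expectation ?Z (\<lambda>zs. of_bool (w \<in> ?T \<and> word_eval G zs w = word_eval G zs w'))
       = measure_pmf.prob ?Z {zs. word_eval G zs w = word_eval G zs w'}"
      using ind[of ?Z UNIV "\<lambda>zs. word_eval G zs w = word_eval G zs w'"] True by simp
    also have "\<dots> \<le> (real r + real n * (\<Sum>q\<in>prime_factors n. real (count A q) * of_bool (D q w w'))) / (real r * real n)"
      using nilpotent_collision_prob[OF assms(1-3) that] r assms(4)
      by (simp add: pos_le_divide_eq r_def A_def D_def mult_ac)
    also have "\<dots> = 1 / real n + (\<Sum>q\<in>prime_factors n. real (count A q) * of_bool (D q w w')) / real r"
      using r assms(4) by (simp add: add_divide_distrib)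
    also have "\<dots> = F w w'"
      unfolding F_def sum_divide_distrib using True by (intro arg_cong2[where f = "(+)"] sum.cong refl) simp
    finally show ?thesis .
  next
    case False
    then show ?thesis by (simp add: F_def sum_nonneg)
  qed
  define B where "B = 1 / real n + (\<Sum>q\<in>prime_factors n. real (count A q) / real r)"
  have FB: "\<bar>F w w'\<bar> \<le> B" for w w'
  proof -
    have "0 \<le> F w w'" by (simp add: F_def sum_nonneg)
    moreover have "F w w' \<le> B"
      unfolding F_def B_def by (intro add_left_mono sum_mono) (auto simp: of_bool_def)
    ultimately show ?thesis by simp
  qed
  have "?K \<le> measure_pmf.expectation ?P (\<lambda>w'. measure_pmf.expectation ?P (\<lambda>w. F w w'))"
    unfolding K
  proof (rule integral_mono_AE)
    show "integrable (measure_pmf ?P) (\<lambda>w'. measure_pmf.expectation ?P (\<lambda>w.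
        measure_pmf.expectation ?Z (\<lambda>zs. of_bool (w \<in> ?T \<and> word_eval G zs w = word_eval G zs w') :: real)))"
      by (intro integrable_pmf_bounded[where B = 1] expectation_abs_le) simp
    show "integrable (measure_pmf ?P) (\<lambda>w'. measure_pmf.expectation ?P (\<lambda>w. F w w'))"
      by (intro integrable_pmf_bounded[where B = B] expectation_abs_le FB)
    show "AE w' in measure_pmf ?P. measure_pmf.expectation ?P (\<lambda>w.
        measure_pmf.expectation ?Z (\<lambda>zs. of_bool (w \<in> ?T \<and> word_eval G zs w = word_eval G zs w') :: real))
      \<le> measure_pmf.expectation ?P (\<lambda>w. F w w')"
    proof (rule AE_pmfI, rule integral_mono_AE)
      fix w' assume w': "w' \<in> set_pmf ?P"
      show "integrable (measure_pmf ?P) (\<lambda>w.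
          measure_pmf.expectation ?Z (\<lambda>zs. of_bool (w \<in> ?T \<and> word_eval G zs w = word_eval G zs w') :: real))"
        by (intro integrable_pmf_bounded[where B = 1] expectation_abs_le) simp
      show "integrable (measure_pmf ?P) (\<lambda>w. F w w')" by (rule integrable_pmf_bounded[OF FB])
      show "AE w in measure_pmf ?P.
          measure_pmf.expectation ?Z (\<lambda>zs. of_bool (w \<in> ?T \<and> word_eval G zs w = word_eval G zs w') :: real) \<le> F w w'"
        by (rule AE_pmfI, rule pointwise) (auto intro: set_word_pmf[OF assms(5)] w')
    qed
  qed
  also have "\<dots> = 1 / real n + (\<Sum>q\<in>prime_factors n. real (count A q) / real r *
      measure_pmf.expectation ?P (\<lambda>w'. measure_pmf.prob ?P {w \<in> ?T. D q w w'}))"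
  proof -
    have i1: "integrable (measure_pmf ?P) (\<lambda>w. of_bool (w \<in> ?T \<and> D q w w') :: real)" for q w'
      by (rule integrable_pmf_bounded[where B = 1]) simp
    have i2: "integrable (measure_pmf ?P) (\<lambda>w'. measure_pmf.prob ?P {w \<in> ?T. D q w w'})" for q
      by (rule integrable_pmf_bounded[where B = 1]) simp
    have "measure_pmf.expectation ?P (\<lambda>w. F w w') = 1 / real n + (\<Sum>q\<in>prime_factors n. real (count A q) / real r *
        measure_pmf.prob ?P {w \<in> ?T. D q w w'})" for w'
      unfolding F_def ind by (rule expectation_affine) (rule i1)
    then show ?thesis by (simp only: expectation_affine[OF i2])
  qed
  also have "\<dots> \<le> 1 / real n + (\<Sum>q\<in>prime_factors n. real (count A q) / real r *
      (p powr a * (1 - p) powr (real k - a)))"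
  proof (intro add_left_mono sum_mono mult_left_mono)
    fix q assume "q \<in> prime_factors n"
    then have "prime (int q)" by (auto simp: in_prime_factors_iff)
    from typical_collision_le[OF this assms(6,5), of s a]
    show "measure_pmf.expectation ?P (\<lambda>w'. measure_pmf.prob ?P {w \<in> ?T. D q w w'})
        \<le> p powr a * (1 - p) powr (real k - a)"
      by (simp add: p_def D_def)
  qed simp
  also have "\<dots> = 1 / real n + (\<Sum>q\<in>prime_factors n. real (count A q)) / real r *
      (p powr a * (1 - p) powr (real k - a))"
    unfolding sum_divide_distrib sum_distrib_right ..
  also have "(\<Sum>q\<in>prime_factors n. real (count A q)) = real r"
    by (simp add: r_def A_def size_multiset_overloaded_eq)
  finally have "?K \<le> 1 / real n + p powr a * (1 - p) powr (real k - a)" using r by simp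
  then have "real n * ?K \<le> real n * (1 / real n + p powr a * (1 - p) powr (real k - a))"
    by (rule mult_left_mono) simp
  then show ?thesis using assms(4) by (simp add: distrib_left)
qed

text \<open>Markov's inequality over the generators, applied to the nonnegative quantity X under the
  root: if the distance exceeds \<epsilon> although \<beta> \<le> \<epsilon> / 2, then X is at least
  (\<epsilon> / 2)^2.\<close>

lemma tv_dist_le_whp:
  fixes G (structure) and a \<epsilon> :: real and s :: direction
  assumes "nilpotent_group G" "finite (carrier G)" "card (carrier G) = n" "n \<ge> 2" "k > 0" "0 < t" "0 < \<epsilon>"
  defines "p \<equiv> (1 - exp (- 2 * (t / real k))) / 2"
    and "\<beta> \<equiv> measure_pmf.prob (word_pmf s k t) {w. real (odd_count k w) < a}"
  assumes "\<beta> \<le> \<epsilon> / 2"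
  shows "1 - 4 * (real n * (p powr a * (1 - p) powr (real k - a)) + 2 * \<beta>) / \<epsilon>\<^sup>2
    \<le> measure_pmf.prob (random_generators G k)
        {Z. tv_dist (cayley_rw s G Z t) (pmf_of_set (carrier G)) \<le> \<epsilon>}"
proof -
  interpret group G using assms(1) by (simp add: nilpotent_group_def)
  let ?P = "word_pmf s k t"
  let ?Z = "pmf_of_set (tuples G k)"
  let ?T = "{w. a \<le> real (odd_count k w)}"
  let ?tv = "\<lambda>zs. tv_dist (cayley_rw s G (mset zs) t) (pmf_of_set (carrier G))"
  define K where "K zs = measure_pmf.expectation ?P (\<lambda>w'. measure_pmf.prob ?P
        {w \<in> ?T. word_eval G zs w = word_eval G zs w'})" for zs
  define X where "X zs = real n * K zs - 1 + 2 * \<beta>" for zs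
  have cne: "carrier G \<noteq> {}" using one_closed by blast
  have fin: "finite (tuples G k)" by (rule finite_tuples[OF assms(2)])
  have "replicate k \<one> \<in> tuples G k" by auto
  then have ne: "tuples G k \<noteq> {}" by blast
  have comp: "- ?T = {w. real (odd_count k w) < a}" by auto
  have tv: "0 \<le> X zs" "?tv zs \<le> \<beta> + sqrt (X zs)" if zs: "zs \<in> tuples G k" for zs
  proof -
    have "word_eval G zs w \<in> carrier G" if "w \<in> set_pmf ?P" for w
      using word_eval_closed[OF zs set_word_pmf[OF assms(5) that]] .
    note * = tv_dist_truncated[OF assms(2) cne this, where T = ?T, unfolded comp assms(3)]
    show "0 \<le> X zs" using *(1) by (simp add: X_def K_def \<beta>_def)
    show "?tv zs \<le> \<beta> + sqrt (X zs)"
      using *(2) unfolding cayley_rw_eq_word_eval[OF is_group zs assms(5)]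
      by (simp add: X_def K_def \<beta>_def)
  qed
  have rg: "measure_pmf.prob (random_generators G k) {Z. tv_dist (cayley_rw s G Z t) (pmf_of_set (carrier G)) \<le> \<epsilon>}
     = measure_pmf.prob ?Z {zs. ?tv zs \<le> \<epsilon>}"
    by (simp add: random_generators_def replicate_pmf_of_set[OF assms(2) cne] vimage_def)
  have fs: "finite (set_pmf ?Z)" using fin ne by simp
  have "measure_pmf.expectation ?Z X = real n * measure_pmf.expectation ?Z K - 1 + 2 * \<beta>"
    unfolding X_def using fs by (simp add: integrable_measure_pmf_finite)
  also have "\<dots> \<le> real n * (p powr a * (1 - p) powr (real k - a)) + 2 * \<beta>"
    using truncated_collision_expectation_le[OF assms(1-6), of s a]
    unfolding K_def p_def by simp
  finally have EX: "measure_pmf.expectation ?Z X \<le> real n * (p powr a * (1 - p) powr (real k - a)) + 2 * \<beta>" .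
  have "measure_pmf.prob ?Z {zs. \<not> ?tv zs \<le> \<epsilon>} \<le> measure_pmf.prob ?Z {zs \<in> space ?Z. (\<epsilon> / 2)\<^sup>2 \<le> X zs}"
  proof (rule measure_pmf.finite_measure_mono_AE)
    show "AE zs in ?Z. zs \<in> {zs. \<not> ?tv zs \<le> \<epsilon>} \<longrightarrow> zs \<in> {zs \<in> space ?Z. (\<epsilon> / 2)\<^sup>2 \<le> X zs}"
    proof (rule AE_pmfI)
      fix zs assume "zs \<in> set_pmf ?Z"
      then have zs: "zs \<in> tuples G k" using fin ne by simp
      have "\<epsilon> / 2 < sqrt (X zs)" if "\<not> ?tv zs \<le> \<epsilon>"
        using that tv(2)[OF zs] assms(10) by linarith
      then have "(\<epsilon> / 2)\<^sup>2 \<le> X zs" if "\<not> ?tv zs \<le> \<epsilon>"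
        using that tv(1)[OF zs] power_mono[of "\<epsilon> / 2" "sqrt (X zs)" 2] assms(7) by simp
      then show "zs \<in> {zs. \<not> ?tv zs \<le> \<epsilon>} \<longrightarrow> zs \<in> {zs \<in> space ?Z. (\<epsilon> / 2)\<^sup>2 \<le> X zs}"
        by simp
    qed
  qed simp
  also have "\<dots> \<le> measure_pmf.expectation ?Z X / (\<epsilon> / 2)\<^sup>2"
  proof (rule integral_Markov_inequality_measure[where A = "{}"])
    show "AE zs in ?Z. 0 \<le> X zs"
      by (rule AE_pmfI, rule tv(1)) (simp only: set_pmf_of_set[OF ne fin])
  qed (use assms(7) in \<open>auto intro: integrable_measure_pmf_finite[OF fs]\<close>)
  also have "\<dots> \<le> (real n * (p powr a * (1 - p) powr (real k - a)) + 2 * \<beta>) / (\<epsilon> / 2)\<^sup>2"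
    by (rule divide_right_mono[OF EX]) simp
  also have "\<dots> = 4 * (real n * (p powr a * (1 - p) powr (real k - a)) + 2 * \<beta>) / \<epsilon>\<^sup>2"
    by (simp add: power_divide)
  finally have "measure_pmf.prob ?Z {zs. \<not> ?tv zs \<le> \<epsilon>}
     \<le> 4 * (real n * (p powr a * (1 - p) powr (real k - a)) + 2 * \<beta>) / \<epsilon>\<^sup>2" .
  moreover have "measure_pmf.prob ?Z {zs. \<not> ?tv zs \<le> \<epsilon>} = 1 - measure_pmf.prob ?Z {zs. ?tv zs \<le> \<epsilon>}"
    using measure_pmf.prob_compl[of "{zs. ?tv zs \<le> \<epsilon>}" ?Z] by (simp add: Compl_eq_Diff_UNIV[symmetric] Collect_neg_eq)
  ultimately show ?thesis unfolding rg by linarith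
qed

section \<open>The elementary abelian group\<close>

lemma comm_group_Z2_power: "comm_group (Z2_power d)"
proof -
  have "group (Z2_power d)" unfolding Z2_power_def by simp
  then show ?thesis
    by (rule group.group_comm_groupI) (simp add: Z2_power_def add.commute)
qed

lemma carrier_Z2_power: "carrier (Z2_power d) = {..<d} \<rightarrow>\<^sub>E {0..<2}"
  by (simp add: Z2_power_def carrier_integer_mod_group)

lemma finite_carrier_Z2_power: "finite (carrier (Z2_power d))"
  unfolding carrier_Z2_power by (intro finite_PiE) auto

lemma card_carrier_Z2_power: "card (carrier (Z2_power d)) = 2 ^ d"
  unfolding carrier_Z2_power by (simp add: card_PiE)

lemma Z2_power_square:
  assumes "x \<in> carrier (Z2_power d)"
  shows "x \<otimes>\<^bsub>Z2_power d\<^esub> x = \<one>\<^bsub>Z2_power d\<^esub>"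
proof -
  have "(x i + x i) mod 2 = 0" if "i < d" for i by simp
  then show ?thesis by (auto simp: Z2_power_def restrict_def fun_eq_iff)
qed

lemma Z2_power_int_pow:
  assumes "x \<in> carrier (Z2_power d)"
  shows "x [^]\<^bsub>Z2_power d\<^esub> (e::int) = (if odd e then x else \<one>\<^bsub>Z2_power d\<^esub>)"
proof -
  interpret comm_group "Z2_power d" by (rule comm_group_Z2_power)
  have sq: "x [^]\<^bsub>Z2_power d\<^esub> (2 * j) = \<one>\<^bsub>Z2_power d\<^esub>" for j :: int
  proof -
    have "x [^]\<^bsub>Z2_power d\<^esub> (2 * j) = (x \<otimes>\<^bsub>Z2_power d\<^esub> x) [^]\<^bsub>Z2_power d\<^esub> j"
      using assms int_pow_mult[OF assms, of j j] int_pow_mult_distrib[OF refl assms assms, of j] by simp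
    then show ?thesis by (simp add: Z2_power_square[OF assms])
  qed
  show ?thesis
  proof (cases "odd e")
    case True
    then obtain j where "e = 2 * j + 1" by (elim oddE)
    then show ?thesis using sq assms by (simp add: int_pow_mult)
  next
    case False
    then obtain j where "e = 2 * j" by (auto elim: evenE)
    then show ?thesis using sq by simp
  qed
qed

lemma (in comm_group) word_eval_finprod:
  assumes "zs \<in> tuples G k" "w \<in> words k"
  shows "word_eval G zs w = (\<Otimes>i\<in>{..<k}. (zs ! i) [^] expo w i)"
  using assms(2)
proof (induction w)
  case (Cons x w)
  let ?f = "\<lambda>i. (zs ! i) [^] expo w i" and ?g = "\<lambda>i. (zs ! i) [^] snd x"
  have cl: "?f \<in> {..<k} \<rightarrow> carrier G" "?g \<in> {..<k} \<rightarrow> carrier G"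
    "(\<lambda>i. if i = fst x then ?g i else \<one>) \<in> {..<k} \<rightarrow> carrier G"
    using tuples_nth[OF assms(1)] by auto
  have x: "fst x \<in> {..<k}" using Cons.prems by simp
  have "(\<Otimes>i\<in>{..<k}. (zs ! i) [^] expo (x # w) i) = (\<Otimes>i\<in>{..<k}. ?f i \<otimes> (if i = fst x then ?g i else \<one>))"
  proof (rule finprod_cong')
    show "(zs ! i) [^] expo (x # w) i = ?f i \<otimes> (if i = fst x then ?g i else \<one>)" if "i \<in> {..<k}" for i
      using tuples_nth[OF assms(1), of i] that by (auto simp: int_pow_mult)
  qed (use tuples_nth[OF assms(1)] in auto)
  also have "\<dots> = (\<Otimes>i\<in>{..<k}. ?f i) \<otimes> ?g (fst x)"
    using finprod_multf[OF cl(1,3)] finprod_singleton_swap[OF x _ cl(2)] by simp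
  finally show ?case using Cons by simp
qed simp

text \<open>Include each index independently with probability p \<le> 1/2. Every set with at most b
  elements then has probability at least p^b (1 - p)^(k - b), and these probabilities sum to at most
  1.\<close>

lemma card_subsets_le:
  fixes p b :: real
  assumes "0 < p" "p \<le> 1 / 2"
  shows "real (card {B. B \<subseteq> {..<k} \<and> real (card B) \<le> b}) \<le> p powr (- b) * (1 - p) powr (b - real k)"
proof -
  let ?S = "{B. B \<subseteq> {..<k} \<and> real (card B) \<le> b}"
  have fin: "finite (Pow {..<k})" by simp
  have w: "p powr b * (1 - p) powr (real k - b) \<le> p ^ card B * (1 - p) ^ card ({..<k} - B)" if "B \<in> ?S" for B
  proof -
    have B: "B \<subseteq> {..<k}" "real (card B) \<le> b" using that by auto
    then have cB: "card ({..<k} - B) = k - card B" "card B \<le> k"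
      using card_mono[OF _ B(1)] finite_subset[OF B(1)] by (auto simp: card_Diff_subset)
    define c where "c = real (card B)"
    have "p powr b * (1 - p) powr (real k - b) = p powr c * (p powr (b - c) * (1 - p) powr (real k - b))"
      by (simp add: powr_add[symmetric] mult.assoc[symmetric])
    also have "\<dots> \<le> p powr c * ((1 - p) powr (b - c) * (1 - p) powr (real k - b))"
      using assms B(2) by (intro mult_left_mono mult_right_mono powr_mono2) (auto simp: c_def)
    also have "\<dots> = p powr real (card B) * (1 - p) powr (real k - real (card B))"
      by (simp add: powr_add[symmetric] c_def)
    finally have "p powr b * (1 - p) powr (real k - b) \<le> p powr real (card B) * (1 - p) powr (real k - real (card B))" .
    then show ?thesis
      using assms cB by (simp add: powr_realpow[symmetric] of_nat_diff)
  qed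
  have "real (card ?S) * (p powr b * (1 - p) powr (real k - b)) = (\<Sum>B\<in>?S. p powr b * (1 - p) powr (real k - b))"
    by simp
  also have "\<dots> \<le> (\<Sum>B\<in>?S. p ^ card B * (1 - p) ^ card ({..<k} - B))"
    by (rule sum_mono) (rule w)
  also have "\<dots> \<le> (\<Sum>B\<in>Pow {..<k}. p ^ card B * (1 - p) ^ card ({..<k} - B))"
    using assms by (intro sum_mono2) auto
  also have "\<dots> = (\<Prod>i<k. p + (1 - p))"
    by (subst prod_add) simp_all
  finally have "real (card ?S) * (p powr b * (1 - p) powr (real k - b)) \<le> 1" by simp
  then have "real (card ?S) \<le> 1 / (p powr b * (1 - p) powr (real k - b))"
    using assms by (subst pos_le_divide_eq) auto
  also have "\<dots> = p powr (- b) * (1 - p) powr (b - real k)"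
    using powr_minus_divide[of "1 - p" "real k - b"] by (simp add: powr_minus_divide)
  finally show ?thesis .
qed

text \<open>The position depends only on which generators have odd exponent. The positions reached
  with at most b odd exponents are therefore no more numerous than the index sets of size at most b,
  for every choice of generators; this set of positions is the test set.\<close>

lemma Z2_power_tv_dist_ge:
  fixes p b :: real
  assumes "zs \<in> tuples (Z2_power d) k" "k > 0" "0 < p" "p \<le> 1 / 2"
  shows "measure_pmf.prob (word_pmf s k t) {w. real (odd_count k w) \<le> b}
      - p powr (- b) * (1 - p) powr (b - real k) / 2 ^ d
    \<le> tv_dist (cayley_rw s (Z2_power d) (mset zs) t) (pmf_of_set (carrier (Z2_power d)))"
proof -
  interpret comm_group "Z2_power d" by (rule comm_group_Z2_power)
  let ?G = "Z2_power d"
  let ?f = "word_eval ?G zs"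
  define F where "F B = finprod ?G (\<lambda>i. if i \<in> B then zs ! i else \<one>\<^bsub>?G\<^esub>) {..<k}" for B
  let ?S = "{B. B \<subseteq> {..<k} \<and> real (card B) \<le> b}"
  let ?A = "F ` ?S"
  have fin: "finite ?S" by (rule finite_subset[of _ "Pow {..<k}"]) auto
  have ev: "?f w = F {i. i < k \<and> odd (expo w i)}" if "w \<in> words k" for w
    unfolding word_eval_finprod[OF assms(1) that] F_def
    by (rule finprod_cong') (use tuples_nth[OF assms(1)] in \<open>auto simp: Z2_power_int_pow\<close>)
  have "measure_pmf.prob (word_pmf s k t) {w. real (odd_count k w) \<le> b}
      \<le> measure_pmf.prob (word_pmf s k t) {w. ?f w \<in> ?A}"
  proof (rule measure_pmf.finite_measure_mono_AE)
    show "AE w in word_pmf s k t. w \<in> {w. real (odd_count k w) \<le> b} \<longrightarrow> w \<in> {w. ?f w \<in> ?A}"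
    proof (rule AE_pmfI, rule impI)
      fix w assume "w \<in> set_pmf (word_pmf s k t)" "w \<in> {w. real (odd_count k w) \<le> b}"
      then have "{i. i < k \<and> odd (expo w i)} \<in> ?S" "?f w = F {i. i < k \<and> odd (expo w i)}"
        using ev[OF set_word_pmf[OF assms(2)]] by (auto simp: odd_count_def)
      then show "w \<in> {w. ?f w \<in> ?A}" by blast
    qed
  qed simp
  also have "\<dots> = measure_pmf.prob (cayley_rw s ?G (mset zs) t) ?A"
    by (simp add: cayley_rw_eq_word_eval[OF is_group assms(1,2)] vimage_def)
  finally have 1: "measure_pmf.prob (word_pmf s k t) {w. real (odd_count k w) \<le> b}
     \<le> measure_pmf.prob (cayley_rw s ?G (mset zs) t) ?A" .
  have ne: "carrier ?G \<noteq> {}" using one_closed by blast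
  have "measure_pmf.prob (pmf_of_set (carrier ?G)) ?A = real (card (carrier ?G \<inter> ?A)) / 2 ^ d"
    using measure_pmf_of_set[OF ne finite_carrier_Z2_power] by (simp add: card_carrier_Z2_power)
  also have "\<dots> \<le> p powr (- b) * (1 - p) powr (b - real k) / 2 ^ d"
  proof (rule divide_right_mono)
    have "card (carrier ?G \<inter> ?A) \<le> card ?A" using fin by (intro card_mono) auto
    also have "\<dots> \<le> card ?S" by (rule card_image_le[OF fin])
    finally show "real (card (carrier ?G \<inter> ?A)) \<le> p powr (- b) * (1 - p) powr (b - real k)"
      using card_subsets_le[OF assms(3,4), of k b] by linarith
  qed simp
  finally show ?thesis
    using 1 tv_dist_ge[of "cayley_rw s ?G (mset zs) t" ?A "pmf_of_set (carrier ?G)"] by linarith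
qed

section \<open>Binary entropy\<close>

definition entropy :: "real \<Rightarrow> real" where
  "entropy p = - p * ln p - (1 - p) * ln (1 - p)"

text \<open>Nonnegativity of relative entropy (Gibbs). The right-hand side is the tangent to the
  entropy at p, so the statement is concavity in the form used below.\<close>

lemma entropy_gibbs:
  assumes "0 < p" "p < 1" "0 < q" "q < 1"
  shows "entropy q \<le> entropy p + (q - p) * ln ((1 - p) / p)"
proof -
  have *: "y * ln (x / y) \<le> x - y" if "0 < x" "0 < y" for x y :: real
  proof -
    have "y * ln (x / y) \<le> y * (x / y - 1)"
      using that by (intro mult_left_mono ln_le_minus_one) auto
    also have "\<dots> = x - y" using that by (simp add: field_simps)
    finally show ?thesis .
  qed
  have 1: "q * ln (p / q) \<le> p - q" using * assms by simp
  have 2: "(1 - q) * ln ((1 - p) / (1 - q)) \<le> q - p" using *[of "1 - p" "1 - q"] assms by simp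
  have "entropy p + (q - p) * ln ((1 - p) / p) - entropy q
      = - (q * ln (p / q)) - (1 - q) * ln ((1 - p) / (1 - q))"
    using assms by (simp add: entropy_def ln_div algebra_simps)
  then show ?thesis using 1 2 by linarith
qed

text \<open>The logarithm is twice the inverse hyperbolic tangent of x; at x = L it is the slope of
  the entropy at (1 - L) / 2.\<close>

lemma ln_ratio_ge:
  fixes x :: real
  assumes "0 \<le> x" "x < 1"
  shows "2 * x \<le> ln ((1 + x) / (1 - x))"
proof -
  let ?g = "\<lambda>x::real. ln (1 + x) - ln (1 - x) - 2 * x"
  have "?g 0 \<le> ?g x"
  proof (rule DERIV_nonneg_imp_nondecreasing[OF assms(1)])
    fix y :: real assume y: "0 \<le> y" "y \<le> x"
    have "y\<^sup>2 < 1" using y assms by (simp add: abs_square_less_1)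
    then have "2 \<le> 2 / (1 - y\<^sup>2)" by (subst pos_le_divide_eq) auto
    moreover have "1 / (1 + y) + 1 / (1 - y) = 2 / (1 - y\<^sup>2)"
      using y assms by (subst add_frac_eq) (auto simp: power2_eq_square algebra_simps)
    moreover have "(?g has_real_derivative 1 / (1 + y) + 1 / (1 - y) - 2) (at y)"
      using y assms by (auto intro!: derivative_eq_intros simp: inverse_eq_divide)
    ultimately show "\<exists>z. (?g has_real_derivative z) (at y) \<and> 0 \<le> z" by (intro exI conjI) auto
  qed
  then show ?thesis using assms by (simp add: ln_div)
qed

lemma entropy_exists:
  assumes "0 < y" "y < ln 2"
  obtains p where "0 < p" "p < 1 / 2" "entropy p = y"
proof -
  have "((\<lambda>p. - p * ln p - (1 - p) * ln (1 - p)) \<longlongrightarrow> 0) (at_right (0::real))"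
    by real_asymp
  then have "eventually (\<lambda>p. entropy p < y) (at_right 0)"
    unfolding entropy_def using assms(1) by (rule order_tendstoD)
  moreover have "eventually (\<lambda>p::real. p < 1 / 2) (at_right 0)"
    by (rule order_tendstoD[OF tendsto_ident_at]) simp
  ultimately have "eventually (\<lambda>p::real. entropy p < y \<and> 0 < p \<and> p < 1 / 2) (at_right 0)"
    using eventually_at_right_less[of 0] by eventually_elim auto
  then obtain x where x: "entropy x < y" "0 < x" "x < 1 / 2"
    using eventually_happens' trivial_limit_at_right_real by blast
  have half: "entropy (1 / 2) = ln 2" by (simp add: entropy_def ln_div)
  have "\<exists>p\<ge>x. p \<le> 1 / 2 \<and> entropy p = y"
  proof (rule IVT')
    show "continuous_on {x..1 / 2} entropy"
      unfolding entropy_def using x by (intro continuous_intros) auto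
  qed (use x half assms in auto)
  then obtain p where p: "x \<le> p" "p \<le> 1 / 2" "entropy p = y" by blast
  have "p \<noteq> 1 / 2" using half p(3) assms(2) by (metis less_irrefl)
  then show ?thesis using that[of p] p x by auto
qed

text \<open>The deficit is the relative entropy to a fair bit; ln y \<le> y - 1 bounds it by L^2. It
  turns a large k - log2 n into a large k L0^2.\<close>

lemma ln_2_minus_entropy_le:
  assumes "0 < L" "L < 1"
  shows "ln 2 - entropy ((1 - L) / 2) \<le> L\<^sup>2"
proof -
  have "1 - (1 - L) / 2 = (1 + L) / 2" by (simp add: field_simps)
  then have "ln 2 - entropy ((1 - L) / 2) = ((1 - L) * ln (1 - L) + (1 + L) * ln (1 + L)) / 2"
    using assms by (simp add: entropy_def ln_div field_simps)
  also have "\<dots> \<le> ((1 - L) * (- L) + (1 + L) * L) / 2"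
    using assms ln_le_minus_one[of "1 - L"] ln_le_minus_one[of "1 + L"]
    by (intro divide_right_mono add_mono mult_left_mono) auto
  also have "\<dots> = L\<^sup>2" by (simp add: power2_eq_square algebra_simps)
  finally show ?thesis .
qed

text \<open>The tangent at the midpoint M = (L + L') / 2 has slope at least 2 M and is followed from
  M to L', which gives (L' - L) M / 2. On the other half only monotonicity is used.\<close>

lemma entropy_diff_ge:
  assumes "0 < L" "L \<le> L'" "L' < 1"
  shows "(L'\<^sup>2 - L\<^sup>2) / 4 \<le> entropy ((1 - L) / 2) - entropy ((1 - L') / 2)"
proof -
  define M where "M = (L + L') / 2"
  have M: "0 < M" "M < 1" using assms by (auto simp: M_def)
  have r: "(1 - (1 - x) / 2) / ((1 - x) / 2) = (1 + x) / (1 - x)" for x :: real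
  proof -
    have "1 - (1 - x) / 2 = (1 + x) / 2" by (simp add: field_simps)
    then show ?thesis by simp
  qed
  have "entropy ((1 - L') / 2) \<le> entropy ((1 - M) / 2) + ((1 - L') / 2 - (1 - M) / 2) * ln ((1 + M) / (1 - M))"
    using entropy_gibbs[of "(1 - M) / 2" "(1 - L') / 2"] M assms unfolding r by simp
  also have "((1 - L') / 2 - (1 - M) / 2) * ln ((1 + M) / (1 - M)) = - ((L' - L) / 4) * ln ((1 + M) / (1 - M))"
    by (simp add: M_def field_simps)
  also have "\<dots> \<le> - ((L' - L) / 4) * (2 * M)"
    using ln_ratio_ge[of M] M assms by (intro mult_left_mono_neg) auto
  also have "\<dots> = - ((L'\<^sup>2 - L\<^sup>2) / 4)"
    by (simp add: M_def power2_eq_square field_simps)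
  finally have 1: "entropy ((1 - L') / 2) \<le> entropy ((1 - M) / 2) - (L'\<^sup>2 - L\<^sup>2) / 4" by simp
  have "entropy ((1 - M) / 2) \<le> entropy ((1 - L) / 2) + ((1 - M) / 2 - (1 - L) / 2) * ln ((1 + L) / (1 - L))"
    using entropy_gibbs[of "(1 - L) / 2" "(1 - M) / 2"] M assms unfolding r by simp
  also have "\<dots> \<le> entropy ((1 - L) / 2)"
    using ln_ratio_ge[of L] assms by (simp add: M_def mult_nonpos_nonneg)
  finally show ?thesis using 1 by linarith
qed

text \<open>Here k p is the mean number of odd exponents, each worth about ln k. The additive 1
  bounds the remaining terms through y ln (1 / y) \<le> 1 - y at y = k p. It keeps p from being too
  small when the entropy is ln n.\<close>

lemma entropy_le:
  assumes "0 < p" "p < 1" "0 < k"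
  shows "k * entropy p \<le> k * p * ln k + 1"
proof -
  have "ln (1 / (1 - p)) \<le> 1 / (1 - p) - 1" using assms by (intro ln_le_minus_one) auto
  then have "(1 - p) * ln (1 / (1 - p)) \<le> (1 - p) * (1 / (1 - p) - 1)"
    using assms by (intro mult_left_mono) auto
  also have "\<dots> = p" using assms by (simp add: field_simps)
  finally have 1: "- (1 - p) * ln (1 - p) \<le> p" using assms by (simp add: ln_div algebra_simps)
  have "k * p * ln (1 / (k * p)) \<le> k * p * (1 / (k * p) - 1)"
    using assms by (intro mult_left_mono ln_le_minus_one) auto
  also have "\<dots> = 1 - k * p" using assms by (simp add: field_simps)
  finally have 2: "- k * p * (ln k + ln p) \<le> 1 - k * p"
    using assms by (simp add: ln_div ln_mult algebra_simps)
  have "k * (- (1 - p) * ln (1 - p)) \<le> k * p" using 1 assms by (intro mult_left_mono) auto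
  then show ?thesis using 2 by (simp add: entropy_def algebra_simps)
qed

section \<open>Deviation bounds on both sides of the entropic time\<close>

lemma variance_ratio:
  fixes k x l e c :: real
  assumes "0 < k" "0 < x" "0 < l" "0 < e"
  shows "k * (c * x) / (4 * (k * (l * (e * x)) / 4)\<^sup>2) = 4 * c / (e\<^sup>2 * (k * l\<^sup>2 * x))"
  using assms by (simp add: power2_eq_square field_simps)

text \<open>Convexity of exp between 0 and ln x; the companion for exponents above 1 follows by
  inverting the power.\<close>

lemma powr_le_linear:
  assumes "0 < x" "0 \<le> r" "r \<le> 1"
  shows "x powr r \<le> 1 - r * (1 - x :: real)"
proof -
  have "exp ((1 - r) * 0 + r * ln x) \<le> (1 - r) * exp 0 + r * exp (ln x)"
    using convex_onD[OF exp_convex, of r 0 "ln x"] assms by simp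
  then show ?thesis using assms by (simp add: powr_def algebra_simps)
qed

lemma powr_ge_linear:
  assumes "0 < x" "1 \<le> r"
  shows "1 - r * (1 - x :: real) \<le> x powr r"
proof -
  have "x = (x powr r) powr (1 / r)" using assms by (simp add: powr_powr)
  also have "\<dots> \<le> 1 - (1 / r) * (1 - x powr r)"
    using assms by (intro powr_le_linear) auto
  finally show ?thesis using assms by (simp add: field_simps)
qed

text \<open>L and L0 are the values of exp (- 2 t / k) at the time under consideration and at the time when
  the parities have entropy ln n. D is half of the distance between the mean numbers k (1 - L) / 2 and
  k (1 - L0) / 2 of odd exponents at these two times, and k (1 - L^2) / 4 is the variance.\<close>

lemma typical_above_le:
  fixes k L0 :: real
  assumes h: "0 < k" "0 < L0" "L0 < 1" "0 < \<eta>" "\<eta> \<le> 1 / 2"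
  defines "L \<equiv> L0 powr (1 + \<eta>)"
  defines "p \<equiv> (1 - L) / 2" and "Y \<equiv> k * L0\<^sup>2 * (1 - L0)" and "D \<equiv> k * (L0 - L) / 4"
  shows "exp (k * entropy ((1 - L0) / 2)) * (p powr (k * p - D) * (1 - p) powr (k - (k * p - D)))
      \<le> exp (- (\<eta> * Y / 4))"
    and "k * (1 - L\<^sup>2) / (4 * D\<^sup>2) \<le> 16 / (\<eta>\<^sup>2 * Y)" and "0 < D" and "0 < L" and "L < 1"
proof -
  have Lx: "L = L0 * L0 powr \<eta>" using h by (simp add: L_def powr_add)
  have x: "L0 powr \<eta> \<le> 1 - \<eta> * (1 - L0)" using h by (intro powr_le_linear) auto
  have "0 < \<eta> * (1 - L0)" using h by simp
  then have x1: "L0 powr \<eta> < 1" using x by linarith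
  show L0': "0 < L" using h by (simp add: L_def)
  have "L0 * L0 powr \<eta> < L0 * 1" using x1 h by (intro mult_strict_left_mono) auto
  then have LL0: "L < L0" by (simp add: Lx)
  then show L1: "L < 1" using h by simp
  show D: "0 < D" using LL0 h by (simp add: D_def)
  have gap: "L0 * (\<eta> * (1 - L0)) \<le> L0 - L"
    using mult_left_mono[OF x, of L0] h by (simp add: Lx algebra_simps)
  have p: "0 < p" "p < 1" using L0' L1 by (auto simp: p_def)
  define a where "a = k * p - D"
  \<comment> \<open>With p0 = (1 - L0) / 2 one has D = k (p - p0) / 2, so lowering the threshold
    from k p to a costs half of the tangent increment at p. By concavity this is at most half of the
    entropy gained since p0, and the other half survives.\<close>
  have "k * entropy ((1 - L0) / 2) + a * ln p + (k - a) * ln (1 - p)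
     = k * entropy ((1 - L0) / 2) - k * entropy p + (k / 2) * ((p - (1 - L0) / 2) * ln ((1 - p) / p))"
    using p by (simp add: a_def D_def entropy_def ln_div p_def[symmetric]) (simp add: p_def field_simps)
  also have "(p - (1 - L0) / 2) * ln ((1 - p) / p) \<le> entropy p - entropy ((1 - L0) / 2)"
    using entropy_gibbs[OF p, of "(1 - L0) / 2"] h by (simp add: left_diff_distrib)
  then have "k * entropy ((1 - L0) / 2) - k * entropy p + (k / 2) * ((p - (1 - L0) / 2) * ln ((1 - p) / p))
    \<le> k * entropy ((1 - L0) / 2) - k * entropy p + (k / 2) * (entropy p - entropy ((1 - L0) / 2))"
    using h by (intro add_left_mono mult_left_mono) auto
  also have "\<dots> = - (k / 2) * (entropy p - entropy ((1 - L0) / 2))" by (simp add: algebra_simps)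
  also have "\<dots> \<le> - (k / 2) * ((L0\<^sup>2 - L\<^sup>2) / 4)"
    using entropy_diff_ge[of L L0] L0' LL0 h by (intro mult_left_mono_neg) (auto simp: p_def)
  also have "\<dots> \<le> - (k / 2) * (L0\<^sup>2 * (2 * \<eta> * (1 - L0)) / 4)"
  proof -
    have "L0 powr (2 * \<eta>) \<le> 1 - 2 * \<eta> * (1 - L0)" using h by (intro powr_le_linear) auto
    moreover have "L0 powr (2 * \<eta>) = (L0 powr \<eta>)\<^sup>2"
      using h powr_add[of L0 \<eta> \<eta>] by (simp add: power2_eq_square)
    ultimately have "L0\<^sup>2 * (L0 powr \<eta>)\<^sup>2 \<le> L0\<^sup>2 * (1 - 2 * \<eta> * (1 - L0))"
      by (intro mult_left_mono) auto
    then have "L0\<^sup>2 * (2 * \<eta> * (1 - L0)) \<le> L0\<^sup>2 - L\<^sup>2"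
      by (simp add: Lx power_mult_distrib algebra_simps)
    then have "L0\<^sup>2 * (2 * \<eta> * (1 - L0)) / 4 \<le> (L0\<^sup>2 - L\<^sup>2) / 4"
      by (rule divide_right_mono) simp
    then show ?thesis using h by (intro mult_left_mono_neg) auto
  qed
  also have "\<dots> = - (\<eta> * Y / 4)" by (simp add: Y_def field_simps)
  finally have e: "k * entropy ((1 - L0) / 2) + a * ln p + (k - a) * ln (1 - p) \<le> - (\<eta> * Y / 4)" .
  have "exp (k * entropy ((1 - L0) / 2)) * (p powr a * (1 - p) powr (k - a))
     = exp (k * entropy ((1 - L0) / 2) + a * ln p + (k - a) * ln (1 - p))"
    using p by (simp add: powr_def exp_add)
  then show "exp (k * entropy ((1 - L0) / 2)) * (p powr (k * p - D) * (1 - p) powr (k - (k * p - D)))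
      \<le> exp (- (\<eta> * Y / 4))"
    using e by (simp add: a_def)
  have "1 - (1 + \<eta>) * (1 - L0) \<le> L" unfolding L_def using h by (intro powr_ge_linear) auto
  moreover have "(1 + \<eta>) * (1 - L0) \<le> 2 * (1 - L0)" using h by (intro mult_right_mono) auto
  ultimately have v1: "1 - L \<le> 2 * (1 - L0)" by linarith
  have "1 - L\<^sup>2 \<le> 2 * (1 - L)"
    using zero_le_power2[of "1 - L"] by (simp add: power2_eq_square algebra_simps)
  also have "\<dots> \<le> 4 * (1 - L0)" using v1 by simp
  finally have v: "1 - L\<^sup>2 \<le> 4 * (1 - L0)" .
  have D2: "(k * (L0 * (\<eta> * (1 - L0))) / 4)\<^sup>2 \<le> D\<^sup>2"
    unfolding D_def using gap h by (intro power_mono divide_right_mono mult_left_mono) auto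
  have "k * (1 - L\<^sup>2) / (4 * D\<^sup>2) \<le> k * (4 * (1 - L0)) / (4 * (k * (L0 * (\<eta> * (1 - L0))) / 4)\<^sup>2)"
    using v D2 h by (intro frac_le mult_left_mono) auto
  also have "\<dots> = 16 / (\<eta>\<^sup>2 * Y)"
    by (subst variance_ratio) (use h in \<open>auto simp: Y_def\<close>)
  finally show "k * (1 - L\<^sup>2) / (4 * D\<^sup>2) \<le> 16 / (\<eta>\<^sup>2 * Y)" .
qed

text \<open>The threshold k p + D lies halfway between the two means, hence equals k p0 - D.
  Comparing with bits of bias p0 therefore leaves exactly - D times the slope ln ((1 - p0) / p0),
  which is at least 2 L0.\<close>

lemma typical_below_le:
  fixes k L0 :: real
  assumes h: "0 < k" "0 < L0" "L0 < 1" "0 < \<eta>" "\<eta> \<le> 1 / 2"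
  defines "L \<equiv> L0 powr (1 - \<eta>)" and "p0 \<equiv> (1 - L0) / 2"
  defines "p \<equiv> (1 - L) / 2" and "Y \<equiv> k * L0\<^sup>2 * (1 - L0)" and "D \<equiv> k * (L - L0) / 4"
  shows "p0 powr (- (k * p + D)) * (1 - p0) powr ((k * p + D) - k) / exp (k * entropy p0)
      \<le> exp (- (\<eta> * Y / 2))"
    and "k * (1 - L\<^sup>2) / (4 * D\<^sup>2) \<le> 8 / (\<eta>\<^sup>2 * Y)" and "0 < D" and "0 < L" and "L < 1"
proof -
  have "L * L0 powr \<eta> = L0" using h by (simp add: L_def powr_add[symmetric])
  have x: "L0 powr \<eta> \<le> 1 - \<eta> * (1 - L0)" using h by (intro powr_le_linear) auto
  have x0: "0 < \<eta> * (1 - L0)" using h by simp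
  then have x1: "L0 powr \<eta> < 1" using x by linarith
  show Lpos: "0 < L" using h by (simp add: L_def)
  have "L * L0 powr \<eta> < L * 1" using x1 Lpos by (intro mult_strict_left_mono) auto
  then have LL0: "L0 < L" using \<open>L * L0 powr \<eta> = L0\<close> by simp
  have "L0 powr (1 - \<eta>) < 1 powr (1 - \<eta>)" using h by (intro powr_less_mono2) auto
  then show L1: "L < 1" by (simp add: L_def)
  show D: "0 < D" using LL0 h by (simp add: D_def)
  have "L0 * (\<eta> * (1 - L0)) \<le> L * (\<eta> * (1 - L0))"
    using LL0 x0 by (intro mult_right_mono) auto
  also have "\<dots> \<le> L * (1 - L0 powr \<eta>)" using x Lpos by (intro mult_left_mono) auto
  also have "\<dots> = L - L0" using \<open>L * L0 powr \<eta> = L0\<close> by (simp add: algebra_simps)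
  finally have gap: "L0 * (\<eta> * (1 - L0)) \<le> L - L0" .
  have p: "0 < p0" "p0 < 1" using h by (auto simp: p0_def)
  define b where "b = k * p + D"
  have b: "b = k * p0 - D" by (simp add: b_def D_def p_def p0_def field_simps)
  have r: "(1 - p0) / p0 = (1 + L0) / (1 - L0)" using h by (simp add: p0_def field_simps)
  have "- b * ln p0 + (b - k) * ln (1 - p0) - k * entropy p0 = - D * ln ((1 - p0) / p0)"
    using p by (simp add: b entropy_def ln_div algebra_simps)
  also have "\<dots> \<le> - D * (2 * L0)"
    unfolding r using ln_ratio_ge[of L0] h D by (intro mult_left_mono_neg) auto
  also have "\<dots> = - (k * L0 / 2) * (L - L0)" by (simp add: D_def)
  also have "\<dots> \<le> - (k * L0 / 2) * (L0 * (\<eta> * (1 - L0)))"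
    using gap h by (intro mult_left_mono_neg) auto
  also have "\<dots> = - (\<eta> * Y / 2)" by (simp add: Y_def power2_eq_square)
  finally have e: "- b * ln p0 + (b - k) * ln (1 - p0) - k * entropy p0 \<le> - (\<eta> * Y / 2)" .
  have "p0 powr (- b) * (1 - p0) powr (b - k) / exp (k * entropy p0)
     = exp (- b * ln p0 + (b - k) * ln (1 - p0) - k * entropy p0)"
    using p by (simp add: powr_def flip: exp_add exp_diff)
  then show "p0 powr (- (k * p + D)) * (1 - p0) powr ((k * p + D) - k) / exp (k * entropy p0)
      \<le> exp (- (\<eta> * Y / 2))"
    using e by (simp add: b_def)
  have "1 - L\<^sup>2 \<le> 2 * (1 - L)"
    using zero_le_power2[of "1 - L"] by (simp add: power2_eq_square algebra_simps)
  also have "\<dots> \<le> 2 * (1 - L0)" using LL0 by simp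
  finally have v: "1 - L\<^sup>2 \<le> 2 * (1 - L0)" .
  have D2: "(k * (L0 * (\<eta> * (1 - L0))) / 4)\<^sup>2 \<le> D\<^sup>2"
    unfolding D_def using gap h by (intro power_mono divide_right_mono mult_left_mono) auto
  have "k * (1 - L\<^sup>2) / (4 * D\<^sup>2) \<le> k * (2 * (1 - L0)) / (4 * (k * (L0 * (\<eta> * (1 - L0))) / 4)\<^sup>2)"
    using v D2 h by (intro frac_le mult_left_mono) auto
  also have "\<dots> = 8 / (\<eta>\<^sup>2 * Y)"
    by (subst variance_ratio) (use h in \<open>auto simp: Y_def\<close>)
  finally show "k * (1 - L\<^sup>2) / (4 * D\<^sup>2) \<le> 8 / (\<eta>\<^sup>2 * Y)" .
qed

section \<open>Mixing times\<close>

lemma t_mix_le_whp: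
  fixes G (structure) and L0 \<eta> \<epsilon> :: real and s :: direction
  assumes G: "nilpotent_group G" "finite (carrier G)" "card (carrier G) = n" "n \<ge> 2" "k > 0"
    and h: "0 < L0" "L0 < 1" "0 < \<eta>" "\<eta> \<le> 1 / 2" "0 < \<epsilon>"
    and ent: "real k * entropy ((1 - L0) / 2) = ln (real n)"
  defines "Y \<equiv> real k * L0\<^sup>2 * (1 - L0)"
  assumes small: "16 / (\<eta>\<^sup>2 * Y) \<le> \<epsilon> / 2"
  shows "1 - 4 * (exp (- (\<eta> * Y / 4)) + 2 * (16 / (\<eta>\<^sup>2 * Y))) / \<epsilon>\<^sup>2
    \<le> measure_pmf.prob (random_generators G k)
        {Z. t_mix s G Z \<epsilon> \<le> ereal ((1 + \<eta>) * (real k / 2 * ln (1 / L0)))}"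
proof -
  define t where "t = (1 + \<eta>) * (real k / 2 * ln (1 / L0))"
  define L where "L = L0 powr (1 + \<eta>)"
  define p where "p = (1 - L) / 2"
  define D where "D = real k * (L0 - L) / 4"
  define a where "a = real k * p - D"
  define \<beta> where "\<beta> = measure_pmf.prob (word_pmf s k t) {w. real (odd_count k w) < a}"
  have k: "0 < real k" using G by simp
  have t: "0 < t" unfolding t_def using h k by (intro mult_pos_pos) (auto simp: ln_gt_zero)
  have Lt: "exp (- 2 * (t / real k)) = L"
    using h k by (simp add: L_def t_def powr_def ln_div)
  note above = typical_above_le[OF k h(1-4), folded L_def, folded p_def Y_def D_def, folded a_def]
  have "\<beta> \<le> measure_pmf.prob (word_pmf s k t) {w. \<bar>real (odd_count k w) - real k * ((1 - L) / 2)\<bar> \<ge> D}"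
    unfolding \<beta>_def by (rule measure_pmf.finite_measure_mono) (auto simp: a_def p_def)
  also have "\<dots> \<le> real k * (1 - L\<^sup>2) / (4 * D\<^sup>2)"
    using odd_count_chebyshev[OF G(5) less_imp_le[OF t] above(3), of s] unfolding Lt .
  also note above(2)
  finally have \<beta>: "\<beta> \<le> 16 / (\<eta>\<^sup>2 * Y)" .
  have "real n = exp (real k * entropy ((1 - L0) / 2))" using ent G(4) by simp
  then have main: "real n * (p powr a * (1 - p) powr (real k - a)) \<le> exp (- (\<eta> * Y / 4))"
    using above(1) by simp
  have "1 - 4 * (exp (- (\<eta> * Y / 4)) + 2 * (16 / (\<eta>\<^sup>2 * Y))) / \<epsilon>\<^sup>2
     \<le> 1 - 4 * (real n * (p powr a * (1 - p) powr (real k - a)) + 2 * \<beta>) / \<epsilon>\<^sup>2"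
    using main \<beta> by (intro diff_left_mono divide_right_mono mult_left_mono add_mono) auto
  also have "\<dots> \<le> measure_pmf.prob (random_generators G k)
        {Z. tv_dist (cayley_rw s G Z t) (pmf_of_set (carrier G)) \<le> \<epsilon>}"
    using tv_dist_le_whp[OF G t h(5), of s a] \<beta> small unfolding Lt p_def \<beta>_def by simp
  also have "\<dots> \<le> measure_pmf.prob (random_generators G k) {Z. t_mix s G Z \<epsilon> \<le> ereal t}"
    unfolding t_mix_def using t
    by (intro measure_pmf.finite_measure_mono) (auto intro!: Inf_lower)
  finally show ?thesis by (simp add: t_def)
qed

text \<open>The bound holds for every choice of generators. All times below the threshold are
  excluded directly: at an earlier time \<open>Lt\<close> is at least L, so both the mean and the
  variance of the number of odd exponents are smaller, and the Chebyshev bound computed with L still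
  applies.\<close>

lemma t_mix_ge:
  fixes L0 \<eta> \<epsilon> :: real
  assumes zs: "zs \<in> tuples (Z2_power d) k" "k > 0" and n: "0 < n" "n \<le> 2 ^ d"
    and h: "0 < L0" "L0 < 1" "0 < \<eta>" "\<eta> \<le> 1 / 2"
    and ent: "real k * entropy ((1 - L0) / 2) = ln (real n)"
  defines "Y \<equiv> real k * L0\<^sup>2 * (1 - L0)"
  assumes small: "exp (- (\<eta> * Y / 2)) + 8 / (\<eta>\<^sup>2 * Y) < 1 - \<epsilon>"
  shows "ereal ((1 - \<eta>) * (real k / 2 * ln (1 / L0))) \<le> t_mix s (Z2_power d) (mset zs) \<epsilon>"
  unfolding t_mix_def
proof (rule Inf_greatest, safe)
  fix t assume t: "0 \<le> t"
    and tv: "tv_dist (cayley_rw s (Z2_power d) (mset zs) t) (pmf_of_set (carrier (Z2_power d))) \<le> \<epsilon>"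
  define L where "L = L0 powr (1 - \<eta>)"
  define p0 where "p0 = (1 - L0) / 2"
  define p where "p = (1 - L) / 2"
  define D where "D = real k * (L - L0) / 4"
  define b where "b = real k * p + D"
  define Lt where "Lt = exp (- 2 * (t / real k))"
  have k: "0 < real k" using zs by simp
  note below = typical_below_le[OF k h(1-4), folded L_def, folded p0_def p_def Y_def D_def, folded b_def]
  show "ereal ((1 - \<eta>) * (real k / 2 * ln (1 / L0))) \<le> ereal t"
  proof (rule ccontr)
    assume "\<not> ?thesis"
    then have "t < (1 - \<eta>) * (real k / 2 * ln (1 / L0))" by simp
    then have "t / real k < (1 - \<eta>) * (real k / 2 * ln (1 / L0)) / real k"
      using k by (rule divide_strict_right_mono)
    also have "\<dots> = - ((1 - \<eta>) * ln L0) / 2" using k h by (simp add: ln_div)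
    finally have "exp ((1 - \<eta>) * ln L0) \<le> Lt" unfolding Lt_def by simp
    then have LLt: "L \<le> Lt" using h by (simp add: L_def powr_def)
    have "1 - measure_pmf.prob (word_pmf s k t) {w. real (odd_count k w) \<le> b}
        = measure_pmf.prob (word_pmf s k t) {w. b < real (odd_count k w)}"
      using measure_pmf.prob_compl[of "{w. real (odd_count k w) \<le> b}" "word_pmf s k t"]
      by (simp add: Compl_eq_Diff_UNIV[symmetric] Collect_neg_eq[symmetric] not_le)
    also have "\<dots> \<le> measure_pmf.prob (word_pmf s k t) {w. \<bar>real (odd_count k w) - real k * ((1 - Lt) / 2)\<bar> \<ge> D}"
    proof (rule measure_pmf.finite_measure_mono)
      have "real k * ((1 - Lt) / 2) \<le> real k * p" using LLt by (simp add: p_def mult_left_mono)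
      then show "{w. b < real (odd_count k w)} \<subseteq> {w. \<bar>real (odd_count k w) - real k * ((1 - Lt) / 2)\<bar> \<ge> D}"
        by (auto simp: b_def)
    qed simp
    also have "\<dots> \<le> real k * (1 - Lt\<^sup>2) / (4 * D\<^sup>2)"
      unfolding Lt_def by (rule odd_count_chebyshev[OF zs(2) t below(3)])
    also have "\<dots> \<le> real k * (1 - L\<^sup>2) / (4 * D\<^sup>2)"
      using LLt below(4) power_mono[of L Lt 2] by (intro divide_right_mono mult_left_mono) auto
    also note below(2)
    finally have 1: "1 - measure_pmf.prob (word_pmf s k t) {w. real (odd_count k w) \<le> b} \<le> 8 / (\<eta>\<^sup>2 * Y)" .
    have p0: "0 < p0" "p0 \<le> 1 / 2" using h by (auto simp: p0_def)
    have en: "exp (real k * entropy p0) = real n" using ent n by (simp add: p0_def)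
    \<comment> \<open>Here the group of order 2^d is compared with n: a larger group only makes the
      test set less likely under the uniform law.\<close>
    have "p0 powr (- b) * (1 - p0) powr (b - real k) / 2 ^ d
        \<le> p0 powr (- b) * (1 - p0) powr (b - real k) / real n"
    proof (rule divide_left_mono)
      have "real n \<le> real (2 ^ d)" using n(2) by (simp only: of_nat_le_iff)
      then show "real n \<le> 2 ^ d" by simp
    qed (use n in auto)
    also have "\<dots> \<le> exp (- (\<eta> * Y / 2))" using below(1) unfolding en .
    finally show False
      using Z2_power_tv_dist_ge[OF zs p0, of s t b] 1 tv small by linarith
  qed
qed

theorem theorem3:
  fixes d n k :: "nat \<Rightarrow> nat"
    and G :: "nat \<Rightarrow> ('a, 'b) monoid_scheme"
    and s :: direction
  assumes "filterlim d at_top sequentially"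
    and "filterlim n at_top sequentially"
    and "\<And>N. n N \<le> 2 ^ d N"
    and "\<And>N. nilpotent_group (G N)"
    and "\<And>N. finite (carrier (G N))"
    and "\<And>N. card (carrier (G N)) = n N"
    and "filterlim (\<lambda>N. real (k N) - log 2 (real (n N))) at_top sequentially"
    and "(\<lambda>N. ln (real (k N)) / ln (real (n N))) \<longlonglongrightarrow> 0"
  shows "t_mix_ratio_le_1_whp s
           G (\<lambda>N. random_generators (G N) (k N))
           (\<lambda>N. Z2_power (d N)) (\<lambda>N. random_generators (Z2_power (d N)) (k N))"
proof -
  \<comment> \<open>The second condition gives ln n < k ln 2, so that \<open>L0\<close> exists; the
    first gives ln n \<ge> 2, which absorbs the additive 1 of \<open>entropy_le\<close>.\<close>
  define good where "good N \<longleftrightarrow> exp 2 \<le> real (n N) \<and> 0 < real (k N) - log 2 (real (n N))" for N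
  have nlim: "filterlim (\<lambda>N. real (n N)) at_top sequentially"
    by (rule filterlim_compose[OF filterlim_real_sequentially assms(2)])
  have ev_good: "eventually good sequentially"
    using filterlim_at_top_dense[THEN iffD1, OF assms(7), rule_format, of 0]
      filterlim_at_top[THEN iffD1, OF nlim, rule_format, of "exp 2"]
    unfolding good_def by eventually_elim auto
  have n2: "2 \<le> n N" if "good N" for N
  proof -
    have "2 \<le> exp (2::real)" using exp_ge_add_one_self[of 2] by linarith
    then show ?thesis using that unfolding good_def by linarith
  qed
  have lnn: "2 \<le> ln (real (n N))" if "good N" for N
    using that n2[OF that] ln_ge_iff[of "real (n N)" 2] by (simp add: good_def)
  have k2: "2 \<le> k N" if "good N" for N
  proof -
    have "1 \<le> log 2 (real (n N))" using n2[OF that] by simp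
    then show ?thesis using that by (simp add: good_def)
  qed
  have "\<exists>L. good N \<longrightarrow> 0 < L \<and> L < 1 \<and> real (k N) * entropy ((1 - L) / 2) = ln (real (n N))" for N
  proof (cases "good N")
    case True
    have kp: "real (k N) > 0" using k2[OF True] by simp
    have "ln (real (n N)) < real (k N) * ln 2"
      using True by (simp add: good_def log_def field_simps)
    then obtain p where p: "0 < p" "p < 1 / 2" "entropy p = ln (real (n N)) / real (k N)"
      using entropy_exists[of "ln (real (n N)) / real (k N)"] kp lnn[OF True] by (auto simp: field_simps)
    then show ?thesis using kp by (intro exI[of _ "1 - 2 * p"]) auto
  qed auto
  then obtain L0 where L0: "\<And>N. good N \<Longrightarrow> 0 < L0 N" "\<And>N. good N \<Longrightarrow> L0 N < 1"
    "\<And>N. good N \<Longrightarrow> real (k N) * entropy ((1 - L0 N) / 2) = ln (real (n N))"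
    by metis
  define Y where "Y N = real (k N) * (L0 N)\<^sup>2 * (1 - L0 N)" for N
  \<comment> \<open>The time at which exp(- 2 t / k) equals \<open>L0\<close>.\<close>
  define \<gamma> where "\<gamma> N = real (k N) / 2 * ln (1 / L0 N)" for N
  \<comment> \<open>The exponent - 1/3 makes \<eta> tend to 0 while \<eta> Y = Y^(2/3) and \<eta>^2
    Y = Y^(1/3) still diverge.\<close>
  define \<eta> where "\<eta> N = Y N powr (- 1 / 3)" for N
  \<comment> \<open>If L0 \<le> 1/2, the factor 1 - L0 is harmless and the entropy deficit bounds k
    L0^2 from below; otherwise L0^2 is harmless and the mean number k (1 - L0) / 2 of odd exponents
    must be large to carry entropy ln n.\<close>
  have Y_ge: "min ((real (k N) - log 2 (real (n N))) * (ln 2 / 2)) (inverse (ln (real (k N)) / ln (real (n N))) / 4) \<le> Y N"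
    if g: "good N" for N
  proof (cases "L0 N \<le> 1 / 2")
    case True
    have "real (k N) * (ln 2 - entropy ((1 - L0 N) / 2)) \<le> real (k N) * (L0 N)\<^sup>2"
      using ln_2_minus_entropy_le[OF L0(1,2)[OF g]] by (rule mult_left_mono) simp
    then have "(real (k N) - log 2 (real (n N))) * ln 2 \<le> real (k N) * (L0 N)\<^sup>2"
      using L0(3)[OF g] by (simp add: log_def algebra_simps)
    moreover have "real (k N) * (L0 N)\<^sup>2 * (1 / 2) \<le> Y N"
      unfolding Y_def using True by (intro mult_left_mono) auto
    ultimately show ?thesis by simp
  next
    case False
    have lk: "0 < ln (real (k N))" using k2[OF g] by simp
    have "ln (real (n N)) \<le> real (k N) * ((1 - L0 N) / 2) * ln (real (k N)) + 1"
      using entropy_le[of "(1 - L0 N) / 2" "real (k N)"] L0[OF g] k2[OF g] by simp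
    then have "ln (real (n N)) / 2 \<le> real (k N) * ((1 - L0 N) / 2) * ln (real (k N))"
      using lnn[OF g] by linarith
    then have "ln (real (n N)) / ln (real (k N)) / 4 \<le> real (k N) * (1 - L0 N) * (1 / 4)"
      using lk by (simp add: field_simps)
    also have "\<dots> \<le> real (k N) * (1 - L0 N) * (L0 N)\<^sup>2"
      using power_mono[of "1 / 2" "L0 N" 2] False L0[OF g]
      by (intro mult_left_mono) (auto simp: power2_eq_square)
    finally show ?thesis by (simp add: Y_def mult_ac)
  qed
  have ratio: "filterlim (\<lambda>N. inverse (ln (real (k N)) / ln (real (n N))) / 4) at_top sequentially"
  proof -
    have "eventually (\<lambda>N. 0 < ln (real (k N)) / ln (real (n N))) sequentially"
      using ev_good
    proof eventually_elim
      case (elim N)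
      have "0 < ln (real (k N))" "0 < ln (real (n N))" using k2[OF elim] lnn[OF elim] by auto
      then show ?case by simp
    qed
    then have "filterlim (\<lambda>N. inverse (ln (real (k N)) / ln (real (n N)))) at_top sequentially"
      by (rule filterlim_inverse_at_top[OF assms(8)])
    then have "filterlim (\<lambda>N. inverse (ln (real (k N)) / ln (real (n N))) * (1 / 4)) at_top sequentially"
      by (rule filterlim_at_top_mult_tendsto_pos[OF tendsto_const, rotated]) simp
    then show ?thesis by (simp only: times_divide_eq_right mult_1_right)
  qed
  have first: "filterlim (\<lambda>N. (real (k N) - log 2 (real (n N))) * (ln 2 / 2)) at_top sequentially"
    using filterlim_at_top_mult_tendsto_pos[OF tendsto_const[of "ln 2 / 2"] _ assms(7)] by simp
  have Ylim: "filterlim Y at_top sequentially"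
    unfolding filterlim_at_top
  proof
    fix Z
    show "eventually (\<lambda>N. Z \<le> Y N) sequentially"
      using ev_good filterlim_at_top[THEN iffD1, OF first, rule_format, of Z]
        filterlim_at_top[THEN iffD1, OF ratio, rule_format, of Z]
    proof eventually_elim
      case (elim N)
      then show ?case using Y_ge[of N] by linarith
    qed
  qed
  have comp: "((\<lambda>N. f (Y N)) \<longlongrightarrow> c) sequentially" if "(f \<longlongrightarrow> c) at_top" for f :: "real \<Rightarrow> real" and c
    using filterlim_compose[OF that Ylim] .
  have "((\<lambda>y. y powr (- 1 / 3)) \<longlongrightarrow> 0) (at_top :: real filter)" by real_asymp
  then have \<eta>lim: "\<eta> \<longlonglongrightarrow> 0" unfolding \<eta>_def by (rule comp)
  have "eventually (\<lambda>N. \<eta> N < 1 / 2) sequentially"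
    using \<eta>lim by (rule order_tendstoD) simp
  then have ev_\<eta>: "eventually (\<lambda>N. good N \<and> 0 < \<eta> N \<and> \<eta> N \<le> 1 / 2) sequentially"
    using ev_good filterlim_at_top_dense[THEN iffD1, OF Ylim, rule_format, of 0]
    by eventually_elim (auto simp: \<eta>_def)
  show ?thesis
    unfolding t_mix_ratio_le_1_whp_def
  proof (rule exI[of _ \<gamma>], rule exI[of _ \<eta>], intro conjI ballI \<eta>lim)
    fix \<epsilon> \<epsilon>' :: real assume "\<epsilon> \<in> {0<..<1}" "\<epsilon>' \<in> {0<..<1}"
    then have \<epsilon>: "0 < \<epsilon>" "\<epsilon> < 1" by auto
    have "((\<lambda>y. 16 / ((y powr (- 1 / 3))\<^sup>2 * y)) \<longlongrightarrow> 0) (at_top :: real filter)" by real_asymp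
    from comp[OF this] have "eventually (\<lambda>N. 16 / ((\<eta> N)\<^sup>2 * Y N) < \<epsilon> / 2) sequentially"
      unfolding \<eta>_def using \<epsilon> by (intro order_tendstoD(2)) auto
    with ev_\<eta> have lb: "eventually (\<lambda>N. 1 - 4 * (exp (- (\<eta> N * Y N / 4)) + 2 * (16 / ((\<eta> N)\<^sup>2 * Y N))) / \<epsilon>\<^sup>2
      \<le> measure_pmf.prob (random_generators (G N) (k N))
          {Z. t_mix s (G N) Z \<epsilon> \<le> ereal ((1 + \<eta> N) * \<gamma> N)}) sequentially"
    proof eventually_elim
      case (elim N)
      then have g: "good N" by simp
      have "k N > 0" using k2[OF g] by simp
      then show ?case
        unfolding \<gamma>_def Y_def
        using elim \<epsilon> L0[OF g] n2[OF g] by (intro t_mix_le_whp) (auto simp: Y_def assms)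
    qed
    have "((\<lambda>y. 1 - 4 * (exp (- (y powr (- 1 / 3) * y / 4)) + 2 * (16 / ((y powr (- 1 / 3))\<^sup>2 * y))) / \<epsilon>\<^sup>2) \<longlongrightarrow> 1)
        (at_top :: real filter)"
    proof -
      have "((\<lambda>y. exp (- (y powr (- 1 / 3) * y / 4)) + 2 * (16 / ((y powr (- 1 / 3))\<^sup>2 * y))) \<longlongrightarrow> 0)
          (at_top :: real filter)" by real_asymp
      then have "((\<lambda>y. 1 - 4 * (exp (- (y powr (- 1 / 3) * y / 4)) + 2 * (16 / ((y powr (- 1 / 3))\<^sup>2 * y))) / \<epsilon>\<^sup>2)
          \<longlongrightarrow> 1 - 4 * 0 / \<epsilon>\<^sup>2) (at_top :: real filter)"
        using \<epsilon> by (intro tendsto_intros) auto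
      then show ?thesis by simp
    qed
    from comp[OF this] have lim: "(\<lambda>N. 1 - 4 * (exp (- (\<eta> N * Y N / 4)) + 2 * (16 / ((\<eta> N)\<^sup>2 * Y N))) / \<epsilon>\<^sup>2) \<longlonglongrightarrow> 1"
      by (simp add: \<eta>_def)
    show "(\<lambda>N. measure_pmf.prob (random_generators (G N) (k N))
          {Z. t_mix s (G N) Z \<epsilon> \<le> ereal ((1 + \<eta> N) * \<gamma> N)}) \<longlonglongrightarrow> 1"
      by (rule tendsto_sandwich[OF lb _ lim tendsto_const]) simp
  next
    fix \<epsilon> \<epsilon>' :: real assume "\<epsilon> \<in> {0<..<1}" "\<epsilon>' \<in> {0<..<1}"
    then have \<epsilon>': "\<epsilon>' < 1" by auto
    have "((\<lambda>y. exp (- (y powr (- 1 / 3) * y / 2)) + 8 / ((y powr (- 1 / 3))\<^sup>2 * y)) \<longlongrightarrow> 0) (at_top :: real filter)"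
      by real_asymp
    from comp[OF this] have "eventually (\<lambda>N. exp (- (\<eta> N * Y N / 2)) + 8 / ((\<eta> N)\<^sup>2 * Y N) < 1 - \<epsilon>') sequentially"
      unfolding \<eta>_def using \<epsilon>' by (intro order_tendstoD(2)) auto
    \<comment> \<open>The lower bound is deterministic in the generators, so this probability is
      eventually equal to 1.\<close>
    with ev_\<eta> have "eventually (\<lambda>N. measure_pmf.prob (random_generators (Z2_power (d N)) (k N))
          {Z. ereal ((1 - \<eta> N) * \<gamma> N) \<le> t_mix s (Z2_power (d N)) Z \<epsilon>'} = 1) sequentially"
    proof eventually_elim
      case (elim N)
      then have g: "good N" by simp
      have kp: "k N > 0" using k2[OF g] by simp
      have ge: "ereal ((1 - \<eta> N) * \<gamma> N) \<le> t_mix s (Z2_power (d N)) (mset zs) \<epsilon>'"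
        if "zs \<in> tuples (Z2_power (d N)) (k N)" for zs
        unfolding \<gamma>_def
        using elim L0[OF g] n2[OF g] by (intro t_mix_ge[OF that kp _ assms(3)]) (auto simp: Y_def)
      interpret H: comm_group "Z2_power (d N)" by (rule comm_group_Z2_power)
      have ne: "carrier (Z2_power (d N)) \<noteq> {}" using H.one_closed by blast
      have "set_pmf (random_generators (Z2_power (d N)) (k N)) \<subseteq> mset ` tuples (Z2_power (d N)) (k N)"
        by (auto simp: random_generators_def set_replicate_pmf finite_carrier_Z2_power ne)
      then show ?case
        using ge by (subst measure_pmf.prob_eq_1) (auto intro!: AE_pmfI)
    qed
    then show "(\<lambda>N. measure_pmf.prob (random_generators (Z2_power (d N)) (k N))
          {Z. ereal ((1 - \<eta> N) * \<gamma> N) \<le> t_mix s (Z2_power (d N)) Z \<epsilon>'}) \<longlonglongrightarrow> 1"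
      by (rule tendsto_eventually)
  qed
qed

end
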